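(* As $n\to\infty$, $$\mathrm{TV}^n+\chi_{C^n}\ \longrightarrow\ \mathrm{TV}+\chi_C$$ in the sense of $\Gamma$-convergence with respect to the $L^1$ topology (on $L^1((0,1)^2)$), where $$C^n:=\{v\ :\ v=1\text{ on }\Omega_s^n,\ v=0\text{ on }[0,1]^2\setminus\Omega^n\},\qquad C:=\{v\ :\ v=1\text{ on }\Omega_s,\ v=0\text{ on }[0,1]^2\setminus\Omega\}.$$
   Context: Setting: $\Omega_s\subset\Omega\Subset(0,1)^2$ are bounded, open and strongly Lipschitz subsets of $\mathbb{R}^2$, $\partial\Omega_s\cap\partial\Omega=\emptyset$, and $\Omega_s$ has finitely many connected components. Cells: for $(i,j)\in\{1,\dots,n-1\}^2$, $$R_{ij}^n:=\frac1n\Big(i-\frac12,i+\frac12\Big)\times\frac1n\Big(j-\frac12,j+\frac12\Big).$$ For a set $E$, $E-B(\frac1n):=\{x\in E : d(x,\partial E)>\frac1n\}$. The discrete domains are $$\Omega_s^n:=\bigcup_{R_{ij}^n\subset\Omega_s-B(\frac1n)}R_{ij}^n,\qquad \Omega^n:=[0,1]^2\setminus\Big(\bigcup_{R_{ij}^n\subset([0,1]^2\setminus\Omega)-B(\frac1n)}R_{ij}^n\Big).$$ Discrete total variation: if $v$ is piecewise constant on the cells $R_{ij}^n$, i.e. $v=\sum_{i,j}v^{ij}1_{R_{ij}^n}$ a.e., set $$(\nabla v)^{ij}:=\big(v^{i+1,j}-v^{i,j},\ v^{i-1,j}-v^{i,j},\ v^{i,j+1}-v^{i,j},\ v^{i,j-1}-v^{i,j}\big)\in\mathbb{R}^4$$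 (with $v^{ij}:=0$ for indices outside the grid) and $$\mathrm{TV}^n(v):=\frac1n\sum_{i,j}\big|(\nabla v)^{ij}\vee0\big|,$$ where $\vee0$ denotes taking the positive part of each component and $|\cdot|$ is the Euclidean norm. If $v$ is not of this form, $\mathrm{TV}^n(v):=+\infty$. $\mathrm{TV}(v)$ is the usual total variation (total mass of the distributional gradient, $+\infty$ if it is not a finite measure). For a set $A$, $\chi_A$ is the convex-analysis indicator: $\chi_A(v)=0$ if $v\in A$ and $+\infty$ otherwise. Equalities of functions are a.e. *)

theory Defs
  imports "HOL-Analysis.Analysis"
begin

text \<open>
  Elements of \<open>L\<^sup>1(M)\<close> are represented by integrable functions; the functionals used below only
  depend on the a.e. class. Since the \<open>L\<^sup>1\<close> topology is metrizable, Gamma-convergence is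
  given by the liminf inequality along all sequences together with recovery sequences.
\<close>

definition converges_L1 ::
  "'a measure \<Rightarrow> (nat \<Rightarrow> 'a \<Rightarrow> real) \<Rightarrow> ('a \<Rightarrow> real) \<Rightarrow> bool" where
  "converges_L1 M w u \<longleftrightarrow>
     (\<forall>n. integrable M (w n)) \<and> integrable M u \<and>
     (\<lambda>n. \<integral>x. \<bar>w n x - u x\<bar> \<partial>M) \<longlonglongrightarrow> 0"

definition gamma_converges_L1 ::
  "'a measure \<Rightarrow> (nat \<Rightarrow> ('a \<Rightarrow> real) \<Rightarrow> ennreal) \<Rightarrow> (('a \<Rightarrow> real) \<Rightarrow> ennreal) \<Rightarrow> bool" where
  "gamma_converges_L1 M F G \<longleftrightarrow>
     (\<forall>u. integrable M u \<longrightarrow>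
        (\<forall>w. converges_L1 M w u \<longrightarrow> G u \<le> liminf (\<lambda>n. F n (w n))) \<and>
        (\<exists>w. converges_L1 M w u \<and> limsup (\<lambda>n. F n (w n)) \<le> G u))"

definition convex_indicator :: "'v set \<Rightarrow> 'v \<Rightarrow> ennreal" where
  "convex_indicator A v = (if v \<in> A then 0 else \<infinity>)"

definition partial_deriv :: "'a::euclidean_space \<Rightarrow> ('a \<Rightarrow> real) \<Rightarrow> 'a \<Rightarrow> real" where
  "partial_deriv b f x = frechet_derivative f (at x) b"

definition smooth :: "('a::euclidean_space \<Rightarrow> real) \<Rightarrow> bool" where
  "smooth f \<longleftrightarrow> (\<forall>bs. set bs \<subseteq> Basis \<longrightarrow> foldr partial_deriv bs f differentiable_on UNIV)"

definition test_functions :: "'a::euclidean_space set \<Rightarrow> ('a \<Rightarrow> real) set" where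
  "test_functions U =
     {\<phi>. smooth \<phi> \<and> compact (closure {x. \<phi> x \<noteq> 0}) \<and> closure {x. \<phi> x \<noteq> 0} \<subseteq> U}"

text \<open>
  The distributional gradient of \<open>v\<close> on \<open>U\<close> is the finite vector measure \<open>\<sigma> \<mu>\<close>, given by its
  polar decomposition: a unit field \<open>\<sigma>\<close> and a finite Borel measure \<open>\<mu>\<close>, which is then the
  variation measure of the gradient.
\<close>

definition has_gradient_measure ::
  "('a::euclidean_space \<Rightarrow> real) \<Rightarrow> 'a set \<Rightarrow> ('a \<Rightarrow> 'a) \<Rightarrow> 'a measure \<Rightarrow> bool" where
  "has_gradient_measure v U \<sigma> \<mu> \<longleftrightarrow>
     finite_measure \<mu> \<and> sets \<mu> = sets (restrict_space borel U) \<and>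
     \<sigma> \<in> borel_measurable \<mu> \<and> (AE x in \<mu>. norm (\<sigma> x) = 1) \<and>
     (\<forall>\<phi>\<in>test_functions U. \<forall>b\<in>Basis.
        (\<integral>x. v x * partial_deriv b \<phi> x \<partial>lebesgue_on U) = - (\<integral>x. \<phi> x * (\<sigma> x \<bullet> b) \<partial>\<mu>))"

text \<open>
  For open \<open>U\<close> and integrable \<open>v\<close>, \<open>\<mu>\<close> is determined by \<open>v\<close>, so the infimum ranges over at most
  one value; it is \<open>\<infinity>\<close> if the gradient is not a finite measure.
\<close>

definition total_variation :: "'a::euclidean_space set \<Rightarrow> ('a \<Rightarrow> real) \<Rightarrow> ennreal" where
  "total_variation U v = Inf {emeasure \<mu> (space \<mu>) | \<mu> \<sigma>. has_gradient_measure v U \<sigma> \<mu>}"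

text \<open>
  Near each boundary point, in suitable orthonormal coordinates \<open>(e1, e2)\<close> centred there, the set
  is the part lying strictly on one side of the graph of a Lipschitz function.
\<close>

definition strongly_lipschitz :: "(real \<times> real) set \<Rightarrow> bool" where
  "strongly_lipschitz S \<longleftrightarrow>
     (\<forall>x\<in>frontier S. \<exists>e1 e2 g L r.
        norm e1 = 1 \<and> norm e2 = 1 \<and> e1 \<bullet> e2 = 0 \<and>
        L-lipschitz_on (UNIV :: real set) g \<and> 0 < r \<and>
        (\<forall>y\<in>ball x r. y \<in> S \<longleftrightarrow> g ((y - x) \<bullet> e1) < (y - x) \<bullet> e2))"

definition open_square :: "(real \<times> real) set" where
  "open_square = {0<..<1} \<times> {0<..<1}"

definition closed_square :: "(real \<times> real) set" where
  "closed_square = {0..1} \<times> {0..1}"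

definition grid :: "nat \<Rightarrow> (int \<times> int) set" where
  "grid n = {1..int n - 1} \<times> {1..int n - 1}"

definition cell :: "nat \<Rightarrow> int \<times> int \<Rightarrow> (real \<times> real) set" where
  "cell n = (\<lambda>(i, j).
     {(real_of_int i - 1/2) / real n <..< (real_of_int i + 1/2) / real n} \<times>
     {(real_of_int j - 1/2) / real n <..< (real_of_int j + 1/2) / real n})"

definition shrink :: "(real \<times> real) set \<Rightarrow> real \<Rightarrow> (real \<times> real) set" where
  "shrink E r = {x \<in> E. infdist x (frontier E) > r}"

definition inner_domain :: "nat \<Rightarrow> (real \<times> real) set \<Rightarrow> (real \<times> real) set" where
  "inner_domain n S = \<Union>{cell n p | p. p \<in> grid n \<and> cell n p \<subseteq> shrink S (1 / real n)}"

definition outer_domain :: "nat \<Rightarrow> (real \<times> real) set \<Rightarrow> (real \<times> real) set" where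
  "outer_domain n W =
     closed_square -
     \<Union>{cell n p | p. p \<in> grid n \<and> cell n p \<subseteq> shrink (closed_square - W) (1 / real n)}"

definition grid_values :: "nat \<Rightarrow> (int \<times> int \<Rightarrow> real) \<Rightarrow> (real \<times> real \<Rightarrow> real) \<Rightarrow> bool" where
  "grid_values n a v \<longleftrightarrow>
     (\<forall>p. p \<notin> grid n \<longrightarrow> a p = 0) \<and>
     (AE x in lebesgue_on open_square. v x = (\<Sum>p\<in>grid n. a p * indicator (cell n p) x))"

definition discrete_gradient ::
  "(int \<times> int \<Rightarrow> real) \<Rightarrow> int \<times> int \<Rightarrow> real \<times> real \<times> real \<times> real" where
  "discrete_gradient a = (\<lambda>(i, j).
     (a (i + 1, j) - a (i, j), a (i - 1, j) - a (i, j),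
      a (i, j + 1) - a (i, j), a (i, j - 1) - a (i, j)))"

definition positive_parts :: "real \<times> real \<times> real \<times> real \<Rightarrow> real \<times> real \<times> real \<times> real" where
  "positive_parts = (\<lambda>(p, q, r, s). (max p 0, max q 0, max r 0, max s 0))"

text \<open>
  The norm on iterated products is the Euclidean one. For \<open>n > 0\<close> the grid values of \<open>v\<close> are
  unique if they exist, so the infimum ranges over at most one value; it is \<open>\<infinity>\<close> if \<open>v\<close> is not
  piecewise constant on the cells.
\<close>

definition discrete_TV :: "nat \<Rightarrow> (real \<times> real \<Rightarrow> real) \<Rightarrow> ennreal" where
  "discrete_TV n v =
     Inf {ennreal (1 / real n * (\<Sum>p\<in>grid n. norm (positive_parts (discrete_gradient a p)))) | a.
            grid_values n a v}"

definition constraint_set ::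
  "(real \<times> real) set \<Rightarrow> (real \<times> real) set \<Rightarrow> (real \<times> real \<Rightarrow> real) set" where
  "constraint_set S W =
     {v. AE x in lebesgue_on open_square.
           (x \<in> S \<longrightarrow> v x = 1) \<and> (x \<in> closed_square - W \<longrightarrow> v x = 0)}"

end

theory Submission
  imports Defs "HOL-Probability.Helly_Selection" "HOL-Probability.Probability_Mass_Function"
begin

text \<open>
Both halves of the Gamma-limit are proved by testing against smooth functions and never use the
structure theory of functions of bounded variation.

\<^bold>\<open>Lower bound.\<close> For grid values \<open>a\<close> let \<open>p, q, r, s\<close> be the positive parts of the four
differences at a grid point and put \<open>F = (p - q, r - s)\<close>. Summation by parts shows that the discrete
vector measure with atoms \<open>F / n\<close> represents the distributional gradient of the piecewise constant
function up to \<open>O(1/n)\<close> (\<open>discrete_divergence\<close>), while \<open>norm F\<close> is at most the norm of the four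
positive parts: the upwind energy bounds the mass of a vector measure that is asymptotically the
gradient. A weak limit of the joint laws of position and direction \<open>F / norm (...)\<close> is extracted by
Helly's theorem on the real line, after lifting the four-dimensional cube to the line along a
continuous space-filling curve (\<open>weakly_convergent_subsequence_of_cube_valued\<close>). Projecting the limit
to the position variable yields the gradient of the limit function in polar form, with no more mass
than the energies (\<open>polar_measure_of_barycentric_density\<close>); this is \<open>liminf_total_variation\<close>. The
constraints pass to the limit because the discrete domains exhaust the open ones and Lipschitz
boundaries are null sets (\<open>constraint_passes_to_limit\<close>).

\<^bold>\<open>Recovery sequences.\<close> Let \<open>u\<close> be admissible with gradient \<open>\<sigma> \<mu>\<close>. Near every point there is a
direction in which short steps neither leave the inner domain nor enter the outer one from outside:
at a boundary point it is the axis of the cone given by the Lipschitz graph, and the two boundaries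
do not interact because they are disjoint (\<open>admissible_direction_exists\<close>). Average \<open>u\<close> with kernels
supported in such cones and glue the averages \<open>m\<^sub>i\<close> by a Lipschitz partition of unity \<open>\<zeta>\<^sub>i\<close>: the
function \<open>\<Sum> \<zeta>\<^sub>i m\<^sub>i\<close> is exactly 1 on the inner and exactly 0 off the outer domain, so its samples at
the cell centres satisfy the discrete constraints for every positive \<open>n\<close>. For a smooth function the upwind
energy is consistent with the isotropic gradient, since \<open>max g 0\<close> and \<open>max (-g) 0\<close> have squares adding
up to \<open>g\<^sup>2\<close>. The gradient of the glued function is bounded by the sum of \<open>\<zeta>\<^sub>i\<close> times the averages of
\<open>\<mu>\<close>, whose integral is the mass of \<open>\<mu>\<close> up to the size of the kernels, and an error
\<open>\<Sum> |\<nabla>\<zeta>\<^sub>i| |m\<^sub>i - u|\<close>, which has this form because \<open>\<Sum> \<nabla>\<zeta>\<^sub>i = 0\<close> and is small in \<open>L\<^sup>1\<close> because the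
averages converge to \<open>u\<close> (\<open>partition_increment_bound\<close>, \<open>mollified_recovery\<close>). A diagonal choice of the scale finishes the proof.
\<close>

section \<open>Smooth bumps and derivatives of test functions\<close>

text \<open>
Functions of one real variable that are \<open>k\<close> times continuously differentiable, and those that are so
for every \<open>k\<close>.
\<close>

fun C_k :: "nat \<Rightarrow> (real \<Rightarrow> real) \<Rightarrow> bool" where
  "C_k 0 f \<longleftrightarrow> continuous_on UNIV f"
| "C_k (Suc k) f \<longleftrightarrow> (\<exists>f'. (\<forall>t. (f has_real_derivative f' t) (at t)) \<and> C_k k f')"

definition C_inf :: "(real \<Rightarrow> real) \<Rightarrow> bool" where
  "C_inf f \<longleftrightarrow> (\<forall>k. C_k k f)"

lemma C_k_Suc_deriv: "C_k (Suc k) f \<longleftrightarrow> (\<forall>t. (f has_real_derivative deriv f t) (at t)) \<and> C_k k (deriv f)"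
proof
  assume "C_k (Suc k) f"
  then obtain f' where f': "\<And>t. (f has_real_derivative f' t) (at t)" "C_k k f'" by auto
  then have "f' = deriv f" by (metis DERIV_imp_deriv ext)
  with f' show "(\<forall>t. (f has_real_derivative deriv f t) (at t)) \<and> C_k k (deriv f)" by auto
qed auto

lemma C_k_SucD: "C_k (Suc k) f \<Longrightarrow> C_k k f"
proof (induction k arbitrary: f)
  case 0
  then show ?case by (auto intro: DERIV_continuous_on has_field_derivative_at_within)
next
  case (Suc k)
  then show ?case by (metis C_k.simps(2))
qed

lemma C_k_const: "C_k k (\<lambda>_. c)"
proof (induction k arbitrary: c)
  case (Suc k)
  then show ?case by (auto intro!: exI[of _ "\<lambda>_. 0"])
qed auto

lemma C_k_add: "C_k k f \<Longrightarrow> C_k k g \<Longrightarrow> C_k k (\<lambda>t. f t + g t)"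
proof (induction k arbitrary: f g)
  case (Suc k)
  then obtain f' g' where "\<And>t. (f has_real_derivative f' t) (at t)" "C_k k f'"
    "\<And>t. (g has_real_derivative g' t) (at t)" "C_k k g'" by auto
  with Suc.IH show ?case by (auto intro!: exI[of _ "\<lambda>t. f' t + g' t"] derivative_eq_intros)
qed (auto intro: continuous_intros)

lemma C_k_mult: "C_k k f \<Longrightarrow> C_k k g \<Longrightarrow> C_k k (\<lambda>t. f t * g t)"
proof (induction k arbitrary: f g)
  case (Suc k)
  then obtain f' g' where *: "\<And>t. (f has_real_derivative f' t) (at t)" "C_k k f'"
    "\<And>t. (g has_real_derivative g' t) (at t)" "C_k k g'" by auto
  have "C_k k (\<lambda>t. f' t * g t + f t * g' t)"
    using * Suc.prems by (intro C_k_add Suc.IH) (auto dest: C_k_SucD simp del: C_k.simps)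
  then show ?case using *
    by (auto intro!: exI[of _ "\<lambda>t. f' t * g t + f t * g' t"] derivative_eq_intros)
qed (auto intro: continuous_intros)

lemma C_k_affine: "C_k k f \<Longrightarrow> C_k k (\<lambda>t. f (a * t + b))"
proof (induction k arbitrary: f)
  case 0
  then show ?case by (auto intro!: continuous_on_compose2[of UNIV f] continuous_intros)
next
  case (Suc k)
  then obtain f' where *: "\<And>t. (f has_real_derivative f' t) (at t)" "C_k k f'" by auto
  have "((\<lambda>t. f (a * t + b)) has_real_derivative a * f' (a * t + b)) (at t)" for t
  proof -
    have "((\<lambda>t. a * t + b) has_real_derivative a) (at t)" by (auto intro!: derivative_eq_intros)
    then show ?thesis using DERIV_chain2[OF *(1), of "\<lambda>t. a * t + b" a t UNIV] by (simp add: mult.commute)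
  qed
  moreover have "C_k k (\<lambda>t. a * f' (a * t + b))"
    by (intro C_k_mult C_k_const Suc.IH *)
  ultimately show ?case by (auto intro!: exI[of _ "\<lambda>t. a * f' (a * t + b)"])
qed

text \<open>
The functions \<open>P(1/t) exp(-1/t)\<close> for \<open>t > 0\<close>, extended by zero. The family is closed under
differentiation, which makes all of them smooth at the origin.
\<close>

definition flat_exp :: "real poly \<Rightarrow> real \<Rightarrow> real" where
  "flat_exp P t = (if t > 0 then poly P (1 / t) * exp (- 1 / t) else 0)"

lemma poly_times_exp_tendsto_0:
  "((\<lambda>s::real. poly P s * exp (- s)) \<longlongrightarrow> 0) at_top"
proof -
  have "((\<lambda>s. \<Sum>i\<le>degree P. coeff P i * (s ^ i / exp s)) \<longlongrightarrow> (\<Sum>i\<le>degree P. coeff P i * 0)) at_top"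
    by (intro tendsto_sum tendsto_mult tendsto_const tendsto_power_div_exp_0)
  then show ?thesis
    by (simp add: poly_altdef sum_distrib_right exp_minus divide_inverse mult.assoc)
qed

lemma flat_exp_tendsto_0: "(flat_exp P \<longlongrightarrow> 0) (at 0)"
proof -
  have "((\<lambda>t. poly P (inverse t) * exp (- inverse t)) \<longlongrightarrow> 0) (at_right 0)"
    using filterlim_compose[OF poly_times_exp_tendsto_0 filterlim_inverse_at_top_right] .
  then have "(flat_exp P \<longlongrightarrow> 0) (at_right 0)"
    by (rule Lim_transform_eventually)
      (auto simp: flat_exp_def eventually_at_right_field field_simps intro!: exI[of _ 1])
  moreover have "(flat_exp P \<longlongrightarrow> 0) (at_left 0)"
    by (rule Lim_transform_eventually[OF tendsto_const])
      (auto simp: flat_exp_def eventually_at_left_field intro!: exI[of _ "-1"])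
  ultimately show ?thesis by (simp add: filterlim_split_at)
qed

lemma flat_exp_has_derivative:
  "(flat_exp P has_real_derivative flat_exp ([:0, 0, 1:] * (P - pderiv P)) t) (at t)"
proof -
  consider "t > 0" | "t < 0" | "t = 0" by linarith
  then show ?thesis
  proof cases
    case 1
    have "((\<lambda>t. poly P (1 / t) * exp (- 1 / t)) has_real_derivative
        flat_exp ([:0, 0, 1:] * (P - pderiv P)) t) (at t)"
      using 1 by (auto intro!: derivative_eq_intros DERIV_chain2[OF poly_DERIV]
        simp: flat_exp_def field_simps power2_eq_square)
    then show ?thesis
      by (rule has_field_derivative_transform_within_open[of _ _ _ "{0<..}"])
        (use 1 in \<open>auto simp: flat_exp_def\<close>)
  next
    case 2
    have "((\<lambda>t. 0) has_real_derivative flat_exp ([:0, 0, 1:] * (P - pderiv P)) t) (at t)"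
      using 2 by (auto simp: flat_exp_def)
    then show ?thesis
      by (rule has_field_derivative_transform_within_open[of _ _ _ "{..<0}"])
        (use 2 in \<open>auto simp: flat_exp_def\<close>)
  next
    case 3
    have "((\<lambda>h. flat_exp P h / h) \<longlongrightarrow> 0) (at 0)"
      by (rule Lim_transform_eventually[OF flat_exp_tendsto_0[of "[:0, 1:] * P"]])
        (auto simp: flat_exp_def eventually_at intro!: exI[of _ 1])
    then show ?thesis using 3 by (simp add: DERIV_def flat_exp_def)
  qed
qed

lemma C_k_flat_exp: "C_k k (flat_exp P)"
proof (induction k arbitrary: P)
  case 0
  show ?case using flat_exp_has_derivative by (auto intro!: DERIV_continuous_on)
next
  case (Suc k)
  then show ?case using flat_exp_has_derivative by auto
qed

text \<open>
A smooth function that is positive exactly on the open interval of radius \<open>w > 0\<close> about \<open>c\<close>.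
\<close>

definition bump :: "real \<Rightarrow> real \<Rightarrow> real \<Rightarrow> real" where
  "bump c w t = flat_exp 1 ((t - c) + w) * flat_exp 1 (w - (t - c))"

lemma C_inf_bump: "C_inf (bump c w)"
proof -
  have 1: "bump c w = (\<lambda>t. flat_exp 1 (1 * t + (w - c)) * flat_exp 1 (- 1 * t + (w + c)))"
    by (auto simp: bump_def algebra_simps)
  show ?thesis unfolding C_inf_def 1
    by (intro allI C_k_mult C_k_affine C_k_flat_exp)
qed

lemma bump_nonneg: "0 \<le> bump c w t" by (auto simp: bump_def flat_exp_def)
lemma bump_nonzero_iff: "w > 0 \<Longrightarrow> bump c w t \<noteq> 0 \<longleftrightarrow> \<bar>t - c\<bar> < w"
  by (auto simp: bump_def flat_exp_def)

lemma C_infD: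
  assumes "C_inf f" shows "(f has_real_derivative deriv f t) (at t)" "C_inf (deriv f)"
  using assms C_k_Suc_deriv unfolding C_inf_def by blast+

text \<open>
Tensor products of smooth functions of one variable are stable under partial derivatives; this is how
the iterated partial derivatives in the definition of \<^const>\<open>smooth\<close> are controlled.
\<close>

lemma foldr_partial_deriv_product:
  assumes "C_inf f" "C_inf g" "set bs \<subseteq> (Basis :: (real \<times> real) set)"
  shows "\<exists>f' g'. C_inf f' \<and> C_inf g' \<and> foldr partial_deriv bs (\<lambda>z. f (fst z) * g (snd z)) = (\<lambda>z. f' (fst z) * g' (snd z))"
  using assms(3)
proof (induction bs)
  case Nil
  then show ?case using assms by auto
next
  case (Cons b bs)
  then obtain f' g' where fg: "C_inf f'" "C_inf g'"
    and eq: "foldr partial_deriv bs (\<lambda>z. f (fst z) * g (snd z)) = (\<lambda>z. f' (fst z) * g' (snd z))" by auto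
  have der: "((\<lambda>z::real \<times> real. f' (fst z) * g' (snd z)) has_derivative
      (\<lambda>h. f' (fst z) * (deriv g' (snd z) * snd h) + deriv f' (fst z) * fst h * g' (snd z))) (at z)" for z
  proof -
    have 1: "((\<lambda>z. f' (fst z)) has_derivative (\<lambda>h. deriv f' (fst z) * fst h)) (at z)"
      using has_derivative_compose[OF bounded_linear_imp_has_derivative[OF bounded_linear_fst]
        C_infD(1)[OF fg(1), unfolded has_field_derivative_def], of z UNIV] by simp
    have 2: "((\<lambda>z. g' (snd z)) has_derivative (\<lambda>h. deriv g' (snd z) * snd h)) (at z)"
      using has_derivative_compose[OF bounded_linear_imp_has_derivative[OF bounded_linear_snd]
        C_infD(1)[OF fg(2), unfolded has_field_derivative_def], of z UNIV] by simp
    show ?thesis using has_derivative_mult[OF 1 2] by simp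
  qed
  have pd: "partial_deriv b (\<lambda>z. f' (fst z) * g' (snd z)) =
      (\<lambda>z. f' (fst z) * (deriv g' (snd z) * snd b) + deriv f' (fst z) * fst b * g' (snd z))"
    unfolding partial_deriv_def frechet_derivative_at[OF der, symmetric] ..
  from Cons.prems consider "fst b = 1" "snd b = 0" | "fst b = 0" "snd b = 1" by (auto simp: Basis_prod_def)
  then show ?case
  proof cases
    case 1
    then show ?thesis using fg C_infD(2)[OF fg(1)] by (auto simp: eq pd)
  next
    case 2
    then show ?thesis using fg C_infD(2)[OF fg(2)] by (auto simp: eq pd)
  qed
qed

lemma differentiable_product_of_C_inf: 
  assumes "C_inf f" "C_inf g"
  shows "(\<lambda>z::real \<times> real. f (fst z) * g (snd z)) differentiable (at z)"
proof -
  have "f differentiable (at (fst z))" "g differentiable (at (snd z))"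
    using C_infD(1)[OF assms(1)] C_infD(1)[OF assms(2)] real_differentiable_def by blast+
  then have "(\<lambda>z. f (fst z)) differentiable (at z)" "(\<lambda>z. g (snd z)) differentiable (at z)"
    using differentiable_chain_at[of fst z f] differentiable_chain_at[of snd z g]
    by (auto simp: comp_def bounded_linear_imp_differentiable bounded_linear_fst bounded_linear_snd)
  then show ?thesis by (rule differentiable_mult)
qed

lemma smooth_product:
  assumes "C_inf f" "C_inf g"
  shows "smooth (\<lambda>z::real \<times> real. f (fst z) * g (snd z))"
  unfolding smooth_def
proof (intro allI impI)
  fix bs :: "(real \<times> real) list" assume "set bs \<subseteq> Basis"
  from foldr_partial_deriv_product[OF assms this] obtain f' g' where
    "C_inf f'" "C_inf g'" "foldr partial_deriv bs (\<lambda>z. f (fst z) * g (snd z)) = (\<lambda>z. f' (fst z) * g' (snd z))"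
    by blast
  then show "foldr partial_deriv bs (\<lambda>z. f (fst z) * g (snd z)) differentiable_on UNIV"
    by (auto simp: differentiable_on_def intro!: differentiable_product_of_C_inf)
qed


lemma smooth_differentiable: "smooth f \<Longrightarrow> f differentiable (at x)"
  unfolding smooth_def by (drule spec[of _ "[]"]) (auto simp: differentiable_on_def)

lemma smooth_partial_deriv:
  assumes "smooth f" "b \<in> Basis" shows "smooth (partial_deriv b f)"
  unfolding smooth_def
proof (intro allI impI)
  fix bs assume "set bs \<subseteq> (Basis :: 'a set)"
  then have "foldr partial_deriv (bs @ [b]) f differentiable_on UNIV"
    using assms unfolding smooth_def by (intro assms(1)[unfolded smooth_def, rule_format]) auto
  then show "foldr partial_deriv bs (partial_deriv b f) differentiable_on UNIV" by simp
qed

lemma smooth_continuous: "smooth f \<Longrightarrow> continuous_on A f"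
  by (metis smooth_differentiable differentiable_imp_continuous_within continuous_at_imp_continuous_on)

lemma partial_deriv_shift: "partial_deriv b (\<lambda>z. f (z - a)) = (\<lambda>z. partial_deriv b f (z - a))"
proof
  fix z
  have "((\<lambda>z. f (z - a)) has_derivative D) (at z) \<longleftrightarrow> (f has_derivative D) (at (z - a))" for D
    by (simp add: has_derivative_at field_simps diff_diff_eq)
  then show "partial_deriv b (\<lambda>z. f (z - a)) z = partial_deriv b f (z - a)"
    by (simp add: partial_deriv_def frechet_derivative_def)
qed

lemma smooth_shift:
  assumes "smooth f" shows "smooth (\<lambda>z. f (z - a))"
proof -
  have "foldr partial_deriv bs (\<lambda>z. f (z - a)) = (\<lambda>z. foldr partial_deriv bs f (z - a))" for bs
    by (induction bs) (auto simp: partial_deriv_shift)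
  moreover have "(\<lambda>z. g (z - a)) differentiable_on UNIV" if "g differentiable_on UNIV" for g :: "'a \<Rightarrow> real"
    using that differentiable_chain_at[of "\<lambda>z. z - a" _ g]
    by (auto simp: differentiable_on_def comp_def)
  ultimately show ?thesis using assms unfolding smooth_def by simp
qed

lemma partial_deriv_outside_support:
  assumes "x \<notin> closure {x. f x \<noteq> 0}" shows "partial_deriv b f x = 0"
proof -
  have "((\<lambda>x. 0) has_derivative (\<lambda>h. 0)) (at x)" by simp
  then have "(f has_derivative (\<lambda>h. 0)) (at x)"
    by (rule has_derivative_transform_within_open[of _ _ _ UNIV "- closure {x. f x \<noteq> 0}"])
      (use assms closure_subset[of "{x. f x \<noteq> 0}"] in auto)
  then show ?thesis unfolding partial_deriv_def by (metis frechet_derivative_at)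
qed

lemma closure_support_partial_deriv:
  "closure {x. partial_deriv b f x \<noteq> 0} \<subseteq> closure {x. f x \<noteq> 0}"
  using partial_deriv_outside_support by (intro closure_minimal) auto

lemma compact_support_bounded:
  fixes f :: "'a::euclidean_space \<Rightarrow> real"
  assumes "continuous_on UNIV f" "compact (closure {x. f x \<noteq> 0})"
  obtains B where "B > 0" "\<And>x. \<bar>f x\<bar> \<le> B"
proof -
  have "bounded (f ` closure {x. f x \<noteq> 0})"
    by (intro compact_imp_bounded compact_continuous_image assms(2) continuous_on_subset[OF assms(1)]) auto
  then obtain B where B: "B > 0" "\<And>x. x \<in> closure {x. f x \<noteq> 0} \<Longrightarrow> \<bar>f x\<bar> \<le> B"
    by (auto simp: bounded_pos)
  have "\<bar>f x\<bar> \<le> B" for x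
    using B closure_subset[of "{x. f x \<noteq> 0}"] by (cases "f x = 0") auto
  then show ?thesis using that B(1) by blast
qed

lemma smooth_compact_support_lipschitz:
  fixes f :: "'a::euclidean_space \<Rightarrow> real"
  assumes "smooth f" "compact (closure {x. f x \<noteq> 0})"
  obtains C where "C > 0" "\<And>x y. \<bar>f x - f y\<bar> \<le> C * norm (x - y)"
proof -
  have "\<exists>B. 0 \<le> B \<and> (\<forall>x. \<bar>partial_deriv b f x\<bar> \<le> B)" if "b \<in> Basis" for b
  proof -
    have "compact (closure {x. partial_deriv b f x \<noteq> 0})"
      using closure_support_partial_deriv[of b f] assms(2) by (metis closed_closure compact_Int_closed inf.absorb2)
    then show ?thesis
      using compact_support_bounded[of "partial_deriv b f"] smooth_continuous[OF smooth_partial_deriv[OF assms(1) that]]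
      by (metis less_imp_le)
  qed
  then obtain B where B: "\<And>b. b \<in> Basis \<Longrightarrow> 0 \<le> B b" "\<And>b x. b \<in> Basis \<Longrightarrow> \<bar>partial_deriv b f x\<bar> \<le> B b"
    by metis
  define C where "C = (\<Sum>b\<in>Basis. B b)"
  have hd: "(f has_derivative frechet_derivative f (at x)) (at x)" for x
    using smooth_differentiable[OF assms(1)] by (simp add: frechet_derivative_works)
  have "onorm (frechet_derivative f (at x)) \<le> C" for x
  proof (rule onorm_le)
    fix h :: 'a
    interpret bounded_linear "frechet_derivative f (at x)" using hd by (rule has_derivative_bounded_linear)
    have "frechet_derivative f (at x) h = frechet_derivative f (at x) (\<Sum>b\<in>Basis. (h \<bullet> b) *\<^sub>R b)"
      by (simp add: euclidean_representation)
    also have "\<dots> = (\<Sum>b\<in>Basis. (h \<bullet> b) * partial_deriv b f x)"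
      by (simp add: sum scaleR partial_deriv_def)
    also have "norm \<dots> \<le> (\<Sum>b\<in>Basis. norm h * B b)"
      by (intro order_trans[OF norm_sum] sum_mono)
        (auto simp: abs_mult intro!: mult_mono Basis_le_norm B)
    finally show "norm (frechet_derivative f (at x) h) \<le> C * norm h"
      by (simp add: C_def sum_distrib_left mult.commute)
  qed
  then have L: "norm (f x - f y) \<le> C * norm (x - y)" for x y
    by (intro differentiable_bound[of UNIV f "\<lambda>x. frechet_derivative f (at x)"] hd[THEN has_derivative_at_withinI]) auto
  have "C \<ge> 0" unfolding C_def by (intro sum_nonneg B)
  then show ?thesis using that[of "C + 1"] L by (smt (verit) mult_right_mono norm_ge_zero real_norm_def)
qed

text \<open>
The derivative may be taken at any reference point \<open>y\<close> near \<open>x\<close>, such as another point of the same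
cell.
\<close>

lemma difference_quotient_partial_deriv:
  fixes f :: "'a::euclidean_space \<Rightarrow> real"
  assumes "smooth f" "b \<in> Basis"
    and C: "\<And>x y. \<bar>partial_deriv b f x - partial_deriv b f y\<bar> \<le> C * norm (x - y)"
  shows "\<bar>f (x + h *\<^sub>R b) - f x - h * partial_deriv b f y\<bar> \<le> C * \<bar>h\<bar> * (norm (x - y) + \<bar>h\<bar>)"
proof -
  define g where "g t = f (x + t *\<^sub>R b) - t * partial_deriv b f y" for t
  have C0: "0 \<le> C" using C[of b 0] assms(2) abs_ge_zero order_trans by fastforce
  have der: "(g has_derivative (\<lambda>s. s * (partial_deriv b f (x + t *\<^sub>R b) - partial_deriv b f y))) (at t within S)" for t S
  proof -
    have "(f has_derivative frechet_derivative f (at (x + t *\<^sub>R b))) (at (x + t *\<^sub>R b))"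
      using smooth_differentiable[OF assms(1)] by (simp add: frechet_derivative_works)
    moreover have "((\<lambda>t. x + t *\<^sub>R b) has_derivative (\<lambda>s. s *\<^sub>R b)) (at t within S)"
      by (auto intro!: derivative_eq_intros)
    ultimately have 1: "((\<lambda>t. f (x + t *\<^sub>R b)) has_derivative (\<lambda>s. frechet_derivative f (at (x + t *\<^sub>R b)) (s *\<^sub>R b))) (at t within S)"
      using has_derivative_compose by blast
    interpret bounded_linear "frechet_derivative f (at (x + t *\<^sub>R b))"
      using smooth_differentiable[OF assms(1)] frechet_derivative_works has_derivative_bounded_linear by blast
    show ?thesis using 1 unfolding g_def
      by (auto intro!: derivative_eq_intros simp: scaleR partial_deriv_def algebra_simps)
  qed
  have "norm (g h - g 0) \<le> C * (norm (x - y) + \<bar>h\<bar>) * norm (h - 0)"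
  proof (rule differentiable_bound[of "{-\<bar>h\<bar>..\<bar>h\<bar>}", OF _ der])
    fix t assume t: "t \<in> {-\<bar>h\<bar>..\<bar>h\<bar>}"
    have "\<bar>partial_deriv b f (x + t *\<^sub>R b) - partial_deriv b f y\<bar> \<le> C * norm (x + t *\<^sub>R b - y)" by (rule C)
    also have "\<dots> \<le> C * (norm (x - y) + \<bar>h\<bar>)"
    proof (rule mult_left_mono[OF _ C0])
      have "norm (x + t *\<^sub>R b - y) \<le> norm (x - y) + norm (t *\<^sub>R b)"
        using norm_triangle_ineq[of "x - y" "t *\<^sub>R b"] by (simp add: algebra_simps)
      then show "norm (x + t *\<^sub>R b - y) \<le> norm (x - y) + \<bar>h\<bar>" using t assms(2) by auto
    qed
    finally have "\<bar>partial_deriv b f (x + t *\<^sub>R b) - partial_deriv b f y\<bar> \<le> C * (norm (x - y) + \<bar>h\<bar>)" .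
    then have "norm (s * (partial_deriv b f (x + t *\<^sub>R b) - partial_deriv b f y)) \<le> C * (norm (x - y) + \<bar>h\<bar>) * norm s" for s
      using mult_right_mono[of _ "C * (norm (x - y) + \<bar>h\<bar>)" "\<bar>s\<bar>"] by (simp add: abs_mult mult.commute[of "\<bar>s\<bar>"])
    then show "onorm (\<lambda>s. s * (partial_deriv b f (x + t *\<^sub>R b) - partial_deriv b f y)) \<le> C * (norm (x - y) + \<bar>h\<bar>)"
      by (rule onorm_le)
  qed auto
  then show ?thesis by (simp add: g_def algebra_simps)
qed

lemma smooth_kernel_exists:
  fixes c :: "real \<times> real"
  assumes "w > 0"
  obtains \<kappa> :: "real \<times> real \<Rightarrow> real" where "smooth \<kappa>" "\<And>z. 0 \<le> \<kappa> z"
    "\<And>z. \<kappa> z \<noteq> 0 \<Longrightarrow> norm (z - c) < w" "compact (closure {z. \<kappa> z \<noteq> 0})"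
    "integrable lborel \<kappa>" "(\<integral>z. \<kappa> z \<partial>lborel) = 1"
proof -
  define f where "f z = bump (fst c) (w/2) (fst z) * bump (snd c) (w/2) (snd z)" for z
  have w2: "w/2 > 0" using assms by simp
  have sf: "smooth f" unfolding f_def by (intro smooth_product C_inf_bump)
  have f0: "0 \<le> f z" for z by (simp add: f_def bump_nonneg)
  have supp: "norm (z - c) < w" if "f z \<noteq> 0" for z
  proof -
    have "\<bar>fst z - fst c\<bar> < w/2" "\<bar>snd z - snd c\<bar> < w/2"
      using that bump_nonzero_iff[OF w2] by (auto simp: f_def)
    then show ?thesis using norm_Pair_le[of "fst z - fst c" "snd z - snd c"] by (cases z; cases c) auto
  qed
  have "bounded {z. f z \<noteq> 0}"
    using supp by (intro bounded_subset[OF bounded_ball[of c w]]) (auto simp: dist_norm norm_minus_commute)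
  then have cs: "compact (closure {z. f z \<noteq> 0})" by (simp add: compact_closure)
  have int: "integrable lborel f"
  proof -
    have "integrable lborel (\<lambda>z. indicator (closure {z. f z \<noteq> 0}) z *\<^sub>R f z)"
      by (intro borel_integrable_compact cs smooth_continuous sf)
    moreover have "(\<lambda>z. indicator (closure {z. f z \<noteq> 0}) z *\<^sub>R f z) = f"
      using closure_subset[of "{z. f z \<noteq> 0}"] by (auto simp: indicator_def fun_eq_iff)
    ultimately show ?thesis by simp
  qed
  define I where "I = (\<integral>z. f z \<partial>lborel)"
  have "I > 0"
  proof -
    have "I \<noteq> 0"
    proof
      assume "I = 0"
      then have "AE z in lborel. f z = 0"
        using integral_nonneg_eq_0_iff_AE[OF int] f0 by (simp add: I_def)
      have op: "open {z. f z \<noteq> 0}"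
        using smooth_continuous[OF sf] by (intro open_Collect_neq continuous_intros)
      have "{z. f z \<noteq> 0} \<in> null_sets lborel"
        using \<open>AE z in lborel. f z = 0\<close> borel_open[OF op] AE_iff_null_sets[of "{z. f z \<noteq> 0}" lborel] by simp
      then have "negligible {z. f z \<noteq> 0}"
        by (simp add: negligible_iff_null_sets null_sets_completionI)
      then have "f z = 0" for z
        using open_not_negligible[OF op] by blast
      moreover have "f c \<noteq> 0" using bump_nonzero_iff[OF w2, of "fst c" "fst c"] bump_nonzero_iff[OF w2, of "snd c" "snd c"] w2
        by (simp add: f_def)
      ultimately show False by blast
    qed
    moreover have "I \<ge> 0" unfolding I_def using f0 by simp
    ultimately show ?thesis by simp
  qed
  have eq: "(\<lambda>z. f z / I) = (\<lambda>z. (1 / I * bump (fst c) (w/2) (fst z)) * bump (snd c) (w/2) (snd z))"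
    by (auto simp: f_def)
  have "C_inf (\<lambda>t. 1 / I * bump (fst c) (w/2) t)"
    using C_inf_bump unfolding C_inf_def by (intro allI C_k_mult C_k_const) auto
  then have "smooth (\<lambda>z. f z / I)" unfolding eq by (intro smooth_product C_inf_bump)
  moreover have "{z. f z / I \<noteq> 0} = {z. f z \<noteq> 0}" using \<open>I > 0\<close> by auto
  moreover have "(\<integral>z. f z / I \<partial>lborel) = 1" using \<open>I > 0\<close> by (simp add: I_def)
  moreover have "0 \<le> f z / I" "f z / I \<noteq> 0 \<Longrightarrow> norm (z - c) < w" for z
    using f0 supp \<open>I > 0\<close> by auto
  moreover have "integrable lborel (\<lambda>z. f z / I)" using int by simp
  ultimately show ?thesis
    using that[of "\<lambda>z. f z / I"] cs by presburger
qed

section \<open>A space-filling curve and weak compactness of laws on a cube\<close>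

text \<open>
Schoenberg's space-filling curve. The wave is continuous with period 2, vanishes on \<open>[0, 1/3]\<close> and
equals 1 on \<open>[2/3, 1]\<close>; the components of the curve, for \<open>k < d\<close>, are built from the values of the
wave at \<open>3\<^sup>m t\<close> with \<open>m\<close> congruent to \<open>k\<close> modulo \<open>d\<close>.
\<close>

definition schoenberg_wave :: "real \<Rightarrow> real" where
  "schoenberg_wave t = max 0 (min 1 (1/2 - cos (pi * t)))"

definition schoenberg_curve :: "nat \<Rightarrow> nat \<Rightarrow> real \<Rightarrow> real" where
  "schoenberg_curve d k t = (\<Sum>n. schoenberg_wave (3 ^ (d * n + k) * t) / 2 ^ Suc n)"

lemma schoenberg_wave_bounds: "0 \<le> schoenberg_wave t" "schoenberg_wave t \<le> 1"
  by (auto simp: schoenberg_wave_def)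

lemma schoenberg_wave_periodic: "schoenberg_wave (t + 2 * of_int m) = schoenberg_wave t"
proof -
  have "cos (pi * t + of_int m * (2 * pi)) = cos (pi * t)"
    using sin_int_2pin[of m] cos_int_2pin[of m] by (simp add: cos_add mult_ac)
  moreover have "pi * (t + 2 * of_int m) = pi * t + of_int m * (2 * pi)" by (simp add: algebra_simps)
  ultimately show ?thesis by (simp add: schoenberg_wave_def)
qed

lemma schoenberg_wave_0:
  assumes "0 \<le> t" "t \<le> 1/3" shows "schoenberg_wave t = 0"
proof -
  have "cos (pi * (1/3)) \<le> cos (pi * t)"
    using assms by (intro cos_monotone_0_pi_le) auto
  then show ?thesis using cos_60 by (simp add: schoenberg_wave_def)
qed

lemma schoenberg_wave_1:
  assumes "2/3 \<le> t" "t \<le> 1" shows "schoenberg_wave t = 1"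
proof -
  have "cos (pi * t) \<le> cos (pi * (2/3))"
    using assms by (intro cos_monotone_0_pi_le) auto
  then show ?thesis using cos_120 by (simp add: schoenberg_wave_def mult.commute)
qed

lemma continuous_schoenberg_curve: "continuous_on UNIV (schoenberg_curve d k)"
proof -
  have s: "summable (\<lambda>n. 1 / 2 ^ Suc n :: real)"
    using summable_mult[OF summable_geometric[of "1/2::real"], of "1/2"] by (simp add: power_divide)
  have "uniform_limit UNIV (\<lambda>N t. \<Sum>n<N. schoenberg_wave (3 ^ (d * n + k) * t) / 2 ^ Suc n)
      (\<lambda>t. \<Sum>n. schoenberg_wave (3 ^ (d * n + k) * t) / 2 ^ Suc n) sequentially"
    by (rule Weierstrass_m_test[OF _ s])
      (use schoenberg_wave_bounds in \<open>auto simp: abs_of_nonneg divide_right_mono\<close>)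
  moreover have "continuous_on UNIV (\<lambda>t. \<Sum>n<N. schoenberg_wave (3 ^ (d * n + k) * t) / 2 ^ Suc n)" for N
    unfolding schoenberg_wave_def by (intro continuous_intros) auto
  ultimately have "continuous_on UNIV (\<lambda>t. \<Sum>n. schoenberg_wave (3 ^ (d * n + k) * t) / 2 ^ Suc n)"
    by (intro uniform_limit_theorem[OF always_eventually]) auto
  then show ?thesis by (simp add: schoenberg_curve_def[abs_def])
qed

lemma binary_digits_exist:
  fixes x :: real
  assumes "0 \<le> x" "x \<le> 1"
  obtains b :: "nat \<Rightarrow> nat" where "\<And>n. b n \<in> {0, 1}" "(\<lambda>n. real (b n) / 2 ^ Suc n) sums x"
proof -
  define r where "r = rec_nat x (\<lambda>_ y. if y \<ge> 1/2 then 2 * y - 1 else 2 * y)"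
  have r0: "r 0 = x" and rS: "r (Suc n) = (if r n \<ge> 1/2 then 2 * r n - 1 else 2 * r n)" for n
    by (auto simp: r_def)
  define b where "b n = (if r n \<ge> 1/2 then 1 else 0 :: nat)" for n
  have r01: "0 \<le> r n \<and> r n \<le> 1" for n
    by (induction n) (auto simp: r0 rS assms)
  have sum: "(\<Sum>k<n. real (b k) / 2 ^ Suc k) = x - r n / 2 ^ n" for n
    by (induction n) (auto simp: r0 rS b_def field_simps)
  have "(\<lambda>n. r n / 2 ^ n) \<longlonglongrightarrow> 0"
  proof (rule tendsto_sandwich[of "\<lambda>_. 0" _ _ "\<lambda>n. (1/2) ^ n"])
    show "(\<lambda>n. (1/2::real) ^ n) \<longlonglongrightarrow> 0" by (intro LIMSEQ_realpow_zero) auto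
  qed (use r01 in \<open>auto simp: power_divide divide_right_mono\<close>)
  then have "(\<lambda>n. x - r n / 2 ^ n) \<longlonglongrightarrow> x - 0" by (intro tendsto_intros)
  then have "(\<lambda>n. real (b n) / 2 ^ Suc n) sums x" by (simp only: sums_def sum) simp
  moreover have "b n \<in> {0,1}" for n by (simp add: b_def)
  ultimately show ?thesis using that by blast
qed

text \<open>
At a point \<open>t\<close> of the Cantor set the value of the wave at \<open>3\<^sup>m t\<close> is half of the ternary digit of \<open>t\<close>
with index \<open>m\<close>, counted from zero.
\<close>

lemma schoenberg_wave_digit:
  fixes a :: "nat \<Rightarrow> nat"
  assumes a: "\<And>k. a k \<in> {0, 1}"
  shows "schoenberg_wave (3 ^ m * (\<Sum>k. 2 * real (a k) / 3 ^ Suc k)) = real (a m)"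
proof -
  define f where "f k = 2 * real (a k) / 3 ^ Suc k" for k
  have a01: "0 \<le> real (a k)" "real (a k) \<le> 1" for k using a[of k] by auto
  have geo: "(\<lambda>k. 2 / 3 ^ Suc k :: real) sums 1"
    using sums_mult[OF geometric_sums[of "1/3::real"], of "2/3"] by (simp add: power_divide)
  have fle: "f k \<le> 2 / 3 ^ Suc k" "0 \<le> f k" for k
    using a01[of k] by (auto simp: f_def field_simps)
  have sf: "summable f"
    by (rule summable_comparison_test'[OF sums_summable[OF geo], of 0]) (use fle in \<open>auto simp: abs_of_nonneg\<close>)
  \<comment> \<open>\<open>3\<^sup>m t\<close> is an even integer plus \<open>2/3 a\<^sub>m\<close> plus the
      tail \<open>s\<close>, which lies in \<open>[0, 1/3]\<close>.\<close>
  define s where "s = (\<Sum>k. f (k + Suc m)) * 3 ^ m"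
  have sf': "summable (\<lambda>k. f (k + Suc m))" using sf by (subst summable_iff_shift)
  have s_eq: "(\<Sum>k. f (k + Suc m)) \<le> (\<Sum>k. (1/3 ^ Suc m) * (2 / 3 ^ Suc k))"
    using fle(1)[of "_ + Suc m"]
    by (intro suminf_le sf' summable_mult sums_summable[OF geo]) (auto simp: power_add field_simps)
  also have "\<dots> = 1 / 3 ^ Suc m"
    using suminf_mult[OF sums_summable[OF geo], of "1/3^Suc m"] sums_unique[OF geo] by simp
  finally have s13: "s \<le> 1/3" by (simp add: s_def field_simps)
  have s0: "0 \<le> s" using fle(2) by (auto simp: s_def simp del: add_Suc_right intro!: mult_nonneg_nonneg suminf_nonneg sf')
  have "(\<Sum>k. f k) = (\<Sum>k. f (k + Suc m)) + (\<Sum>k<Suc m. f k)"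
    using suminf_split_initial_segment[OF sf, of "Suc m"] by simp
  then have "3 ^ m * (\<Sum>k. f k) = s + 3 ^ m * (\<Sum>k<m. f k) + 3 ^ m * f m"
    by (simp add: s_def algebra_simps)
  moreover have "3 ^ m * f m = 2/3 * real (a m)" by (simp add: f_def)
  moreover have "3 ^ m * (\<Sum>k<m. f k) = 2 * of_int (\<Sum>k<m. int (a k) * 3 ^ (m - Suc k))"
  proof -
    have "3 ^ m * f k = 2 * (real (a k) * 3 ^ (m - Suc k))" if "k < m" for k
    proof -
      have "(3::real) ^ m = 3 ^ (m - Suc k) * 3 ^ Suc k"
        unfolding power_add[symmetric] using that by (intro arg_cong[of _ _ "\<lambda>j. 3 ^ j"]) simp
      then show ?thesis by (simp add: f_def field_simps)
    qed
    then show ?thesis by (simp add: sum_distrib_left)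
  qed
  ultimately have "3 ^ m * (\<Sum>k. f k) = (s + 2/3 * real (a m)) + 2 * of_int (\<Sum>k<m. int (a k) * 3 ^ (m - Suc k))"
    by simp
  then have "schoenberg_wave (3 ^ m * (\<Sum>k. f k)) = schoenberg_wave (s + 2/3 * real (a m))"
    by (simp only: schoenberg_wave_periodic)
  also have "\<dots> = real (a m)"
    using a[of m] s0 s13 schoenberg_wave_0[of s] schoenberg_wave_1[of "s + 2/3"] by auto
  finally show ?thesis by (simp add: f_def)
qed

lemma schoenberg_curve_surj:
  assumes d: "d > 0" and c: "\<And>k. k < d \<Longrightarrow> 0 \<le> c k \<and> c k \<le> (1::real)"
  shows "\<exists>t\<in>{0..1}. \<forall>k<d. schoenberg_curve d k t = c k"
proof -
  have "\<forall>k\<in>{..<d}. \<exists>b :: nat \<Rightarrow> nat. (\<forall>n. b n \<in> {0, 1}) \<and> (\<lambda>n. real (b n) / 2 ^ Suc n) sums c k"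
    using c by (metis binary_digits_exist lessThan_iff)
  then obtain b where b: "\<And>k n. k < d \<Longrightarrow> b k n \<in> {0, 1::nat}"
    "\<And>k. k < d \<Longrightarrow> (\<lambda>n. real (b k n) / 2 ^ Suc n) sums c k"
    by (metis bchoice lessThan_iff)
  define a where "a m = b (m mod d) (m div d)" for m
  have a: "a m \<in> {0,1}" for m unfolding a_def using d by (intro b) simp
  define t where "t = (\<Sum>k. 2 * real (a k) / 3 ^ Suc k)"
  have "schoenberg_curve d k t = c k" if "k < d" for k
  proof -
    have "a (d * n + k) = b k n" for n using that by (simp add: a_def)
    then have "schoenberg_wave (3 ^ (d * n + k) * t) = real (b k n)" for n
      using schoenberg_wave_digit[of a "d * n + k", OF a] by (simp only: t_def)
    then show ?thesis using sums_unique[OF b(2)[OF that]] by (simp add: schoenberg_curve_def)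
  qed
  moreover have "t \<in> {0..1}"
  proof -
    have geo: "(\<lambda>k. 2 / 3 ^ Suc k :: real) sums 1"
      using sums_mult[OF geometric_sums[of "1/3::real"], of "2/3"] by (simp add: power_divide)
    have le: "0 \<le> 2 * real (a k) / 3 ^ Suc k" "2 * real (a k) / 3 ^ Suc k \<le> 2 / 3 ^ Suc k" for k
      using a[of k] by (auto simp: field_simps)
    have "summable (\<lambda>k. 2 * real (a k) / 3 ^ Suc k)"
      by (rule summable_comparison_test'[OF sums_summable[OF geo], of 0]) (use le in auto)
    then show ?thesis
      using suminf_le[OF le(2) _ sums_summable[OF geo]] sums_unique[OF geo] suminf_nonneg[OF _ le(1)]
      by (auto simp: t_def)
  qed
  ultimately show ?thesis by blast
qed

lemma cube_continuous_image_of_line: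
  obtains g :: "real \<Rightarrow> (real \<times> real) \<times> (real \<times> real)" where "continuous_on UNIV g"
    "\<And>x1 x2 y1 y2. \<bar>x1\<bar> \<le> 1 \<Longrightarrow> \<bar>x2\<bar> \<le> 1 \<Longrightarrow> \<bar>y1\<bar> \<le> 1 \<Longrightarrow> \<bar>y2\<bar> \<le> 1 \<Longrightarrow> ((x1, x2), (y1, y2)) \<in> g ` {0..1}"
proof -
  define c where "c k t = 2 * schoenberg_curve 4 k t - 1" for k t
  define g where "g t = ((c 0 t, c 1 t), (c 2 t, c 3 t))" for t
  have cc: "continuous_on UNIV (c k)" for k
    unfolding c_def by (intro continuous_intros continuous_schoenberg_curve)
  have "continuous_on UNIV g"
    unfolding g_def by (intro continuous_on_Pair cc)
  moreover have "((x1, x2), (y1, y2)) \<in> g ` {0..1}"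
    if "\<bar>x1\<bar> \<le> 1" "\<bar>x2\<bar> \<le> 1" "\<bar>y1\<bar> \<le> 1" "\<bar>y2\<bar> \<le> 1" for x1 x2 y1 y2
  proof -
    define e where "e = (\<lambda>k::nat. ((if k = 0 then x1 else if k = 1 then x2 else if k = 2 then y1 else y2) + 1) / 2)"
    obtain t where t01: "t \<in> {0..1}" and t: "\<forall>k<4. schoenberg_curve 4 k t = e k"
    proof -
      have "0 \<le> e k \<and> e k \<le> 1" if "k < 4" for k
        using \<open>\<bar>x1\<bar> \<le> 1\<close> \<open>\<bar>x2\<bar> \<le> 1\<close> \<open>\<bar>y1\<bar> \<le> 1\<close> \<open>\<bar>y2\<bar> \<le> 1\<close> by (auto simp: e_def abs_le_iff)
      then show ?thesis using schoenberg_curve_surj[of 4 e] that by auto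
    qed
    have "c k t = 2 * e k - 1" if "k < 4" for k using t that by (simp add: c_def)
    then have "g t = ((x1, x2), (y1, y2))" by (simp add: g_def e_def add_divide_distrib)
    then show ?thesis using t01 by (metis imageI)
  qed
  ultimately show ?thesis using that by blast
qed

text \<open>
Weak compactness of laws on the cube, reduced to Helly's theorem on the line: the random points are
lifted to the parameter interval of a curve that fills the cube, and the limit law is transported back
along the curve. The laws are discrete, so the lifting \<open>s\<close> need not be measurable in any other sense.
\<close>

lemma weakly_convergent_subsequence_of_cube_valued:
  fixes P :: "nat \<Rightarrow> 'i pmf" and X Y :: "nat \<Rightarrow> 'i \<Rightarrow> real \<times> real"
  assumes X: "\<And>n i. \<bar>fst (X n i)\<bar> \<le> 1 \<and> \<bar>snd (X n i)\<bar> \<le> 1"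
    and Y: "\<And>n i. \<bar>fst (Y n i)\<bar> \<le> 1 \<and> \<bar>snd (Y n i)\<bar> \<le> 1"
  obtains r Q and g h :: "real \<Rightarrow> real \<times> real" where
    "strict_mono r" "real_distribution Q" "continuous_on UNIV g" "continuous_on UNIV h"
    "\<And>f :: (real \<times> real) \<times> (real \<times> real) \<Rightarrow> real. continuous_on UNIV f \<Longrightarrow> bounded (range f) \<Longrightarrow>
       (\<lambda>n. \<integral>i. f (X (r n) i, Y (r n) i) \<partial>measure_pmf (P (r n))) \<longlonglongrightarrow> (\<integral>t. f (g t, h t) \<partial>Q)"
proof -
  obtain G :: "real \<Rightarrow> (real \<times> real) \<times> (real \<times> real)" where G: "continuous_on UNIV G"
    "\<And>x1 x2 y1 y2. \<bar>x1\<bar> \<le> 1 \<Longrightarrow> \<bar>x2\<bar> \<le> 1 \<Longrightarrow> \<bar>y1\<bar> \<le> 1 \<Longrightarrow> \<bar>y2\<bar> \<le> 1 \<Longrightarrow> ((x1, x2), (y1, y2)) \<in> G ` {0..1}"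
    using cube_continuous_image_of_line by blast
  have ex: "\<exists>t\<in>{0..1}. G t = (X n i, Y n i)" for n i
    using G(2)[of "fst (X n i)" "snd (X n i)" "fst (Y n i)" "snd (Y n i)"] X[of n i] Y[of n i] by auto
  define s where "s n i = (SOME t. t \<in> {0..1} \<and> G t = (X n i, Y n i))" for n i
  have "s n i \<in> {0..1} \<and> G (s n i) = (X n i, Y n i)" for n i
    unfolding s_def by (rule someI_ex) (use ex in blast)
  then have s: "s n i \<in> {0..1}" "G (s n i) = (X n i, Y n i)" for n i
    by blast+
  define \<mu> where "\<mu> n = distr (measure_pmf (P n)) borel (s n)" for n
  have rd: "real_distribution (\<mu> n)" for n
    unfolding \<mu>_def by (intro prob_space.real_distribution_distr prob_space_measure_pmf) auto
  have "measure (\<mu> n) {-1<..1} = 1" for n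
  proof -
    have "s n -` {-1<..1} = UNIV" using s(1)[of n] by force
    then show ?thesis by (simp add: \<mu>_def measure_distr)
  qed
  then have "tight \<mu>"
    unfolding tight_def using rd by (intro conjI allI impI exI[of _ "-1::real"] exI[of _ "1::real"]) auto
  from tight_imp_convergent_subsubsequence[OF this strict_mono_id]
  obtain r Q where r: "strict_mono (r :: nat \<Rightarrow> nat)" and Q: "real_distribution Q"
    and w: "weak_conv_m (\<mu> \<circ> r) Q" by (auto simp: comp_def)
  show ?thesis
  proof (rule that[OF r Q, of "\<lambda>t. fst (G t)" "\<lambda>t. snd (G t)"])
    fix f :: "(real \<times> real) \<times> (real \<times> real) \<Rightarrow> real"
    assume f: "continuous_on UNIV f" "bounded (range f)"
    then obtain B where B: "\<And>z. norm (f z) \<le> B" by (auto simp: bounded_iff)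
    have fG: "continuous_on UNIV (\<lambda>t. f (G t))"
      using continuous_on_compose2[OF f(1) G(1)] by simp
    have "(\<lambda>n. integral\<^sup>L ((\<mu> \<circ> r) n) (\<lambda>t. f (G t))) \<longlonglongrightarrow> integral\<^sup>L Q (\<lambda>t. f (G t))"
      by (rule weak_conv_imp_integral_bdd_continuous_conv[OF _ Q w, of _ B])
        (use fG rd B in \<open>auto simp: continuous_on_eq_continuous_at\<close>)
    moreover have "integral\<^sup>L ((\<mu> \<circ> r) n) (\<lambda>t. f (G t)) = (\<integral>i. f (X (r n) i, Y (r n) i) \<partial>measure_pmf (P (r n)))" for n
      using borel_measurable_continuous_onI[OF fG] by (simp add: \<mu>_def integral_distr s(2))
    ultimately show "(\<lambda>n. \<integral>i. f (X (r n) i, Y (r n) i) \<partial>measure_pmf (P (r n))) \<longlonglongrightarrow> (\<integral>t. f (fst (G t), snd (G t)) \<partial>Q)"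
      by simp
  qed (intro continuous_on_fst continuous_on_snd G)+
qed

section \<open>Polar decomposition of a projected vector measure\<close>

text \<open>
The density \<open>f\<close> plays the role of the conditional expectation of \<open>Y\<close> given \<open>X\<close>, as a function of the
value of \<open>X\<close>. Its components are Radon-Nikodym derivatives of the laws of \<open>X\<close> under the densities
\<open>1 + Y \<bullet> b\<close>, which are nonnegative because \<open>norm Y \<le> 1\<close>.
\<close>

lemma barycentric_density:
  fixes X Y :: "'t \<Rightarrow> 'a::euclidean_space"
  assumes "finite_measure Q" and X[measurable]: "X \<in> borel_measurable Q" and Y[measurable]: "Y \<in> borel_measurable Q"
    and Y1: "\<And>t. norm (Y t) \<le> 1"
  obtains f where "f \<in> borel_measurable borel" "integrable (distr Q borel X) f"
    "\<And>\<phi> b B. \<phi> \<in> borel_measurable borel \<Longrightarrow> (\<And>x. \<bar>\<phi> x\<bar> \<le> B) \<Longrightarrow> b \<in> Basis \<Longrightarrow>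
       (\<integral>t. \<phi> (X t) * (Y t \<bullet> b) \<partial>Q) = (\<integral>x. \<phi> x * (f x \<bullet> b) \<partial>distr Q borel X)"
proof -
  interpret Q: finite_measure Q by fact
  define M where "M = distr Q borel X"
  interpret M: finite_measure M unfolding M_def by (rule Q.finite_measure_distr) simp
  have setsM [simp, measurable_cong]: "sets M = sets borel" by (simp add: M_def)
  have spM [simp]: "space M = UNIV" by (simp add: M_def)
  have Yb: "\<bar>Y t \<bullet> b\<bar> \<le> 1" if "b \<in> Basis" for t b
    using Basis_le_norm[OF that, of "Y t"] Y1[of t] by simp
  have "\<exists>D. D \<in> borel_measurable borel \<and> (\<forall>x. 0 \<le> D x) \<and> integrable M D \<and>
      (\<forall>\<phi> B. \<phi> \<in> borel_measurable borel \<longrightarrow> (\<forall>x. \<bar>\<phi> x\<bar> \<le> B) \<longrightarrow>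
        (\<integral>t. \<phi> (X t) * (1 + Y t \<bullet> b) \<partial>Q) = (\<integral>x. \<phi> x * D x \<partial>M))" if b: "b \<in> Basis" for b
  proof -
    define R where "R = density Q (\<lambda>t. ennreal (1 + Y t \<bullet> b))"
    define N where "N = distr R borel X"
    have [measurable_cong, simp]: "sets R = sets Q" by (simp add: R_def)
    have "finite_measure R"
    proof
      have "emeasure R (space R) = (\<integral>\<^sup>+ t. ennreal (1 + Y t \<bullet> b) \<partial>Q)"
        by (simp add: R_def emeasure_density cong: nn_integral_cong)
      also have "\<dots> \<le> (\<integral>\<^sup>+ t. 2 \<partial>Q)"
        using Yb[OF b] by (intro nn_integral_mono) (auto simp: abs_le_iff ennreal_le_iff simp flip: ennreal_numeral)
      also have "\<dots> < \<infinity>" using Q.emeasure_finite[of "space Q"] by (simp add: ennreal_mult_eq_top_iff less_top[symmetric])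
      finally show "emeasure R (space R) \<noteq> \<infinity>" by simp
    qed
    then have finN: "finite_measure N" unfolding N_def by (rule finite_measure.finite_measure_distr) simp
    interpret N: finite_measure N by fact
    have setsN [simp, measurable_cong]: "sets N = sets M" by (simp add: N_def)
    have ac: "absolutely_continuous M N"
      unfolding absolutely_continuous_def
    proof
      fix A assume A: "A \<in> null_sets M"
      then have [measurable]: "A \<in> sets borel" by (auto simp: null_sets_def)
      from A have 0: "X -` A \<inter> space Q \<in> null_sets Q"
        by (auto simp: null_sets_def M_def emeasure_distr)
      have "emeasure N A = (\<integral>\<^sup>+ t. ennreal (1 + Y t \<bullet> b) * indicator (X -` A \<inter> space Q) t \<partial>Q)"
        by (simp add: N_def emeasure_distr R_def emeasure_density)
      also have "\<dots> = 0"
        using AE_not_in[OF 0] by (subst nn_integral_0_iff_AE) auto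
      finally show "A \<in> null_sets N" by (auto simp: null_sets_def)
    qed
    obtain D where D: "D \<in> borel_measurable M" "AE x in M. RN_deriv M N x = ennreal (D x)" "\<And>x. 0 \<le> D x"
      using M.real_RN_deriv[OF finN ac setsN] by metis
    have dens: "density M (\<lambda>x. ennreal (D x)) = N"
      using M.density_RN_deriv[OF ac setsN] density_cong[of "RN_deriv M N" M "\<lambda>x. ennreal (D x)"] D by simp
    have [measurable]: "D \<in> borel_measurable borel" using D(1) by simp
    have "integrable M D"
    proof (rule integrableI_nonneg)
      have "(\<integral>\<^sup>+x. ennreal (D x) \<partial>M) = emeasure N (space N)"
        by (simp only: dens[symmetric] space_density) (simp add: emeasure_density)
      then show "(\<integral>\<^sup>+x. ennreal (D x) \<partial>M) < \<infinity>" by (simp add: N.emeasure_finite less_top[symmetric])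
    qed (use D in auto)
    moreover have "(\<integral>t. \<phi> (X t) * (1 + Y t \<bullet> b) \<partial>Q) = (\<integral>x. \<phi> x * D x \<partial>M)"
      if [measurable]: "\<phi> \<in> borel_measurable borel" for \<phi>
    proof -
      have "(\<integral>x. \<phi> x * D x \<partial>M) = (\<integral>x. \<phi> x \<partial>density M (\<lambda>x. ennreal (D x)))"
        by (subst integral_density) (auto simp: D mult.commute)
      also have "\<dots> = (\<integral>t. \<phi> (X t) \<partial>R)" by (simp add: dens N_def integral_distr)
      also have "\<dots> = (\<integral>t. \<phi> (X t) * (1 + Y t \<bullet> b) \<partial>Q)"
        unfolding R_def using abs_le_D2[OF Yb[OF b]] by (subst integral_density) (auto simp: mult.commute add.commute neg_le_iff_le intro!: AE_I2, smt (verit))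
      finally show ?thesis ..
    qed
    ultimately show ?thesis using D(3) by (intro exI[of _ D]) auto
  qed
  then have "\<exists>D. \<forall>b\<in>Basis. D b \<in> borel_measurable borel \<and> (\<forall>x. 0 \<le> D b x) \<and> integrable M (D b) \<and>
      (\<forall>\<phi> B. \<phi> \<in> borel_measurable borel \<longrightarrow> (\<forall>x. \<bar>\<phi> x\<bar> \<le> B) \<longrightarrow>
        (\<integral>t. \<phi> (X t) * (1 + Y t \<bullet> b) \<partial>Q) = (\<integral>x. \<phi> x * D b x \<partial>M))"
    by (intro bchoice) blast
  then obtain D where D[measurable]: "\<And>b. b \<in> Basis \<Longrightarrow> D b \<in> borel_measurable borel"
    and Dint: "\<And>b. b \<in> Basis \<Longrightarrow> integrable M (D b)"
    and DD: "\<And>\<phi> b B. b \<in> Basis \<Longrightarrow> \<phi> \<in> borel_measurable borel \<Longrightarrow> (\<And>x. \<bar>\<phi> x\<bar> \<le> B) \<Longrightarrow>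
        (\<integral>t. \<phi> (X t) * (1 + Y t \<bullet> b) \<partial>Q) = (\<integral>x. \<phi> x * D b x \<partial>M)"
    by blast
  define f where "f x = (\<Sum>b\<in>Basis. (D b x - 1) *\<^sub>R b)" for x
  have fb: "f x \<bullet> b = D b x - 1" if "b \<in> Basis" for x b
    using that by (simp add: f_def inner_sum_left inner_Basis if_distrib cong: if_cong)
  have [measurable]: "f \<in> borel_measurable borel" unfolding f_def by measurable
  have "integrable M f" unfolding f_def[abs_def]
    by (intro Bochner_Integration.integrable_sum integrable_scaleR_left Bochner_Integration.integrable_diff Dint) auto
  moreover have "(\<integral>t. \<phi> (X t) * (Y t \<bullet> b) \<partial>Q) = (\<integral>x. \<phi> x * (f x \<bullet> b) \<partial>M)"
    if [measurable]: "\<phi> \<in> borel_measurable borel" and B: "\<And>x. \<bar>\<phi> x\<bar> \<le> B" and b: "b \<in> Basis" for \<phi> b B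
  proof -
    have i1: "integrable Q (\<lambda>t. \<phi> (X t))" by (rule Q.integrable_const_bound[of _ B]) (use B in auto)
    have i2: "integrable Q (\<lambda>t. \<phi> (X t) * (Y t \<bullet> b))"
      by (rule Bochner_Integration.integrable_bound[OF i1]) (use Yb[OF b] in \<open>auto simp: abs_mult mult_left_le\<close>)
    have i3: "integrable M \<phi>" by (rule M.integrable_const_bound[of _ B]) (use B in auto)
    have i4: "integrable M (\<lambda>x. \<phi> x * D b x)"
    proof (rule Bochner_Integration.integrable_bound[OF integrable_mult_right[OF Dint[OF b], of B]])
      have "\<bar>\<phi> x\<bar> * \<bar>D b x\<bar> \<le> \<bar>B\<bar> * \<bar>D b x\<bar>" for x
        using B[of x] by (intro mult_right_mono) auto
      then show "AE x in M. norm (\<phi> x * D b x) \<le> norm (B * D b x)" by (auto simp: abs_mult)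
    qed (use D[OF b] in measurable)
    have "(\<integral>t. \<phi> (X t) * (Y t \<bullet> b) \<partial>Q) = (\<integral>t. \<phi> (X t) * (1 + Y t \<bullet> b) \<partial>Q) - (\<integral>t. \<phi> (X t) \<partial>Q)"
      using i1 i2 by (simp add: algebra_simps)
    also have "\<dots> = (\<integral>x. \<phi> x * D b x \<partial>M) - (\<integral>x. \<phi> x \<partial>M)"
      using DD[OF b \<open>\<phi> \<in> _\<close> B] by (simp add: M_def integral_distr)
    also have "\<dots> = (\<integral>x. \<phi> x * (f x \<bullet> b) \<partial>M)"
      using i3 i4 by (simp add: fb[OF b] algebra_simps)
    finally show ?thesis .
  qed
  ultimately show ?thesis using that[of f] unfolding M_def by auto
qed

text \<open>
The vector measure \<open>f M\<close>, where \<open>M\<close> is the law of \<open>X\<close>, in polar form on \<open>U\<close>. Its mass is at most that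
of \<open>Q\<close>: with \<open>\<sigma> = f / norm f\<close> as test field the mass of \<open>f M\<close> becomes the integral of
\<open>\<sigma>(X) \<bullet> Y \<le> 1\<close>.
\<close>

lemma polar_measure_of_barycentric_density:
  fixes X Y :: "'t \<Rightarrow> 'a::euclidean_space"
  assumes "finite_measure Q" and X[measurable]: "X \<in> borel_measurable Q" and Y[measurable]: "Y \<in> borel_measurable Q"
    and Y1: "\<And>t. norm (Y t) \<le> 1" and U[measurable]: "U \<in> sets borel"
  obtains \<mu> \<sigma> where "finite_measure \<mu>" "sets \<mu> = sets (restrict_space borel U)"
    "\<sigma> \<in> borel_measurable \<mu>" "AE x in \<mu>. norm (\<sigma> x) = 1" "emeasure \<mu> (space \<mu>) \<le> emeasure Q (space Q)"
    "\<And>\<phi> b B. \<phi> \<in> borel_measurable borel \<Longrightarrow> (\<And>x. \<bar>\<phi> x\<bar> \<le> B) \<Longrightarrow> (\<And>x. x \<notin> U \<Longrightarrow> \<phi> x = 0) \<Longrightarrow> b \<in> Basis \<Longrightarrow>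
       (\<integral>t. \<phi> (X t) * (Y t \<bullet> b) \<partial>Q) = (\<integral>x. \<phi> x * (\<sigma> x \<bullet> b) \<partial>\<mu>)"
proof -
  interpret Q: finite_measure Q by fact
  define M where "M = distr Q borel X"
  interpret M: finite_measure M unfolding M_def by (rule Q.finite_measure_distr) simp
  have setsM [simp, measurable_cong]: "sets M = sets borel" by (simp add: M_def)
  have spM [simp]: "space M = UNIV" by (simp add: M_def)
  obtain f where f[measurable]: "f \<in> borel_measurable borel" and fint: "integrable M f"
    and fX: "\<And>\<phi> b B. \<phi> \<in> borel_measurable borel \<Longrightarrow> (\<And>x. \<bar>\<phi> x\<bar> \<le> B) \<Longrightarrow> b \<in> Basis \<Longrightarrow>
       (\<integral>t. \<phi> (X t) * (Y t \<bullet> b) \<partial>Q) = (\<integral>x. \<phi> x * (f x \<bullet> b) \<partial>M)"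
    using barycentric_density[OF assms(1-4), folded M_def] by blast
  define \<sigma> where "\<sigma> x = f x /\<^sub>R norm (f x)" for x
  have [measurable]: "\<sigma> \<in> borel_measurable borel" unfolding \<sigma>_def[abs_def]
    by (intro borel_measurable_scaleR borel_measurable_inverse borel_measurable_norm measurable_compose[OF f] borel_measurable_norm) simp_all
  have \<sigma>1: "norm (\<sigma> x) \<le> 1" for x by (cases "f x = 0") (simp_all add: \<sigma>_def)
  have nf: "norm (f x) *\<^sub>R \<sigma> x = f x" for x by (cases "f x = 0") (simp_all add: \<sigma>_def)
  have f\<sigma>: "(\<Sum>b\<in>Basis. (\<sigma> x \<bullet> b) * (f x \<bullet> b)) = norm (f x)" for x
  proof -
    have "(\<Sum>b\<in>Basis. (\<sigma> x \<bullet> b) * (f x \<bullet> b)) = \<sigma> x \<bullet> f x" by (rule euclidean_inner[symmetric])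
    also have "\<dots> = norm (f x)"
      by (cases "f x = 0") (auto simp: \<sigma>_def dot_square_norm power2_eq_square)
    finally show ?thesis .
  qed
  have \<sigma>b: "\<bar>\<sigma> x \<bullet> b\<bar> \<le> 1" if "b \<in> Basis" for b x
    using Basis_le_norm[OF that, of "\<sigma> x"] \<sigma>1[of x] by simp
  have intb: "integrable M (\<lambda>x. (\<sigma> x \<bullet> b) * (f x \<bullet> b))" if b: "b \<in> Basis" for b
  proof (rule Bochner_Integration.integrable_bound[OF integrable_norm[OF fint]])
    have "norm ((\<sigma> x \<bullet> b) * (f x \<bullet> b)) \<le> 1 * norm (f x)" for x
      using \<sigma>b[OF b, of x] Basis_le_norm[OF b, of "f x"] by (simp only: norm_mult real_norm_def abs_mult) (intro mult_mono, auto)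
    then show "AE x in M. norm ((\<sigma> x \<bullet> b) * (f x \<bullet> b)) \<le> norm (norm (f x))" by simp
  qed simp
  have intQ: "integrable Q (\<lambda>t. (\<sigma> (X t) \<bullet> b) * (Y t \<bullet> b))" if b: "b \<in> Basis" for b
  proof (rule Q.integrable_const_bound[of _ 1])
    have "\<bar>(\<sigma> (X t) \<bullet> b) * (Y t \<bullet> b)\<bar> \<le> 1 * 1" for t
      unfolding abs_mult using \<sigma>b[OF b, of "X t"] Basis_le_norm[OF b, of "Y t"] Y1[of t]
      by (intro mult_mono) auto
    then show "AE t in Q. norm ((\<sigma> (X t) \<bullet> b) * (Y t \<bullet> b)) \<le> 1" by simp
  qed simp
  \<comment> \<open>The field \<open>\<sigma>\<close> is bounded and Borel, hence an admissible test field
      componentwise.\<close>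
  have "(\<integral>x. norm (f x) \<partial>M) = (\<Sum>b\<in>Basis. \<integral>x. (\<sigma> x \<bullet> b) * (f x \<bullet> b) \<partial>M)"
    by (subst Bochner_Integration.integral_sum[symmetric]) (auto simp: intb f\<sigma>)
  also have "\<dots> = (\<Sum>b\<in>Basis. \<integral>t. (\<sigma> (X t) \<bullet> b) * (Y t \<bullet> b) \<partial>Q)"
    by (intro sum.cong refl fX[symmetric, of _ 1] \<sigma>b) auto
  also have "\<dots> = (\<integral>t. \<sigma> (X t) \<bullet> Y t \<partial>Q)"
    by (subst Bochner_Integration.integral_sum[symmetric]) (auto simp: intQ euclidean_inner[of "\<sigma> _" "Y _"])
  also have "\<dots> \<le> (\<integral>t. 1 \<partial>Q)"
  proof (rule integral_mono)
    have bd: "\<bar>\<sigma> (X t) \<bullet> Y t\<bar> \<le> 1" for t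
      using Cauchy_Schwarz_ineq2[of "\<sigma> (X t)" "Y t"] mult_mono[OF \<sigma>1[of "X t"] Y1[of t]] by simp
    then show "integrable Q (\<lambda>t. \<sigma> (X t) \<bullet> Y t)" by (intro Q.integrable_const_bound[of _ 1]) auto
    show "\<sigma> (X t) \<bullet> Y t \<le> 1" for t using bd[of t] by simp
  qed simp
  finally have mass: "(\<integral>x. norm (f x) \<partial>M) \<le> measure Q (space Q)" by simp
  define \<nu> where "\<nu> = density M (\<lambda>x. ennreal (norm (f x)))"
  have [simp, measurable_cong]: "sets \<nu> = sets borel" by (simp add: \<nu>_def)
  have sp\<nu> [simp]: "space \<nu> = UNIV" by (simp add: \<nu>_def)
  define \<mu> where "\<mu> = restrict_space \<nu> U"
  have "emeasure \<mu> (space \<mu>) = emeasure \<nu> U"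
    by (simp add: \<mu>_def emeasure_restrict_space space_restrict_space)
  also have "\<dots> \<le> emeasure \<nu> (space \<nu>)" by (intro emeasure_space)
  also have "\<dots> = (\<integral>\<^sup>+x. ennreal (norm (f x)) \<partial>M)"
    by (simp add: \<nu>_def emeasure_density)
  also have "\<dots> = ennreal (\<integral>x. norm (f x) \<partial>M)"
    using fint by (intro nn_integral_eq_integral) auto
  also have "\<dots> \<le> ennreal (measure Q (space Q))" using mass by (intro ennreal_leI)
  also have "\<dots> = emeasure Q (space Q)" by (simp add: Q.emeasure_eq_measure)
  finally have em: "emeasure \<mu> (space \<mu>) \<le> emeasure Q (space Q)" .
  have "finite_measure \<mu>"
    using em Q.emeasure_finite[of "space Q"] by (intro finite_measureI) (metis infinity_ennreal_def top.extremum_uniqueI)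
  moreover have "sets \<mu> = sets (restrict_space borel U)" unfolding \<mu>_def by (intro sets_restrict_space_cong) simp
  moreover have "\<sigma> \<in> borel_measurable \<mu>" unfolding \<mu>_def by (intro measurable_restrict_space1) simp
  moreover have "AE x in \<mu>. norm (\<sigma> x) = 1"
  proof -
    have "AE x in \<nu>. norm (\<sigma> x) = 1" unfolding \<nu>_def
      by (subst AE_density) (auto simp: \<sigma>_def)
    then show ?thesis unfolding \<mu>_def by (subst AE_restrict_space_iff) auto
  qed
  moreover have "(\<integral>t. \<phi> (X t) * (Y t \<bullet> b) \<partial>Q) = (\<integral>x. \<phi> x * (\<sigma> x \<bullet> b) \<partial>\<mu>)"
    if [measurable]: "\<phi> \<in> borel_measurable borel" and B: "\<And>x. \<bar>\<phi> x\<bar> \<le> B" and z: "\<And>x. x \<notin> U \<Longrightarrow> \<phi> x = 0"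
      and b: "b \<in> Basis" for \<phi> b B
  proof -
    have "(\<integral>x. \<phi> x * (\<sigma> x \<bullet> b) \<partial>\<mu>) = (\<integral>x. indicator U x *\<^sub>R (\<phi> x * (\<sigma> x \<bullet> b)) \<partial>\<nu>)"
      unfolding \<mu>_def by (subst integral_restrict_space) auto
    also have "(\<lambda>x. indicator U x *\<^sub>R (\<phi> x * (\<sigma> x \<bullet> b))) = (\<lambda>x. \<phi> x * (\<sigma> x \<bullet> b))"
    proof
      fix x show "indicator U x *\<^sub>R (\<phi> x * (\<sigma> x \<bullet> b)) = \<phi> x * (\<sigma> x \<bullet> b)"
        using z[of x] by (cases "x \<in> U") auto
    qed
    also have "(\<integral>x. \<phi> x * (\<sigma> x \<bullet> b) \<partial>\<nu>) = (\<integral>x. norm (f x) *\<^sub>R (\<phi> x * (\<sigma> x \<bullet> b)) \<partial>M)"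
      unfolding \<nu>_def by (subst integral_density) auto
    also have "\<dots> = (\<integral>x. \<phi> x * (f x \<bullet> b) \<partial>M)"
    proof (rule Bochner_Integration.integral_cong[OF refl])
      fix x show "norm (f x) *\<^sub>R (\<phi> x * (\<sigma> x \<bullet> b)) = \<phi> x * (f x \<bullet> b)"
        using arg_cong[OF nf[of x], of "\<lambda>v. v \<bullet> b"] by (simp add: mult.left_commute)
    qed
    also have "\<dots> = (\<integral>t. \<phi> (X t) * (Y t \<bullet> b) \<partial>Q)" by (rule fX[symmetric, OF _ B b]) simp
    finally show ?thesis ..
  qed
  ultimately show ?thesis using that em by blast
qed

section \<open>Cells and upwind difference quotients\<close>

text \<open>
The grid point \<open>p / n\<close>, which is the centre of \<^term>\<open>cell n p\<close> for \<open>n > 0\<close>.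
\<close>

definition cell_center :: "nat \<Rightarrow> int \<times> int \<Rightarrow> real \<times> real" where
  "cell_center n p = (real_of_int (fst p) / real n, real_of_int (snd p) / real n)"

lemma open_square_borel [measurable, simp]: "open_square \<in> sets borel"
  and open_open_square [simp]: "open open_square"
  unfolding open_square_def by (auto intro!: borel_open open_Times)

lemma open_square_box: "open_square = box (0, 0) (1, 1)"
  by (auto simp: open_square_def box_def Basis_prod_def)

lemma finite_grid [simp]: "finite (grid n)" by (simp add: grid_def)

lemma cell_eq_box:
  "cell n p = box ((real_of_int (fst p) - 1/2) / real n, (real_of_int (snd p) - 1/2) / real n)
                  ((real_of_int (fst p) + 1/2) / real n, (real_of_int (snd p) + 1/2) / real n)"
  by (auto simp: cell_def box_def Basis_prod_def split: prod.splits)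

lemma open_cell [simp]: "open (cell n p)" by (simp add: cell_eq_box open_box)
lemma cell_borel [measurable, simp]: "cell n p \<in> sets borel" by (simp add: borel_open)

lemma in_cell_iff:
  assumes "n > 0"
  shows "x \<in> cell n p \<longleftrightarrow> \<bar>real n * fst x - of_int (fst p)\<bar> < 1/2 \<and> \<bar>real n * snd x - of_int (snd p)\<bar> < 1/2"
proof -
  have "s \<in> {(of_int i - 1/2) / real n <..< (of_int i + 1/2) / real n} \<longleftrightarrow> \<bar>real n * s - of_int i\<bar> < 1/2" for s and i :: int
    using assms unfolding abs_less_iff by (simp add: pos_divide_less_eq pos_less_divide_eq mult.commute) linarith
  then show ?thesis by (cases x; cases p) (auto simp: cell_def)
qed

lemma emeasure_cell: "n > 0 \<Longrightarrow> emeasure lborel (cell n p) = ennreal (1 / (real n)\<^sup>2)"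
proof -
  assume n: "n > 0"
  have 1: "(real_of_int i + 1/2) / real n - (real_of_int i - 1/2) / real n = 1 / real n" for i
    by (simp add: diff_divide_distrib[symmetric])
  show ?thesis unfolding cell_eq_box using n
    by (subst emeasure_lborel_box) (auto simp: Basis_prod_def 1 divide_right_mono prod.insert_if power2_eq_square)
qed

lemma cell_center_in_cell: "n > 0 \<Longrightarrow> cell_center n p \<in> cell n p"
  by (simp add: in_cell_iff cell_center_def)

lemma dist_in_cell:
  assumes "n > 0" "x \<in> cell n p" "y \<in> cell n p"
  shows "norm (x - y) \<le> 2 / real n"
proof -
  have 1: "\<bar>real n * fst x - real n * fst y\<bar> < 1" "\<bar>real n * snd x - real n * snd y\<bar> < 1"
    using assms(2,3) unfolding in_cell_iff[OF assms(1)] by linarith+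
  have "real n * \<bar>fst x - fst y\<bar> < 1" "real n * \<bar>snd x - snd y\<bar> < 1"
    using 1 by (simp_all flip: right_diff_distrib add: abs_mult)
  then have "\<bar>fst x - fst y\<bar> \<le> 1 / real n" "\<bar>snd x - snd y\<bar> \<le> 1 / real n"
    using assms(1) by (simp_all add: field_simps)
  then show ?thesis
    using norm_Pair_le[of "fst x - fst y" "snd x - snd y"] by (cases x; cases y) auto
qed

lemma disjoint_cells:
  assumes "n > 0" "x \<in> cell n p" "x \<in> cell n q" shows "p = q"
proof -
  have "\<bar>real_of_int (fst p) - of_int (fst q)\<bar> < 1" "\<bar>real_of_int (snd p) - of_int (snd q)\<bar> < 1"
    using assms(2,3) unfolding in_cell_iff[OF assms(1)] by linarith+
  then show ?thesis by (auto intro!: prod_eqI)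
qed

lemma cell_subset_open_square:
  assumes "p \<in> grid n" shows "cell n p \<subseteq> open_square"
proof
  fix x assume x: "x \<in> cell n p"
  have n: "n > 0" using assms by (auto simp: grid_def)
  have p: "1 \<le> fst p" "fst p \<le> int n - 1" "1 \<le> snd p" "snd p \<le> int n - 1" using assms by (auto simp: grid_def)
  then have p': "1 \<le> real_of_int (fst p)" "real_of_int (fst p) \<le> real n - 1" "1 \<le> real_of_int (snd p)" "real_of_int (snd p) \<le> real n - 1"
    by linarith+
  have "0 < real n * fst x" "real n * fst x < real n * 1" "0 < real n * snd x" "real n * snd x < real n * 1"
    using x p' unfolding in_cell_iff[OF n] by linarith+
  then show "x \<in> open_square"
    using n by (auto simp: open_square_def zero_less_mult_iff mult_less_cancel_left mem_Times_iff)
qed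

text \<open>
Almost every point lies in a cell of every mesh, the cells being indexed by all integer pairs here and
not only by those of the grid: the lines between the cells form a null set.
\<close>

lemma AE_in_cells: "AE x in lborel. \<forall>n>0. \<exists>p. x \<in> cell n p"
proof -
  define N where "N = (\<Union>b\<in>(Basis :: (real \<times> real) set). \<Union>(n::nat). \<Union>(m::int). {x :: real \<times> real. x \<bullet> b = (of_int m + 1/2) / real n})"
  have "negligible N" unfolding N_def
    unfolding negligible_iff_null_sets
  proof (rule null_sets_UN')
    show "countable (Basis :: (real \<times> real) set)" by (intro countable_finite finite_Basis)
    fix b :: "real \<times> real" assume b: "b \<in> Basis"
    have "{x. x \<bullet> b = c} \<in> null_sets lebesgue" for c
      using negligible_standard_hyperplane[OF b, of c] by (simp add: negligible_iff_null_sets)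
    then show "(\<Union>n::nat. \<Union>m::int. {x. x \<bullet> b = (of_int m + 1/2) / real n}) \<in> null_sets lebesgue"
      by (intro null_sets_UN' countableI_type)
  qed
  then have "AE x in lebesgue. x \<notin> N"
    by (simp add: negligible_iff_null_sets AE_not_in)
  then have "AE x in lborel. x \<notin> N" by (simp add: AE_completion_iff)
  moreover have "\<exists>p. x \<in> cell n p" if x: "x \<notin> N" and n: "n > 0" for x n
  proof -
    have ne: "real n * fst x \<noteq> of_int m + 1/2" "real n * snd x \<noteq> of_int m + 1/2" for m
    proof -
      have "x \<bullet> b \<noteq> (of_int m + 1/2) / real n" if "b \<in> Basis" for b
        using x that unfolding N_def by blast
      from this[of "(1, 0)"] this[of "(0, 1)"] show "real n * fst x \<noteq> of_int m + 1/2" "real n * snd x \<noteq> of_int m + 1/2"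
        using n by (auto simp: Basis_prod_def inner_prod_def nonzero_eq_divide_eq mult.commute)
    qed
    have "\<bar>real n * t - of_int \<lfloor>real n * t + 1/2\<rfloor>\<bar> < 1/2" if "\<And>m. real n * t \<noteq> of_int m + 1/2" for t
    proof -
      have "real n * t \<noteq> of_int (\<lfloor>real n * t + 1/2\<rfloor> - 1) + 1/2" by (rule that)
      then have "real n * t \<noteq> of_int \<lfloor>real n * t + 1/2\<rfloor> - 1/2" by simp
      then show ?thesis using floor_correct[of "real n * t + 1/2"] by (simp only: abs_less_iff) linarith
    qed
    then have "x \<in> cell n (\<lfloor>real n * fst x + 1/2\<rfloor>, \<lfloor>real n * snd x + 1/2\<rfloor>)"
      using ne unfolding in_cell_iff[OF n] by simp
    then show ?thesis by blast
  qed
  ultimately show ?thesis by (auto elim!: eventually_mono)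
qed

text \<open>
The vector carried by a grid point: right minus left and upper minus lower positive part. Each nonzero
difference of neighbouring values enters at exactly one of the two points, the one with the lower value,
and with the sign of a derivative, so these vectors represent the distributional gradient.
\<close>

definition upwind_gradient :: "(int \<times> int \<Rightarrow> real) \<Rightarrow> int \<times> int \<Rightarrow> real \<times> real" where
  "upwind_gradient a p = (case positive_parts (discrete_gradient a p) of (r, l, t, d) \<Rightarrow> (r - l, t - d))"

lemma norm_upwind_gradient_le:
  "norm (upwind_gradient a p) \<le> norm (positive_parts (discrete_gradient a p))"
proof -
  obtain x y z w where xyz: "discrete_gradient a p = (x, y, z, w)" by (metis prod_cases4)
  have sq: "(max s 0 - max t 0)\<^sup>2 \<le> (max s 0)\<^sup>2 + (max t 0)\<^sup>2" for s t :: real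
  proof -
    have "0 \<le> 2 * (max s 0 * max t 0)" by simp
    then show ?thesis by (simp add: power2_diff)
  qed
  show ?thesis
    using sq[of x y] sq[of z w]
    by (simp add: upwind_gradient_def xyz positive_parts_def norm_Pair)
qed

lemma upwind_gradient_inner:
  assumes "e \<in> {(1, 0), (0, 1)}"
  shows "upwind_gradient a p \<bullet> (real_of_int (fst e), real_of_int (snd e)) =
     max (a (p + e) - a p) 0 - max (a (p - e) - a p) 0"
    and "max (a (p - e) - a p) 0 \<le> norm (positive_parts (discrete_gradient a p))"
proof -
  show "upwind_gradient a p \<bullet> (real_of_int (fst e), real_of_int (snd e)) =
     max (a (p + e) - a p) 0 - max (a (p - e) - a p) 0"
    using assms by (cases p) (auto simp: upwind_gradient_def positive_parts_def discrete_gradient_def inner_prod_def)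
  have le: "\<bar>y\<bar> \<le> norm (x, y, z, w)" "\<bar>w\<bar> \<le> norm (x, y, z, w)" for x y z w :: real
    by (auto simp: norm_Pair intro!: real_le_rsqrt)
  show "max (a (p - e) - a p) 0 \<le> norm (positive_parts (discrete_gradient a p))"
    using assms le by (cases p) (auto simp: positive_parts_def discrete_gradient_def intro: order_trans[OF _ order_trans[OF abs_ge_self le(1)]] order_trans[OF _ order_trans[OF abs_ge_self le(2)]])
qed

text \<open>
An edge with increasing values is counted at its lower end and one with decreasing values at its upper
end. Moving all of them to the same end leaves the error term with the backward positive part.
\<close>

lemma upwind_summation_by_parts:
  fixes a f :: "int \<times> int \<Rightarrow> real"
  assumes fin: "finite G" and supp: "\<And>p. f p \<noteq> 0 \<Longrightarrow> p \<in> G \<and> p + e \<in> G"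
  shows "(\<Sum>p\<in>G. f p * (max (a (p + e) - a p) 0 - max (a (p - e) - a p) 0)) =
    (\<Sum>p\<in>G. (f (p - e) - f p) * (a p + max (a (p - e) - a p) 0))"
proof -
  have shift: "(\<Sum>p\<in>G. f p * k (p + e)) = (\<Sum>p\<in>G. f (p - e) * k p)" for k
    by (rule sum.reindex_bij_witness_not_neutral[of "{p\<in>G. f p * k (p + e) = 0}" "{p\<in>G. f (p - e) * k p = 0}" _ "\<lambda>p. p - e" "\<lambda>p. p + e"])
      (use fin supp in \<open>auto dest: supp\<close>)
  have "(\<Sum>p\<in>G. f p * (max (a (p + e) - a p) 0 - max (a (p - e) - a p) 0)) =
     (\<Sum>p\<in>G. f p * (a (p + e) + max (a (p + e - e) - a (p + e)) 0)) - (\<Sum>p\<in>G. f p * (a p + max (a (p - e) - a p) 0))"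
    unfolding sum_subtractf[symmetric] by (intro sum.cong refl) (auto simp: max_def algebra_simps)
  also have "\<dots> = (\<Sum>p\<in>G. (f (p - e) - f p) * (a p + max (a (p - e) - a p) 0))"
    unfolding shift[of "\<lambda>p. a p + max (a (p - e) - a p) 0"] by (simp add: left_diff_distrib sum_subtractf)
  finally show ?thesis .
qed


lemma integrable_on_open_square_bounded:
  assumes "g \<in> borel_measurable (lebesgue_on open_square)" "\<And>x. x \<in> open_square \<Longrightarrow> \<bar>g x :: real\<bar> \<le> B"
  shows "integrable (lebesgue_on open_square) g"
proof -
  have "open_square \<in> lmeasurable" unfolding open_square_box by simp
  then have "finite_measure (lebesgue_on open_square)" by (rule finite_measure_lebesgue_on)
  then show ?thesis using assms
    by (intro finite_measure.integrable_const_bound[of _ _ B]) (auto intro!: AE_I2 simp: space_restrict_space)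
qed

lemma borel_measurable_lebesgue_on_open_square:
  fixes g :: "real \<times> real \<Rightarrow> real"
  shows "g \<in> borel_measurable borel \<Longrightarrow> g \<in> borel_measurable (lebesgue_on open_square)"
  by (intro measurable_restrict_space1 measurable_completion) simp

lemma integral_open_square_lborel:
  fixes g :: "real \<times> real \<Rightarrow> real"
  assumes [measurable]: "g \<in> borel_measurable borel"
  shows "(\<integral>x. g x \<partial>lebesgue_on open_square) = (\<integral>x. indicator open_square x * g x \<partial>lborel)"
proof -
  have "(\<integral>x. g x \<partial>lebesgue_on open_square) = (\<integral>x. indicator open_square x *\<^sub>R g x \<partial>lebesgue)"
    by (subst integral_restrict_space) auto
  also have "\<dots> = (\<integral>x. indicator open_square x *\<^sub>R g x \<partial>lborel)"
    by (subst integral_completion) auto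
  finally show ?thesis by simp
qed

lemma measure_cell_on_open_square:
  assumes "p \<in> grid n" shows "(\<integral>x. indicat_real (cell n p) x \<partial>lebesgue_on open_square) = 1 / (real n)\<^sup>2"
proof -
  have n: "n > 0" using assms by (auto simp: grid_def)
  have "(\<integral>x. indicat_real (cell n p) x \<partial>lebesgue_on open_square) = (\<integral>x. indicat_real (cell n p) x \<partial>lborel)"
  proof -
    have eq: "(\<lambda>x. indicator open_square x * indicat_real (cell n p) x) = (indicator (cell n p) :: _ \<Rightarrow> real)"
      using cell_subset_open_square[OF assms] by (auto simp: indicator_def fun_eq_iff)
    have "(\<integral>x. indicat_real (cell n p) x \<partial>lebesgue_on open_square) = (\<integral>x. indicator open_square x * (indicat_real (cell n p) x :: real) \<partial>lborel)"
      by (rule integral_open_square_lborel) simp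
    then show ?thesis by (simp only: eq)
  qed
  also have "\<dots> = 1 / (real n)\<^sup>2" using emeasure_cell[OF n, of p] by (simp add: measure_def)
  finally show ?thesis .
qed

lemma cellwise_integral_error:
  fixes g :: "real \<times> real \<Rightarrow> real"
  assumes p: "p \<in> grid n" and g: "g \<in> borel_measurable borel" "\<And>x. \<bar>g x\<bar> \<le> B"
    and c: "\<And>y. y \<in> cell n p \<Longrightarrow> \<bar>g y - c\<bar> \<le> \<eta>"
  shows "\<bar>(\<integral>x. indicator (cell n p) x * g x \<partial>lebesgue_on open_square) - c / (real n)\<^sup>2\<bar> \<le> \<eta> / (real n)\<^sup>2"
proof -
  note [measurable] = g(1)
  have i1: "integrable (lebesgue_on open_square) (\<lambda>x. indicator (cell n p) x * g x)"
  proof (rule integrable_on_open_square_bounded[of _ "\<bar>B\<bar>"])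
    fix x show "\<bar>indicator (cell n p) x * g x\<bar> \<le> \<bar>B\<bar>" using g(2)[of x] by (auto simp: indicator_def)
  qed (rule borel_measurable_lebesgue_on_open_square, measurable)
  have i2: "integrable (lebesgue_on open_square) (\<lambda>x. indicator (cell n p) x * d)" for d :: real
    by (rule integrable_on_open_square_bounded[of _ "\<bar>d\<bar>"], rule borel_measurable_lebesgue_on_open_square, measurable)
      (auto simp: indicator_def)
  have "(\<integral>x. indicator (cell n p) x * g x \<partial>lebesgue_on open_square) - c / (real n)\<^sup>2
     = (\<integral>x. indicator (cell n p) x * g x - indicator (cell n p) x * c \<partial>lebesgue_on open_square)"
    using measure_cell_on_open_square[OF p] by (subst Bochner_Integration.integral_diff[OF i1 i2]) simp
  also have "\<bar>\<dots>\<bar> \<le> (\<integral>x. \<bar>indicator (cell n p) x * g x - indicator (cell n p) x * c\<bar> \<partial>lebesgue_on open_square)"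
    by (rule integral_abs_bound)
  also have "\<dots> \<le> (\<integral>x. indicator (cell n p) x * \<eta> \<partial>lebesgue_on open_square)"
    by (intro integral_mono integrable_abs Bochner_Integration.integrable_diff i1 i2) (auto simp: indicator_def c)
  also have "\<dots> = \<eta> / (real n)\<^sup>2" using measure_cell_on_open_square[OF p] by simp
  finally show ?thesis .
qed

lemma sum_cells_value:
  assumes n: "n > 0" and p: "p \<in> grid n" "x \<in> cell n p"
  shows "(\<Sum>q\<in>grid n. f q * indicat_real (cell n q) x) = f p"
proof -
  have z: "indicat_real (cell n q) x = 0" if "q \<in> grid n - {p}" for q
    using that p(2) disjoint_cells[OF n, of x p q] by (metis DiffE indicator_simps(2) insertI1)
  have "(\<Sum>q\<in>grid n. f q * indicat_real (cell n q) x)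
      = f p * indicat_real (cell n p) x + (\<Sum>q\<in>grid n - {p}. f q * indicat_real (cell n q) x)"
    by (rule sum.remove) (use p in auto)
  also have "(\<Sum>q\<in>grid n - {p}. f q * indicat_real (cell n q) x) = 0"
    by (rule sum.neutral) (metis z mult_zero_right)
  finally show ?thesis by (simp only: indicator_simps(1)[OF p(2)] mult_1_right add_0_right)
qed

lemma abs_sum_disjoint_cells:
  assumes "n > 0"
  shows "\<bar>\<Sum>p\<in>grid n. a p * indicator (cell n p) x\<bar> = (\<Sum>p\<in>grid n. \<bar>a p\<bar> * indicat_real (cell n p) x)"
proof (cases "\<exists>p\<in>grid n. x \<in> cell n p")
  case True
  then obtain p where p: "p \<in> grid n" "x \<in> cell n p" by blast
  show ?thesis by (simp only: sum_cells_value[OF assms p])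
next
  case False
  then have "(\<Sum>p\<in>grid n. f p * indicat_real (cell n p) x) = 0" for f :: "int \<times> int \<Rightarrow> real"
    by (intro sum.neutral) (metis indicator_simps(2) mult_zero_right)
  then show ?thesis by (simp only: abs_zero)
qed

lemma grid_values_integrals:
  assumes v: "grid_values n a v" and vint: "integrable (lebesgue_on open_square) v" and n: "n > 0"
  shows "(\<integral>x. \<bar>v x\<bar> \<partial>lebesgue_on open_square) = (\<Sum>p\<in>grid n. \<bar>a p\<bar>) / (real n)\<^sup>2"
    and "\<And>g B. g \<in> borel_measurable borel \<Longrightarrow> (\<And>x. \<bar>g x\<bar> \<le> B) \<Longrightarrow>
      (\<integral>x. v x * g x \<partial>lebesgue_on open_square) = (\<Sum>p\<in>grid n. a p * (\<integral>x. indicator (cell n p) x * g x \<partial>lebesgue_on open_square))"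
proof -
  have vm [measurable]: "v \<in> borel_measurable (lebesgue_on open_square)" using vint by simp
  have sm: "(\<lambda>x. \<Sum>p\<in>grid n. a p * indicator (cell n p) x) \<in> borel_measurable borel" for a :: "int \<times> int \<Rightarrow> real" by measurable
  have ae: "AE x in lebesgue_on open_square. v x = (\<Sum>p\<in>grid n. a p * indicator (cell n p) x)"
    using v by (simp add: grid_values_def)
  have ic: "integrable (lebesgue_on open_square) (indicat_real (cell n p))" for p
    by (rule integrable_on_open_square_bounded[of _ 1], rule borel_measurable_lebesgue_on_open_square) (auto simp: indicator_def)
  have "(\<integral>x. \<bar>v x\<bar> \<partial>lebesgue_on open_square) = (\<integral>x. (\<Sum>p\<in>grid n. \<bar>a p\<bar> * indicator (cell n p) x) \<partial>lebesgue_on open_square)"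
  proof (rule integral_cong_AE)
    show "(\<lambda>x. \<bar>v x\<bar>) \<in> borel_measurable (lebesgue_on open_square)"
      by (intro borel_measurable_abs vm)
    show "(\<lambda>x. \<Sum>p\<in>grid n. \<bar>a p\<bar> * indicator (cell n p) x) \<in> borel_measurable (lebesgue_on open_square)"
      by (rule borel_measurable_lebesgue_on_open_square[OF sm])
    show "AE x in lebesgue_on open_square. \<bar>v x\<bar> = (\<Sum>p\<in>grid n. \<bar>a p\<bar> * indicator (cell n p) x)"
      using ae by eventually_elim (simp only: abs_sum_disjoint_cells[OF n, of a])
  qed
  also have "\<dots> = (\<Sum>p\<in>grid n. \<bar>a p\<bar> * (1 / (real n)\<^sup>2))"
  proof (subst Bochner_Integration.integral_sum)
    show "integrable (lebesgue_on open_square) (\<lambda>x. \<bar>a p\<bar> * indicator (cell n p) x)" for p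
      by (intro integrable_mult_right ic)
    show "(\<Sum>p\<in>grid n. \<integral>x. \<bar>a p\<bar> * indicator (cell n p) x \<partial>lebesgue_on open_square) = (\<Sum>p\<in>grid n. \<bar>a p\<bar> * (1 / (real n)\<^sup>2))"
      by (intro sum.cong refl) (simp only: integral_mult_right_zero measure_cell_on_open_square)
  qed
  finally show "(\<integral>x. \<bar>v x\<bar> \<partial>lebesgue_on open_square) = (\<Sum>p\<in>grid n. \<bar>a p\<bar>) / (real n)\<^sup>2"
    by (simp add: sum_divide_distrib)
  fix g :: "real \<times> real \<Rightarrow> real" and B assume g [measurable]: "g \<in> borel_measurable borel" and B: "\<And>x. \<bar>g x\<bar> \<le> B"
  have ig: "integrable (lebesgue_on open_square) (\<lambda>x. indicator (cell n p) x * g x)" for p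
  proof (rule integrable_on_open_square_bounded[of _ "\<bar>B\<bar>"])
    fix x show "\<bar>indicator (cell n p) x * g x\<bar> \<le> \<bar>B\<bar>" using B[of x] by (auto simp: indicator_def)
  qed (rule borel_measurable_lebesgue_on_open_square, measurable)
  have "(\<integral>x. v x * g x \<partial>lebesgue_on open_square) = (\<integral>x. (\<Sum>p\<in>grid n. a p * (indicator (cell n p) x * g x)) \<partial>lebesgue_on open_square)"
  proof (rule integral_cong_AE)
    show "(\<lambda>x. v x * g x) \<in> borel_measurable (lebesgue_on open_square)"
      by (intro borel_measurable_times vm borel_measurable_lebesgue_on_open_square g)
    show "(\<lambda>x. \<Sum>p\<in>grid n. a p * (indicator (cell n p) x * g x)) \<in> borel_measurable (lebesgue_on open_square)"
      by (rule borel_measurable_lebesgue_on_open_square) measurable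
    show "AE x in lebesgue_on open_square. v x * g x = (\<Sum>p\<in>grid n. a p * (indicator (cell n p) x * g x))"
      using ae by eventually_elim (simp only: sum_distrib_right mult.assoc)
  qed
  also have "\<dots> = (\<Sum>p\<in>grid n. a p * (\<integral>x. indicator (cell n p) x * g x \<partial>lebesgue_on open_square))"
    using ig by (subst Bochner_Integration.integral_sum) (intro integrable_mult_right, simp_all only: integral_mult_right_zero)
  finally show "(\<integral>x. v x * g x \<partial>lebesgue_on open_square) = (\<Sum>p\<in>grid n. a p * (\<integral>x. indicator (cell n p) x * g x \<partial>lebesgue_on open_square))" .
qed

text \<open>
The vectors \<^const>\<open>upwind_gradient\<close> represent the distributional gradient up to an error of order
\<open>1/n\<close>. The values on the outermost cells are unconstrained but invisible, since the test function
vanishes there once \<open>n\<close> is large.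
\<close>

lemma discrete_divergence:
  assumes \<phi>: "\<phi> \<in> test_functions open_square" and e: "e \<in> {(1, 0), (0, 1)}"
  defines "b \<equiv> (real_of_int (fst e), real_of_int (snd e))"
  obtains C N where "C \<ge> 0" "\<And>n v a. n \<ge> N \<Longrightarrow> n > 0 \<Longrightarrow> grid_values n a v \<Longrightarrow>
    integrable (lebesgue_on open_square) v \<Longrightarrow>
    \<bar>1 / real n * (\<Sum>p\<in>grid n. \<phi> (cell_center n p) * (upwind_gradient a p \<bullet> b))
      + (\<integral>x. v x * partial_deriv b \<phi> x \<partial>lebesgue_on open_square)\<bar>
    \<le> C / real n * ((\<integral>x. \<bar>v x\<bar> \<partial>lebesgue_on open_square)
        + 1 / real n * (\<Sum>p\<in>grid n. norm (positive_parts (discrete_gradient a p))))"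
proof -
  have b: "b \<in> Basis" using e by (auto simp: b_def Basis_prod_def)
  have sm: "smooth \<phi>" and cs: "compact (closure {x. \<phi> x \<noteq> 0})" and sub: "closure {x. \<phi> x \<noteq> 0} \<subseteq> open_square"
    using \<phi> by (auto simp: test_functions_def)
  obtain C1 where C1: "C1 > 0" "\<And>x y. \<bar>\<phi> x - \<phi> y\<bar> \<le> C1 * norm (x - y)"
    using smooth_compact_support_lipschitz[OF sm cs] by blast
  have smd: "smooth (partial_deriv b \<phi>)" using sm b by (rule smooth_partial_deriv)
  have csd: "compact (closure {x. partial_deriv b \<phi> x \<noteq> 0})"
    using closure_support_partial_deriv[of b \<phi>] cs by (metis closed_closure compact_Int_closed inf.absorb2)
  obtain C2 where C2: "C2 > 0" "\<And>x y. \<bar>partial_deriv b \<phi> x - partial_deriv b \<phi> y\<bar> \<le> C2 * norm (x - y)"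
    using smooth_compact_support_lipschitz[OF smd csd] by blast
  obtain B where B: "\<And>x. \<bar>partial_deriv b \<phi> x\<bar> \<le> B"
    using compact_support_bounded[OF smooth_continuous[OF smd] csd] by metis
  have "\<exists>\<delta>>0. \<forall>x. \<phi> x \<noteq> 0 \<longrightarrow> \<delta> \<le> fst x \<and> fst x \<le> 1 - \<delta> \<and> \<delta> \<le> snd x \<and> snd x \<le> 1 - \<delta>"
  proof (cases "\<exists>x. \<phi> x \<noteq> 0")
    case True
    define K where "K = closure {x. \<phi> x \<noteq> 0}"
    have K: "compact K" "K \<noteq> {}" using cs True closure_subset[of "{x. \<phi> x \<noteq> 0}"] by (auto simp: K_def)
    define m where "m x = min (min (fst x) (1 - fst x)) (min (snd x) (1 - snd x))" for x :: "real \<times> real"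
    have "continuous_on K m" unfolding m_def by (intro continuous_intros)
    from continuous_attains_inf[OF K this] obtain x0 where x0: "x0 \<in> K" "\<And>y. y \<in> K \<Longrightarrow> m x0 \<le> m y" by blast
    have "x0 \<in> open_square" using x0(1) sub by (auto simp: K_def)
    then have "m x0 > 0"  by (auto simp: m_def open_square_def)
    moreover have "m x0 \<le> m x" if "\<phi> x \<noteq> 0" for x using that closure_subset[of "{x. \<phi> x \<noteq> 0}"] by (intro x0) (auto simp: K_def)
    ultimately have "\<phi> x \<noteq> 0 \<longrightarrow> m x0 \<le> fst x \<and> fst x \<le> 1 - m x0 \<and> m x0 \<le> snd x \<and> snd x \<le> 1 - m x0" for x
      by (fastforce simp: m_def[of x])
    with \<open>m x0 > 0\<close> show ?thesis by blast
  qed (auto intro: exI[of _ 1])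
  then obtain \<delta> where \<delta>: "\<delta> > 0" "\<And>x. \<phi> x \<noteq> 0 \<Longrightarrow> \<delta> \<le> fst x \<and> fst x \<le> 1 - \<delta> \<and> \<delta> \<le> snd x \<and> snd x \<le> 1 - \<delta>" by blast
  \<comment> \<open>Mesh sizes at most \<open>\<delta> / 2\<close> keep the support of the test function two
      cells away from the boundary.\<close>
  define N where "N = nat \<lceil>2 / \<delta>\<rceil>"
  show ?thesis
  proof (rule that[of "C1 + 3 * C2" N])
    show "0 \<le> C1 + 3 * C2" using C1 C2 by simp
    fix n v a assume nN: "n \<ge> N" and n: "n > 0" and v: "grid_values n a v"
      and vint: "integrable (lebesgue_on open_square) v"
    have n2: "real n * \<delta> \<ge> 2"
    proof -
      have "2 / \<delta> \<le> real n" using nN by (simp add: N_def)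
      then show ?thesis using \<delta>(1) by (simp add: pos_divide_le_eq)
    qed
    define f where "f p = \<phi> (cell_center n p)" for p
    define q where "q p = max (a (p - e) - a p) 0" for p
    have supp: "p \<in> grid n \<and> p + e \<in> grid n" if "f p \<noteq> 0" for p
    proof -
      have "\<delta> \<le> of_int (fst p) / real n" "of_int (fst p) / real n \<le> 1 - \<delta>"
        "\<delta> \<le> of_int (snd p) / real n" "of_int (snd p) / real n \<le> 1 - \<delta>"
        using \<delta>(2)[of "cell_center n p"] that by (auto simp: f_def cell_center_def)
      then have "real n * \<delta> \<le> of_int (fst p)" "of_int (fst p) \<le> real n - real n * \<delta>"
        "real n * \<delta> \<le> of_int (snd p)" "of_int (snd p) \<le> real n - real n * \<delta>"
        using n by (auto simp: field_simps)
      with n2 have "2 \<le> fst p" "fst p \<le> int n - 2" "2 \<le> snd p" "snd p \<le> int n - 2" by linarith+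
      then show ?thesis using e by (cases p) (auto simp: grid_def)
    qed
    have cc: "cell_center n (p - e) = cell_center n p + (- 1 / real n) *\<^sub>R b" for p
      by (auto simp: cell_center_def b_def scaleR_prod_def diff_divide_distrib)
    have nb: "norm b = 1" using b by simp
    have d1: "\<bar>f (p - e) - f p\<bar> \<le> C1 / real n" for p
      using C1(2)[of "cell_center n (p - e)" "cell_center n p"] by (simp add: f_def cc nb)
    have d2: "\<bar>partial_deriv b \<phi> y - (- (real n * (f (p - e) - f p)))\<bar> \<le> 3 * C2 / real n"
      if y: "y \<in> cell n p" for p y
    proof -
      have "\<bar>f (p - e) - f p - (- 1 / real n) * partial_deriv b \<phi> y\<bar> \<le> C2 * \<bar>- 1 / real n\<bar> * (norm (cell_center n p - y) + \<bar>- 1 / real n\<bar>)"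
        unfolding f_def cc by (rule difference_quotient_partial_deriv[OF sm b C2(2)])
      also have "\<dots> \<le> C2 * (1 / real n) * (2 / real n + 1 / real n)"
        unfolding abs_divide abs_minus_cancel abs_one abs_of_nat
        using dist_in_cell[OF n cell_center_in_cell[OF n] y] C2(1) by (intro mult_left_mono add_mono) auto
      finally have "\<bar>f (p - e) - f p - (- 1 / real n) * partial_deriv b \<phi> y\<bar> * real n \<le> 3 * C2 / real n"
        using n by (simp add: field_simps)
      moreover have "\<bar>f (p - e) - f p - (- 1 / real n) * partial_deriv b \<phi> y\<bar> * real n = \<bar>(f (p - e) - f p - (- 1 / real n) * partial_deriv b \<phi> y) * real n\<bar>"
        by (simp add: abs_mult)
      moreover have "(f (p - e) - f p - (- 1 / real n) * partial_deriv b \<phi> y) * real n = partial_deriv b \<phi> y - (- (real n * (f (p - e) - f p)))"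
        using n by (simp add: field_simps)
      ultimately show ?thesis by simp
    qed
    define J where "J p = (\<integral>x. indicator (cell n p) x * partial_deriv b \<phi> x \<partial>lebesgue_on open_square)" for p
    have meas: "partial_deriv b \<phi> \<in> borel_measurable borel"
      by (intro borel_measurable_continuous_onI smooth_continuous smd)
    have J: "\<bar>J p + (f (p - e) - f p) / real n\<bar> \<le> 3 * C2 / real n / (real n)\<^sup>2" if p: "p \<in> grid n" for p
      using cellwise_integral_error[OF p meas B d2] n unfolding J_def by (simp add: power2_eq_square)
    define T where "T = (\<Sum>p\<in>grid n. norm (positive_parts (discrete_gradient a p)))"
    have qT: "0 \<le> q p" "q p \<le> norm (positive_parts (discrete_gradient a p))" for p
      using upwind_gradient_inner(2)[OF e, of a p] by (auto simp: q_def)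
    have "1 / real n * (\<Sum>p\<in>grid n. \<phi> (cell_center n p) * (upwind_gradient a p \<bullet> b))
      = 1 / real n * (\<Sum>p\<in>grid n. (f (p - e) - f p) * (a p + q p))"
      unfolding b_def upwind_gradient_inner(1)[OF e] q_def
      using upwind_summation_by_parts[of "grid n" f e a] supp by (simp add: f_def)
    moreover have "(\<integral>x. v x * partial_deriv b \<phi> x \<partial>lebesgue_on open_square) = (\<Sum>p\<in>grid n. a p * J p)"
      unfolding J_def by (rule grid_values_integrals(2)[OF v vint n meas B])
    ultimately have "\<bar>1 / real n * (\<Sum>p\<in>grid n. \<phi> (cell_center n p) * (upwind_gradient a p \<bullet> b))
      + (\<integral>x. v x * partial_deriv b \<phi> x \<partial>lebesgue_on open_square)\<bar>
      = \<bar>\<Sum>p\<in>grid n. (f (p - e) - f p) / real n * q p + a p * (J p + (f (p - e) - f p) / real n)\<bar>"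
      by (simp add: sum_distrib_left algebra_simps add_divide_distrib diff_divide_distrib flip: sum.distrib)
    also have "\<dots> \<le> (\<Sum>p\<in>grid n. C1 / real n / real n * norm (positive_parts (discrete_gradient a p)) + \<bar>a p\<bar> * (3 * C2 / real n / (real n)\<^sup>2))"
    proof (rule order_trans[OF sum_abs], rule sum_mono, rule order_trans[OF abs_triangle_ineq], rule add_mono)
      fix p assume p: "p \<in> grid n"
      show "\<bar>(f (p - e) - f p) / real n * q p\<bar> \<le> C1 / real n / real n * norm (positive_parts (discrete_gradient a p))"
        unfolding abs_mult abs_divide abs_of_nat using divide_right_mono[OF d1[of p], of "real n"] qT[of p] C1(1)
        by (intro mult_mono) auto
      show "\<bar>a p * (J p + (f (p - e) - f p) / real n)\<bar> \<le> \<bar>a p\<bar> * (3 * C2 / real n / (real n)\<^sup>2)"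
        unfolding abs_mult by (intro mult_left_mono J p) auto
    qed
    also have "\<dots> = C1 / real n * (1 / real n * T) + 3 * C2 / real n * (\<integral>x. \<bar>v x\<bar> \<partial>lebesgue_on open_square)"
      unfolding grid_values_integrals(1)[OF v vint n] T_def
      by (simp only: sum.distrib sum_distrib_left[symmetric] sum_distrib_right[symmetric]) simp
    also have "\<dots> \<le> (C1 + 3 * C2) / real n * (1 / real n * T) + (C1 + 3 * C2) / real n * (\<integral>x. \<bar>v x\<bar> \<partial>lebesgue_on open_square)"
      using C1(1) C2(1) unfolding T_def by (intro add_mono mult_right_mono divide_right_mono mult_nonneg_nonneg sum_nonneg) auto
    also have "\<dots> = (C1 + 3 * C2) / real n * ((\<integral>x. \<bar>v x\<bar> \<partial>lebesgue_on open_square) + 1 / real n * T)"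
      by (subst add.commute) (rule distrib_left[symmetric])
    finally show "\<bar>1 / real n * (\<Sum>p\<in>grid n. \<phi> (cell_center n p) * (upwind_gradient a p \<bullet> b))
      + (\<integral>x. v x * partial_deriv b \<phi> x \<partial>lebesgue_on open_square)\<bar>
    \<le> (C1 + 3 * C2) / real n * ((\<integral>x. \<bar>v x\<bar> \<partial>lebesgue_on open_square)
        + 1 / real n * (\<Sum>p\<in>grid n. norm (positive_parts (discrete_gradient a p))))"
      unfolding T_def .
  qed
qed

section \<open>Lower bound for the total variation\<close>

lemma continuous_ball_retraction: "continuous_on UNIV (\<lambda>y :: 'a::real_normed_vector. y /\<^sub>R max 1 (norm y))"
  by (intro continuous_intros) (auto simp: max_def)

lemma norm_ball_retraction: "norm (y /\<^sub>R max 1 (norm y)) \<le> 1"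
  by (auto simp: max_def divide_simps)

text \<open>
Lower semicontinuity: a bound \<open>L\<close> on the upwind energies is a bound on the total variation of the
\<open>L\<^sup>1\<close> limit.
\<close>

lemma liminf_total_variation:
  fixes v :: "nat \<Rightarrow> real \<times> real \<Rightarrow> real" and a :: "nat \<Rightarrow> int \<times> int \<Rightarrow> real"
  assumes r: "strict_mono (r :: nat \<Rightarrow> nat)"
    and gv: "\<And>k. grid_values (r k) (a k) (v k)"
    and vint: "\<And>k. integrable (lebesgue_on open_square) (v k)"
    and uint: "integrable (lebesgue_on open_square) u"
    and conv: "(\<lambda>k. \<integral>x. \<bar>v k x - u x\<bar> \<partial>lebesgue_on open_square) \<longlonglongrightarrow> 0"
    and L: "\<And>k. 1 / real (r k) * (\<Sum>p\<in>grid (r k). norm (positive_parts (discrete_gradient (a k) p))) \<le> L" "L > 0"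
  shows "total_variation open_square u \<le> ennreal L"
proof -
  define \<omega> where "\<omega> k p = 1 / real (r k) * norm (positive_parts (discrete_gradient (a k) p))" for k p
  have \<omega>0: "0 \<le> \<omega> k p" for k p by (simp add: \<omega>_def)
  have \<omega>L: "(\<Sum>p\<in>grid (r k). \<omega> k p) \<le> L" for k using L(1)[of k] by (simp add: \<omega>_def sum_distrib_left)
  \<comment> \<open>The energies are turned into laws of total mass one; the missing mass sits at the index
      \<^const>\<open>None\<close>, placed at the corner \<open>(0, 0)\<close> outside the open square where
      test functions vanish.\<close>
  define wt where "wt k i = (case i of None \<Rightarrow> (L - (\<Sum>p\<in>grid (r k). \<omega> k p)) / L
     | Some p \<Rightarrow> (if p \<in> grid (r k) then \<omega> k p / L else 0))" for k i
  define I where "I k = insert None (Some ` grid (r k))" for k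
  have finI: "finite (I k)" for k by (simp add: I_def)
  have sumI: "(\<Sum>i\<in>I k. f i) = f None + (\<Sum>p\<in>grid (r k). f (Some p))" for f :: "_ \<Rightarrow> real" and k
    unfolding I_def by (subst sum.insert) (auto simp: sum.reindex)
  have wt0: "0 \<le> wt k i" for k i
    using \<omega>L[of k] \<omega>0 L(2) by (auto simp: wt_def split: option.split)
  have wtz: "wt k i = 0" if "i \<notin> I k" for k i
    using that by (auto simp: wt_def I_def split: option.split)
  have wtsum: "(\<Sum>i\<in>I k. wt k i) = 1" for k
    using L(2) by (simp add: sumI wt_def sum_divide_distrib[symmetric] add_divide_distrib[symmetric])
  define P where "P k = embed_pmf (wt k)" for k
  have pmfP: "pmf (P k) i = wt k i" for k i
    unfolding P_def
  proof (rule pmf_embed_pmf[OF wt0])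
    have "(\<integral>\<^sup>+ i. ennreal (wt k i) \<partial>count_space UNIV) = (\<Sum>i\<in>I k. ennreal (wt k i))"
      by (rule nn_integral_count_space'[OF finI]) (use wtz in auto)
    also have "\<dots> = ennreal (\<Sum>i\<in>I k. wt k i)" by (rule sum_ennreal) (rule wt0)
    finally show "(\<integral>\<^sup>+ i. ennreal (wt k i) \<partial>count_space UNIV) = 1" by (simp add: wtsum)
  qed
  have intP: "(\<integral>i. f i \<partial>measure_pmf (P k)) = (\<Sum>i\<in>I k. f i * wt k i)" for f k
    by (subst integral_measure_pmf_real[OF finI[of k]]) (auto simp: pmfP set_pmf_iff wtz intro: ccontr)
  define X where "X k i = (case i of None \<Rightarrow> (0, 0) | Some p \<Rightarrow> if p \<in> grid (r k) then cell_center (r k) p else (0, 0))" for k i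
  define Y where "Y k i = (case i of None \<Rightarrow> 0
     | Some p \<Rightarrow> upwind_gradient (a k) p /\<^sub>R norm (positive_parts (discrete_gradient (a k) p)))" for k i
  have nY: "norm (Y k i) \<le> 1" for k i
  proof (cases i)
    case (Some p)
    have "norm (upwind_gradient (a k) p) / norm (positive_parts (discrete_gradient (a k) p)) \<le> 1"
      using norm_upwind_gradient_le[of "a k" p] by (simp add: divide_le_eq_1)
    then show ?thesis by (simp add: Y_def Some divide_inverse mult.commute)
  qed (simp add: Y_def)
  have Xb: "\<bar>fst (X k i)\<bar> \<le> 1 \<and> \<bar>snd (X k i)\<bar> \<le> 1" for k i
    by (auto simp: X_def cell_center_def grid_def divide_le_eq_1 split: option.split)
  have Yb: "\<bar>fst (Y k i)\<bar> \<le> 1 \<and> \<bar>snd (Y k i)\<bar> \<le> 1" for k i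
    using nY[of k i] norm_fst_le[of "fst (Y k i)" "snd (Y k i)"] norm_snd_le[of "snd (Y k i)" "fst (Y k i)"] by simp
  obtain s Q and g h :: "real \<Rightarrow> real \<times> real" where s: "strict_mono s" and Q: "real_distribution Q"
    and cg: "continuous_on UNIV g" and ch: "continuous_on UNIV h"
    and lim: "\<And>f :: (real \<times> real) \<times> (real \<times> real) \<Rightarrow> real. continuous_on UNIV f \<Longrightarrow> bounded (range f) \<Longrightarrow>
       (\<lambda>n. \<integral>i. f (X (s n) i, Y (s n) i) \<partial>measure_pmf (P (s n))) \<longlonglongrightarrow> (\<integral>t. f (g t, h t) \<partial>Q)"
    by (rule weakly_convergent_subsequence_of_cube_valued[of X Y P, OF Xb Yb]) blast
  interpret Q: real_distribution Q by fact
  \<comment> \<open>The curve may leave the unit ball in the direction variable; the directions of the atoms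
      do not, so a retraction changes nothing for them.\<close>
  define h' where "h' t = h t /\<^sub>R max 1 (norm (h t))" for t
  have ch': "continuous_on UNIV h'"
    unfolding h'_def by (intro continuous_on_compose2[OF continuous_ball_retraction ch]) auto
  have h'1: "norm (h' t) \<le> 1" for t unfolding h'_def by (rule norm_ball_retraction)
  define Q' where "Q' = density Q (\<lambda>_. ennreal L)"
  have [simp, measurable_cong]: "sets Q' = sets borel" by (simp add: Q'_def)
  have emQ': "emeasure Q' (space Q') = ennreal L"
    using Q.emeasure_space_1 by (simp add: Q'_def emeasure_density_const)
  have finQ': "finite_measure Q'" using emQ' by (intro finite_measureI) simp
  have gm: "g \<in> borel_measurable Q'" and hm: "h' \<in> borel_measurable Q'"
    using borel_measurable_continuous_onI[OF cg] borel_measurable_continuous_onI[OF ch'] by simp_all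
  have intQ': "(\<integral>t. f t \<partial>Q') = L * (\<integral>t. f t \<partial>Q)" if "f \<in> borel_measurable borel" for f :: "real \<Rightarrow> real"
    unfolding Q'_def using that L(2) by (subst integral_density) auto
  obtain \<mu> \<sigma> where \<mu>: "finite_measure \<mu>" "sets \<mu> = sets (restrict_space borel open_square)"
    "\<sigma> \<in> borel_measurable \<mu>" "AE x in \<mu>. norm (\<sigma> x) = 1" "emeasure \<mu> (space \<mu>) \<le> emeasure Q' (space Q')"
    and \<mu>int: "\<And>\<phi> b B. \<phi> \<in> borel_measurable borel \<Longrightarrow> (\<And>x. \<bar>\<phi> x\<bar> \<le> B) \<Longrightarrow> (\<And>x. x \<notin> open_square \<Longrightarrow> \<phi> x = 0) \<Longrightarrow> b \<in> Basis \<Longrightarrow>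
       (\<integral>t. \<phi> (g t) * (h' t \<bullet> b) \<partial>Q') = (\<integral>x. \<phi> x * (\<sigma> x \<bullet> b) \<partial>\<mu>)"
    by (rule polar_measure_of_barycentric_density[OF finQ' gm hm h'1 open_square_borel]) blast
  have "has_gradient_measure u open_square \<sigma> \<mu>"
    unfolding has_gradient_measure_def
  proof (intro conjI ballI \<mu>(1-4))
    fix \<phi> b assume \<phi>: "\<phi> \<in> test_functions open_square" and b: "b \<in> (Basis :: (real \<times> real) set)"
    have sm: "smooth \<phi>" and cs: "compact (closure {x. \<phi> x \<noteq> 0})" and sub: "closure {x. \<phi> x \<noteq> 0} \<subseteq> open_square"
      using \<phi> by (auto simp: test_functions_def)
    have c\<phi>: "continuous_on UNIV \<phi>" using sm by (rule smooth_continuous)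
    obtain B where B: "\<And>x. \<bar>\<phi> x\<bar> \<le> B" using compact_support_bounded[OF c\<phi> cs] by metis
    have \<phi>0: "\<phi> x = 0" if "x \<notin> open_square" for x using that sub closure_subset[of "{x. \<phi> x \<noteq> 0}"] by auto
    have smd: "smooth (partial_deriv b \<phi>)" using sm b by (rule smooth_partial_deriv)
    have csd: "compact (closure {x. partial_deriv b \<phi> x \<noteq> 0})"
      using closure_support_partial_deriv[of b \<phi>] cs by (metis closed_closure compact_Int_closed inf.absorb2)
    obtain B' where B': "B' > 0" "\<And>x. \<bar>partial_deriv b \<phi> x\<bar> \<le> B'"
      using compact_support_bounded[OF smooth_continuous[OF smd] csd] by metis
    have pdm: "partial_deriv b \<phi> \<in> borel_measurable (lebesgue_on open_square)"
      by (intro borel_measurable_lebesgue_on_open_square borel_measurable_continuous_onI smooth_continuous smd)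
    obtain e where e: "e \<in> {(1, 0), (0, 1)}" and be: "b = (real_of_int (fst e), real_of_int (snd e))"
      using b by (auto simp: Basis_prod_def)
    obtain C N where CN: "C \<ge> 0" "\<And>n v a. n \<ge> N \<Longrightarrow> n > 0 \<Longrightarrow> grid_values n a v \<Longrightarrow> integrable (lebesgue_on open_square) v \<Longrightarrow>
      \<bar>1 / real n * (\<Sum>p\<in>grid n. \<phi> (cell_center n p) * (upwind_gradient a p \<bullet> b))
        + (\<integral>x. v x * partial_deriv b \<phi> x \<partial>lebesgue_on open_square)\<bar>
      \<le> C / real n * ((\<integral>x. \<bar>v x\<bar> \<partial>lebesgue_on open_square)
          + 1 / real n * (\<Sum>p\<in>grid n. norm (positive_parts (discrete_gradient a p))))"
      unfolding be by (rule discrete_divergence[OF \<phi> e]) blast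
    define D where "D k = 1 / real (r k) * (\<Sum>p\<in>grid (r k). \<phi> (cell_center (r k) p) * (upwind_gradient (a k) p \<bullet> b))" for k
    define E where "E k = (\<integral>x. v k x * partial_deriv b \<phi> x \<partial>lebesgue_on open_square)" for k
    define E0 where "E0 = (\<integral>x. u x * partial_deriv b \<phi> x \<partial>lebesgue_on open_square)"
    define U where "U = (\<integral>x. \<bar>u x\<bar> \<partial>lebesgue_on open_square)"
    define d where "d k = (\<integral>x. \<bar>v k x - u x\<bar> \<partial>lebesgue_on open_square)" for k
    have d0: "d \<longlonglongrightarrow> 0" using conv by (simp add: d_def[abs_def])
    have ib: "integrable (lebesgue_on open_square) (\<lambda>x. f x * partial_deriv b \<phi> x)"
      if f: "integrable (lebesgue_on open_square) f" for f
      by (rule Bochner_Integration.integrable_bound[OF integrable_mult_right[OF f, of B']])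
        (use pdm f B' in \<open>auto simp: abs_mult mult.commute[of B'] intro!: AE_I2 mult_left_mono\<close>)
    have EE0: "\<bar>E k - E0\<bar> \<le> B' * d k" for k
    proof -
      have "E k - E0 = (\<integral>x. (v k x - u x) * partial_deriv b \<phi> x \<partial>lebesgue_on open_square)"
        unfolding E_def E0_def left_diff_distrib by (rule Bochner_Integration.integral_diff[symmetric, OF ib[OF vint] ib[OF uint]])
      also have "\<bar>\<dots>\<bar> \<le> (\<integral>x. \<bar>(v k x - u x) * partial_deriv b \<phi> x\<bar> \<partial>lebesgue_on open_square)" by (rule integral_abs_bound)
      also have "\<dots> \<le> (\<integral>x. B' * \<bar>v k x - u x\<bar> \<partial>lebesgue_on open_square)"
      proof (rule integral_mono)
        show "\<bar>(v k x - u x) * partial_deriv b \<phi> x\<bar> \<le> B' * \<bar>v k x - u x\<bar>" for x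
          unfolding abs_mult using B'(2)[of x] by (subst mult.commute) (rule mult_right_mono, auto)
      qed (intro integrable_abs integrable_mult_right ib Bochner_Integration.integrable_diff vint uint)+
      finally show ?thesis by (simp add: d_def)
    qed
    have Elim: "E \<longlonglongrightarrow> E0"
      by (rule LIM_zero_cancel, rule Lim_null_comparison[of _ "\<lambda>k. B' * d k"])
        (use EE0 tendsto_mult[OF tendsto_const d0] in auto)
    have vU: "(\<integral>x. \<bar>v k x\<bar> \<partial>lebesgue_on open_square) \<le> U + d k" for k
    proof -
      have "(\<integral>x. \<bar>v k x\<bar> \<partial>lebesgue_on open_square) \<le> (\<integral>x. \<bar>u x\<bar> + \<bar>v k x - u x\<bar> \<partial>lebesgue_on open_square)"
        using vint uint by (intro integral_mono) auto
      then show ?thesis using vint uint by (simp add: U_def d_def)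
    qed
    have r_ge: "k \<le> r k" for k using r by (rule seq_suble)
    have "(\<lambda>k. D k + E k) \<longlonglongrightarrow> 0"
    proof (rule Lim_null_comparison[of _ "\<lambda>k. C / real (r k) * (U + d k + L)"])
      show "\<forall>\<^sub>F k in sequentially. norm (D k + E k) \<le> C / real (r k) * (U + d k + L)"
        using eventually_ge_at_top[of "max N 1"]
      proof eventually_elim
        case (elim k)
        then have "r k \<ge> N" "r k > 0" using r_ge[of k] by auto
        have "norm (D k + E k) \<le> C / real (r k) * ((\<integral>x. \<bar>v k x\<bar> \<partial>lebesgue_on open_square)
          + 1 / real (r k) * (\<Sum>p\<in>grid (r k). norm (positive_parts (discrete_gradient (a k) p))))"
          using CN(2)[OF \<open>r k \<ge> N\<close> \<open>r k > 0\<close> gv vint] by (simp add: D_def E_def)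
        also have "\<dots> \<le> C / real (r k) * (U + d k + L)"
          using vU[of k] L(1)[of k] CN(1) by (intro mult_left_mono add_mono) auto
        finally show ?case .
      qed
      have "filterlim (\<lambda>k. real (r k)) at_top sequentially"
        using filterlim_compose[OF filterlim_real_sequentially filterlim_subseq[OF r]] .
      then have "(\<lambda>k. C / real (r k)) \<longlonglongrightarrow> 0" by (rule real_tendsto_divide_at_top[OF tendsto_const])
      then have "(\<lambda>k. C / real (r k) * (U + d k + L)) \<longlonglongrightarrow> 0 * (U + 0 + L)" using d0 by (intro tendsto_intros)
      then show "(\<lambda>k. C / real (r k) * (U + d k + L)) \<longlonglongrightarrow> 0" by simp
    qed
    from tendsto_diff[OF this Elim] have Dlim: "D \<longlonglongrightarrow> - E0" by simp
    define f where "f z = \<phi> (fst z) * ((snd z /\<^sub>R max 1 (norm (snd z))) \<bullet> b)" for z :: "(real \<times> real) \<times> (real \<times> real)"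
    have "continuous_on UNIV f" unfolding f_def
      by (intro continuous_on_mult continuous_on_inner continuous_on_compose2[OF c\<phi>] continuous_on_compose2[OF continuous_ball_retraction] continuous_intros) auto
    moreover have "bounded (range f)"
    proof -
      have "norm (f z) \<le> B * 1" for z
        unfolding f_def norm_mult
      proof (rule mult_mono)
        show "norm ((snd z /\<^sub>R max 1 (norm (snd z))) \<bullet> b) \<le> 1"
          using Basis_le_norm[OF b, of "snd z /\<^sub>R max 1 (norm (snd z))"] norm_ball_retraction[of "snd z"] by simp
      qed (use B[of "fst z"] order_trans[OF abs_ge_zero B[of "fst z"]] in auto)
      then show ?thesis by (intro boundedI[of _ B]) auto
    qed
    ultimately have "(\<lambda>n. \<integral>i. f (X (s n) i, Y (s n) i) \<partial>measure_pmf (P (s n))) \<longlonglongrightarrow> (\<integral>t. f (g t, h t) \<partial>Q)"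
      by (rule lim)
    moreover have "(\<integral>i. f (X k i, Y k i) \<partial>measure_pmf (P k)) = D k / L" for k
    proof -
      have "f (X k None, Y k None) = 0" by (simp add: f_def X_def Y_def)
      moreover have "f (X k (Some p), Y k (Some p)) * wt k (Some p)
          = \<phi> (cell_center (r k) p) * (upwind_gradient (a k) p \<bullet> b) / real (r k) / L" if p: "p \<in> grid (r k)" for p
      proof -
        have "Y k (Some p) /\<^sub>R max 1 (norm (Y k (Some p))) = Y k (Some p)" using nY[of k "Some p"] by (simp add: max_def)
        moreover have "norm (positive_parts (discrete_gradient (a k) p)) * (Y k (Some p) \<bullet> b) = upwind_gradient (a k) p \<bullet> b"
          using norm_upwind_gradient_le[of "a k" p]
          by (cases "norm (positive_parts (discrete_gradient (a k) p)) = 0") (auto simp: Y_def)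
        ultimately show ?thesis using p by (simp add: f_def X_def wt_def \<omega>_def mult_ac)
      qed
      ultimately have "(\<Sum>i\<in>I k. f (X k i, Y k i) * wt k i) = (\<Sum>p\<in>grid (r k). \<phi> (cell_center (r k) p) * (upwind_gradient (a k) p \<bullet> b) / real (r k) / L)"
        unfolding sumI by (simp cong: sum.cong)
      then show ?thesis unfolding intP by (simp add: D_def sum_distrib_left sum_divide_distrib)
    qed
    ultimately have "(\<lambda>n. D (s n) / L) \<longlonglongrightarrow> (\<integral>t. f (g t, h t) \<partial>Q)" by simp
    moreover have "(\<lambda>n. D (s n) / L) \<longlonglongrightarrow> - E0 / L"
      using LIMSEQ_subseq_LIMSEQ[OF Dlim s] L(2) by (intro tendsto_divide tendsto_const) (auto simp: comp_def)
    ultimately have "(\<integral>t. f (g t, h t) \<partial>Q) = - E0 / L" by (rule LIMSEQ_unique)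
    moreover have "f (g t, h t) = \<phi> (g t) * (h' t \<bullet> b)" for t by (simp add: f_def h'_def)
    ultimately have "L * (\<integral>t. \<phi> (g t) * (h' t \<bullet> b) \<partial>Q) = - E0" using L(2) by simp
    moreover have "(\<integral>t. \<phi> (g t) * (h' t \<bullet> b) \<partial>Q') = L * (\<integral>t. \<phi> (g t) * (h' t \<bullet> b) \<partial>Q)"
      by (intro intQ' borel_measurable_continuous_onI continuous_on_mult continuous_on_inner continuous_on_compose2[OF c\<phi> cg] ch' continuous_on_const) auto
    moreover have "(\<integral>t. \<phi> (g t) * (h' t \<bullet> b) \<partial>Q') = (\<integral>x. \<phi> x * (\<sigma> x \<bullet> b) \<partial>\<mu>)"
      by (rule \<mu>int[OF borel_measurable_continuous_onI[OF c\<phi>] B \<phi>0 b])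
    ultimately show "(\<integral>x. u x * partial_deriv b \<phi> x \<partial>lebesgue_on open_square) = - (\<integral>x. \<phi> x * (\<sigma> x \<bullet> b) \<partial>\<mu>)"
      by (simp add: E0_def)
  qed
  then have "total_variation open_square u \<le> emeasure \<mu> (space \<mu>)"
    unfolding total_variation_def by (intro Inf_lower) blast
  also have "\<dots> \<le> ennreal L" using \<mu>(5) emQ' by simp
  finally show ?thesis .
qed

section \<open>Lipschitz boundaries\<close>

text \<open>
Data of a local graph representation of \<open>S\<close> at \<open>x\<close>: orthonormal axes, a Lipschitz function and a
radius.
\<close>

definition lipschitz_chart ::
  "(real \<times> real) set \<Rightarrow> real \<times> real \<Rightarrow> real \<times> real \<Rightarrow> real \<times> real \<Rightarrow> (real \<Rightarrow> real) \<Rightarrow> real \<Rightarrow> real \<Rightarrow> bool" where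
  "lipschitz_chart S x e1 e2 g L r \<longleftrightarrow> norm e1 = 1 \<and> norm e2 = 1 \<and> e1 \<bullet> e2 = 0 \<and>
        L-lipschitz_on (UNIV :: real set) g \<and> 0 < r \<and>
        (\<forall>y\<in>ball x r. y \<in> S \<longleftrightarrow> g ((y - x) \<bullet> e1) < (y - x) \<bullet> e2)"

lemma lipschitz_chart_exists:
  assumes "strongly_lipschitz S" "x \<in> frontier S"
  obtains e1 e2 g L r where "lipschitz_chart S x e1 e2 g L r"
proof -
  from assms have "\<exists>e1 e2 g L r. lipschitz_chart S x e1 e2 g L r"
    unfolding strongly_lipschitz_def lipschitz_chart_def by (rule bspec)
  then show ?thesis using that by (elim exE)
qed

lemma lipschitz_chartD:
  assumes "lipschitz_chart S x e1 e2 g L r"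
  shows "norm e1 = 1" "norm e2 = 1" "e1 \<bullet> e2 = 0" "L-lipschitz_on UNIV g" "0 < r"
    "\<And>y. y \<in> ball x r \<Longrightarrow> y \<in> S \<longleftrightarrow> g ((y - x) \<bullet> e1) < (y - x) \<bullet> e2"
  using assms unfolding lipschitz_chart_def by simp_all

lemma orthonormal_pair_expansion:
  fixes e1 e2 z :: "real \<times> real"
  assumes "norm e1 = 1" "norm e2 = 1" "e1 \<bullet> e2 = 0"
  shows "(z \<bullet> e1) *\<^sub>R e1 + (z \<bullet> e2) *\<^sub>R e2 = z"
proof -
  obtain a b c d x y where e: "e1 = (a, b)" "e2 = (c, d)" "z = (x, y)" by (metis surj_pair)
  have 1: "a * a + b * b = 1" "c * c + d * d = 1" "a * c + b * d = 0"
    using assms by (auto simp: e norm_Pair power2_eq_square inner_prod_def)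
  have "(a * d - b * c) * (a * d - b * c) = (a * a + b * b) * (c * c + d * d) - (a * c + b * d) * (a * c + b * d)"
    by (simp add: algebra_simps)
  then have D: "(a * d - b * c) * (a * d - b * c) = 1" by (simp add: 1)
  define D where "D = a * d - b * c"
  have d: "d = D * a" "c = - (D * b)"
  proof -
    have "D * a = d * (a * a + b * b) - b * (a * c + b * d)" by (simp add: D_def algebra_simps)
    then show "d = D * a" by (simp add: 1)
    have "D * b = a * (a * c + b * d) - c * (a * a + b * b)" by (simp add: D_def algebra_simps)
    then show "c = - (D * b)" by (simp add: 1)
  qed
  have DD: "D * D = 1" using D by (simp add: D_def)
  have "(x * a + y * b) * a + (x * c + y * d) * c = x * (a * a + (D * D) * (b * b)) + y * (a * b - (D * D) * (a * b))"
    by (simp add: d algebra_simps)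
  moreover have "(x * a + y * b) * b + (x * c + y * d) * d = x * (a * b - (D * D) * (a * b)) + y * (b * b + (D * D) * (a * a))"
    by (simp add: d algebra_simps)
  ultimately show ?thesis using 1(1) by (simp add: e DD inner_prod_def add.commute)
qed

text \<open>
A graph is the image of a coordinate axis, a null set of the plane, under a Lipschitz map of the
plane.
\<close>

lemma negligible_lipschitz_graph:
  fixes e1 e2 x :: "real \<times> real"
  assumes e: "norm e1 = 1" "norm e2 = 1" and g: "L-lipschitz_on UNIV g"
  shows "negligible (range (\<lambda>s. x + s *\<^sub>R e1 + g s *\<^sub>R e2))"
proof -
  define f where "f z = x + fst z *\<^sub>R e1 + g (fst z) *\<^sub>R e2" for z :: "real \<times> real"
  have "negligible (f ` {z. z \<bullet> (0, 1) = 0})"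
  proof (rule negligible_locally_Lipschitz_image)
    show "negligible {z :: real \<times> real. z \<bullet> (0, 1) = 0}"
      by (rule negligible_standard_hyperplane) (simp add: Basis_prod_def)
    fix z :: "real \<times> real"
    have "norm (f y - f z) \<le> (1 + L) * norm (y - z)" for y
    proof -
      have "f y - f z = (fst y - fst z) *\<^sub>R e1 + (g (fst y) - g (fst z)) *\<^sub>R e2"
        by (simp add: f_def algebra_simps)
      then have "norm (f y - f z) \<le> \<bar>fst y - fst z\<bar> + \<bar>g (fst y) - g (fst z)\<bar>"
        using norm_triangle_ineq[of "(fst y - fst z) *\<^sub>R e1" "(g (fst y) - g (fst z)) *\<^sub>R e2"] e by simp
      also have "\<dots> \<le> (1 + L) * \<bar>fst y - fst z\<bar>"
        using lipschitz_onD[OF g, of "fst y" "fst z"] by (simp add: dist_real_def algebra_simps)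
      also have "\<dots> \<le> (1 + L) * norm (y - z)"
        using norm_fst_le[of "fst y - fst z" "snd y - snd z"] lipschitz_on_nonneg[OF g]
        by (cases y; cases z) (auto intro!: mult_left_mono)
      finally show ?thesis .
    qed
    then show "\<exists>T B. open T \<and> z \<in> T \<and> (\<forall>y\<in>{z. z \<bullet> (0, 1) = 0} \<inter> T. norm (f y - f z) \<le> B * norm (y - z))"
      by (intro exI[of _ UNIV]) auto
  qed simp
  moreover have "range (\<lambda>s. x + s *\<^sub>R e1 + g s *\<^sub>R e2) \<subseteq> f ` {z. z \<bullet> (0, 1) = 0}"
  proof
    fix y assume "y \<in> range (\<lambda>s. x + s *\<^sub>R e1 + g s *\<^sub>R e2)"
    then obtain s where "y = f (s, 0)" by (auto simp: f_def)
    then show "y \<in> f ` {z. z \<bullet> (0, 1) = 0}" by (auto simp: inner_prod_def)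
  qed
  ultimately show ?thesis by (rule negligible_subset)
qed

lemma negligible_frontier_strongly_lipschitz:
  assumes "strongly_lipschitz S"
  shows "negligible (frontier S)"
proof (rule locally_negligible_alt[THEN iffD2], rule ballI)
  fix x assume "x \<in> frontier S"
  then obtain e1 e2 g L r where chart: "lipschitz_chart S x e1 e2 g L r"
    using lipschitz_chart_exists[OF assms] by metis
  note e = lipschitz_chartD(1-3)[OF chart] and g = lipschitz_chartD(4)[OF chart]
    and r = lipschitz_chartD(5)[OF chart] and S = lipschitz_chartD(6)[OF chart]
  have cg: "continuous_on UNIV g" using g by (rule lipschitz_on_continuous_on)
  define F where "F y = (y - x) \<bullet> e2 - g ((y - x) \<bullet> e1)" for y
  have cF: "continuous_on A F" for A
    unfolding F_def by (intro continuous_intros continuous_on_compose2[OF cg]) auto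
  have "F y = 0" if y: "y \<in> frontier S" "y \<in> ball x r" for y
  proof (rule ccontr)
    assume "F y \<noteq> 0"
    then consider "F y > 0" | "F y < 0" by linarith
    then show False
    proof cases
      case 1
      have op: "open (ball x r \<inter> {y. F y > 0})" by (intro open_Int open_ball open_Collect_less cF continuous_intros)
      have "ball x r \<inter> {y. F y > 0} \<subseteq> S" using S by (auto simp: F_def)
      then have "y \<in> interior S" using op 1 y by (auto simp: interior_def)
      then show False using y by (simp add: frontier_def)
    next
      case 2
      have op: "open (ball x r \<inter> {y. F y < 0})" by (intro open_Int open_ball open_Collect_less cF continuous_intros)
      have "ball x r \<inter> {y. F y < 0} \<inter> S = {}" using S by (auto simp: F_def)
      then have "ball x r \<inter> {y. F y < 0} \<inter> closure S = {}" using op by (simp add: open_Int_closure_eq_empty)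
      then show False using y 2 by (auto simp: frontier_def)
    qed
  qed
  then have "frontier S \<inter> ball x r \<subseteq> range (\<lambda>s. x + s *\<^sub>R e1 + g s *\<^sub>R e2)"
  proof (intro subsetI)
    fix y assume y: "y \<in> frontier S \<inter> ball x r"
    assume "\<And>y. y \<in> frontier S \<Longrightarrow> y \<in> ball x r \<Longrightarrow> F y = 0"
    with y have "F y = 0" by blast
    then have "y = x + ((y - x) \<bullet> e1) *\<^sub>R e1 + g ((y - x) \<bullet> e1) *\<^sub>R e2"
      using orthonormal_pair_expansion[OF e, of "y - x"] by (simp add: F_def algebra_simps)
    then show "y \<in> range (\<lambda>s. x + s *\<^sub>R e1 + g s *\<^sub>R e2)" by blast
  qed
  then have "negligible (frontier S \<inter> ball x r)"
    using negligible_lipschitz_graph[OF e(1,2) g] negligible_subset by blast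
  then show "\<exists>U. openin (top_of_set (frontier S)) U \<and> x \<in> U \<and> negligible U"
    using r \<open>x \<in> frontier S\<close> by (intro exI[of _ "frontier S \<inter> ball x r"]) (auto intro: openin_open_Int)
qed

section \<open>Constraints in the limit\<close>

text \<open>
The discrete domains exhaust the interior: a fixed point is eventually in an admissible cell, if it lies
in a cell at all.
\<close>

lemma eventually_cell_in_shrink:
  assumes x: "x \<in> open_square" "x \<in> interior E" and E: "bounded E"
  shows "\<forall>\<^sub>F n in sequentially. \<forall>p. x \<in> cell n p \<longrightarrow> p \<in> grid n \<and> cell n p \<subseteq> shrink E (1 / real n)"
proof -
  obtain \<rho> where \<rho>: "\<rho> > 0" "ball x \<rho> \<subseteq> E" using x(2) by (auto simp: mem_interior)
  \<comment> \<open>The distance to an empty frontier would be zero by convention, so a frontier is needed;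
      it exists because \<open>E\<close> is bounded and has an interior point.\<close>
  have ne: "frontier E \<noteq> {}"
  proof
    assume "frontier E = {}"
    then have "E = UNIV" using x(2) interior_subset by (auto simp: frontier_eq_empty)
    then show False using E by auto
  qed
  define \<delta> where "\<delta> = min (min (fst x) (1 - fst x)) (min (snd x) (1 - snd x))"
  have \<delta>: "\<delta> > 0" "\<delta> \<le> fst x" "\<delta> \<le> 1 - fst x" "\<delta> \<le> snd x" "\<delta> \<le> 1 - snd x" using x(1) by (auto simp: \<delta>_def open_square_def)
  have big: "\<forall>\<^sub>F n in sequentially. real n > M" for M
    using filterlim_at_top_dense[of real sequentially] filterlim_real_sequentially by blast
  show ?thesis
    using big[of "1 / \<delta>"] big[of "3 / \<rho>"] big[of 0]
  proof eventually_elim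
    case (elim n)
    then have n: "n > 0" by simp
    have 1: "real n * \<delta> > 1" and 3: "3 / real n < \<rho>" using elim \<delta>(1) \<rho>(1) by (simp_all add: field_simps)
    show ?case
    proof (intro allI impI conjI)
      fix p assume xp: "x \<in> cell n p"
      have "real n * \<delta> \<le> real n * fst x" "real n * \<delta> \<le> real n * (1 - fst x)"
        "real n * \<delta> \<le> real n * snd x" "real n * \<delta> \<le> real n * (1 - snd x)"
        by (rule mult_left_mono[OF \<delta>(2)] mult_left_mono[OF \<delta>(3)] mult_left_mono[OF \<delta>(4)] mult_left_mono[OF \<delta>(5)], simp)+
      then have "1 < real n * fst x" "real n * fst x < real n - 1" "1 < real n * snd x" "real n * snd x < real n - 1"
        using 1 unfolding right_diff_distrib mult_1_right by linarith+
      then have "0 < real_of_int (fst p)" "real_of_int (fst p) < real n" "0 < real_of_int (snd p)" "real_of_int (snd p) < real n"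
        using xp unfolding in_cell_iff[OF n] by linarith+
      then have "0 < fst p" "fst p < int n" "0 < snd p" "snd p < int n" by linarith+
      then show "p \<in> grid n" by (cases p) (auto simp: grid_def)
      show "cell n p \<subseteq> shrink E (1 / real n)"
      proof
        fix y assume y: "y \<in> cell n p"
        have d: "dist x y \<le> 2 / real n" using dist_in_cell[OF n xp y] by (simp add: dist_norm)
        moreover have "2 / real n < 3 / real n" using n by (simp add: divide_strict_right_mono)
        ultimately have "y \<in> ball x \<rho>" using 3 by simp
        then have "y \<in> E" using \<rho>(2) by blast
        moreover have "\<rho> - 2 / real n \<le> dist y z" if "z \<in> frontier E" for z
        proof -
          have "z \<notin> ball x \<rho>" using that \<rho>(2) interior_maximal[OF \<rho>(2) open_ball] by (auto simp: frontier_def)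
          then show ?thesis using d dist_triangle[of x z y] by simp
        qed
        then have "\<rho> - 2 / real n \<le> infdist y (frontier E)"
          using ne by (simp add: infdist_def) (rule cINF_greatest, auto)
        moreover have "1 / real n < \<rho> - 2 / real n" using 3 by (simp add: add_divide_distrib[symmetric] less_diff_eq)
        ultimately show "y \<in> shrink E (1 / real n)" by (simp add: shrink_def)
      qed
    qed
  qed
qed

text \<open>
The integral of \<open>|u - c|\<close> over \<open>A k\<close> is at most the distance of \<open>v k\<close> to \<open>u\<close>. It is applied on the
sets \<open>B k\<close> of points that stay in all later \<open>A j\<close>.
\<close>

lemma L1_limit_constant_on_exhaustion:
  assumes v: "\<And>k. integrable M (v k)" and u: "integrable M u"
    and conv: "(\<lambda>k. \<integral>x. \<bar>v k x - u x\<bar> \<partial>M) \<longlonglongrightarrow> (0 :: real)"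
    and A: "\<And>k. A k \<inter> space M \<in> sets M" and vA: "\<And>k. AE x in M. x \<in> A k \<longrightarrow> v k x = c"
    and E: "AE x in M. x \<in> E \<longrightarrow> (\<forall>\<^sub>F k in sequentially. x \<in> A k)"
  shows "AE x in M. x \<in> E \<longrightarrow> u x = c"
proof -
  have um: "u \<in> borel_measurable M" and vm: "\<And>k. v k \<in> borel_measurable M" using u v by auto
  have Am: "Measurable.pred M (\<lambda>x. x \<in> A k)" for k
    using A[of k] by (simp add: pred_def Int_def conj_commute)
  have bound: "(\<integral>\<^sup>+x. (if x \<in> A k then ennreal \<bar>u x - c\<bar> else 0) \<partial>M) \<le> ennreal (\<integral>x. \<bar>v k x - u x\<bar> \<partial>M)" for k
  proof -
    have "(\<integral>\<^sup>+x. (if x \<in> A k then ennreal \<bar>u x - c\<bar> else 0) \<partial>M) \<le> (\<integral>\<^sup>+x. ennreal \<bar>v k x - u x\<bar> \<partial>M)"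
      using vA[of k] by (intro nn_integral_mono_AE) (auto elim!: eventually_mono simp: abs_minus_commute)
    also have "\<dots> = ennreal (\<integral>x. \<bar>v k x - u x\<bar> \<partial>M)"
      using u v by (intro nn_integral_eq_integral) auto
    finally show ?thesis .
  qed
  define B where "B k x \<longleftrightarrow> (\<forall>j\<ge>k. x \<in> A j)" for k x
  have Bm: "Measurable.pred M (B k)" for k
    unfolding B_def using Am by measurable
  have "AE x in M. B k x \<longrightarrow> u x = c" for k
  proof -
    have "(\<integral>\<^sup>+x. (if B k x then ennreal \<bar>u x - c\<bar> else 0) \<partial>M) \<le> ennreal (\<integral>x. \<bar>v j x - u x\<bar> \<partial>M)" if "j \<ge> k" for j
    proof -
      have "(\<integral>\<^sup>+x. (if B k x then ennreal \<bar>u x - c\<bar> else 0) \<partial>M) \<le> (\<integral>\<^sup>+x. (if x \<in> A j then ennreal \<bar>u x - c\<bar> else 0) \<partial>M)"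
        using that by (intro nn_integral_mono) (auto simp: B_def)
      then show ?thesis using bound[of j] by (rule order_trans)
    qed
    then have "(\<integral>\<^sup>+x. (if B k x then ennreal \<bar>u x - c\<bar> else 0) \<partial>M) \<le> ennreal 0"
      by (intro tendsto_lowerbound[OF tendsto_ennrealI[OF conv]]) (auto simp: eventually_sequentially)
    then have "(\<integral>\<^sup>+x. (if B k x then ennreal \<bar>u x - c\<bar> else 0) \<partial>M) = 0" by simp
    moreover have "(\<lambda>x. if B k x then ennreal \<bar>u x - c\<bar> else 0) \<in> borel_measurable M"
      using Bm um by measurable
    ultimately have "AE x in M. (if B k x then ennreal \<bar>u x - c\<bar> else 0) = 0"
      by (subst (asm) nn_integral_0_iff_AE) auto
    then show ?thesis by eventually_elim (auto split: if_splits simp: ennreal_eq_0_iff)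
  qed
  then have "AE x in M. \<forall>k. B k x \<longrightarrow> u x = c" by (subst AE_all_countable) blast
  with E show ?thesis by eventually_elim (auto simp: B_def eventually_sequentially)
qed

lemma AE_lebesgue_on_open_square:
  assumes "AE x in lebesgue. P x" shows "AE x in lebesgue_on open_square. P x"
proof -
  have "open_square \<inter> space lebesgue \<in> sets lebesgue" by simp
  then show ?thesis using assms by (simp only: AE_restrict_space_iff) (auto elim: eventually_mono)
qed

lemma constraint_passes_to_limit:
  assumes \<Omega>s: "open S" "bounded S" and \<Omega>: "open W" "strongly_lipschitz W"
    and SW: "S \<subseteq> W" and W: "closure W \<subseteq> open_square"
    and r: "strict_mono (r :: nat \<Rightarrow> nat)"
    and vC: "\<And>k. v k \<in> constraint_set (inner_domain (r k) S) (outer_domain (r k) W)"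
    and vint: "\<And>k. integrable (lebesgue_on open_square) (v k)"
    and uint: "integrable (lebesgue_on open_square) u"
    and conv: "(\<lambda>k. \<integral>x. \<bar>v k x - u x\<bar> \<partial>lebesgue_on open_square) \<longlonglongrightarrow> 0"
  shows "u \<in> constraint_set S W"
proof -
  have cells: "AE x in lebesgue_on open_square. \<forall>n>0. \<exists>p. x \<in> cell n p"
    by (intro AE_lebesgue_on_open_square AE_completion AE_in_cells)
  have fr: "AE x in lebesgue_on open_square. x \<notin> frontier W"
    using negligible_frontier_strongly_lipschitz[OF \<Omega>(2)]
    by (intro AE_lebesgue_on_open_square AE_not_in) (simp add: negligible_iff_null_sets)
  have insq: "AE x in lebesgue_on open_square. x \<in> open_square"
    by (intro AE_I2) (simp add: space_restrict_space)
  have om: "A \<inter> space (lebesgue_on open_square) \<in> sets (lebesgue_on open_square)" if "open A" for A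
  proof -
    have "A \<inter> open_square \<in> sets lebesgue" using that by (intro sets_completionI_sets) simp
    moreover have "open_square \<inter> space lebesgue \<in> sets lebesgue" by simp
    ultimately show ?thesis by (simp only: sets_restrict_space_iff space_restrict_space) simp
  qed
  have ev_r: "\<forall>\<^sub>F k in sequentially. P (r k)" if "\<forall>\<^sub>F n in sequentially. P n" for P
    using eventually_compose_filterlim[OF that filterlim_subseq[OF r]] .
  define Z where "Z n = \<Union>{cell n p | p. p \<in> grid n \<and> cell n p \<subseteq> shrink (closed_square - W) (1 / real n)}" for n
  have os: "open_square \<subseteq> closed_square" by (auto simp: open_square_def closed_square_def)
  have bcs: "bounded closed_square" unfolding closed_square_def by (intro bounded_Times bounded_closed_interval)
  have one: "AE x in lebesgue_on open_square. x \<in> S \<longrightarrow> u x = 1"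
  proof (rule L1_limit_constant_on_exhaustion[OF vint uint conv, of "\<lambda>k. inner_domain (r k) S"])
    show "inner_domain (r k) S \<inter> space (lebesgue_on open_square) \<in> sets (lebesgue_on open_square)" for k
      by (rule om) (auto simp: inner_domain_def)
    show "AE x in lebesgue_on open_square. x \<in> inner_domain (r k) S \<longrightarrow> v k x = 1" for k
      using vC[of k] by (auto simp: constraint_set_def elim: eventually_mono)
    show "AE x in lebesgue_on open_square. x \<in> S \<longrightarrow> (\<forall>\<^sub>F k in sequentially. x \<in> inner_domain (r k) S)"
      using cells insq
    proof eventually_elim
      case (elim x)
      show ?case
      proof
        assume "x \<in> S"
        then have "x \<in> interior S" using \<Omega>s by (simp add: interior_open)
        from ev_r[OF eventually_cell_in_shrink[OF elim(2) this \<Omega>s(2)]] ev_r[OF eventually_gt_at_top[of 0]]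
        show "\<forall>\<^sub>F k in sequentially. x \<in> inner_domain (r k) S"
        proof eventually_elim
          case (elim k)
          then obtain p where "x \<in> cell (r k) p" using \<open>\<forall>n>0. \<exists>p. x \<in> cell n p\<close> by blast
          then show ?case using elim(1) unfolding inner_domain_def by blast
        qed
      qed
    qed
  qed
  have zero: "AE x in lebesgue_on open_square. x \<in> closed_square - W \<longrightarrow> u x = 0"
  proof (rule L1_limit_constant_on_exhaustion[OF vint uint conv, of "\<lambda>k. Z (r k)"])
    show "Z (r k) \<inter> space (lebesgue_on open_square) \<in> sets (lebesgue_on open_square)" for k
      by (rule om) (auto simp: Z_def)
    have ZZ: "open_square \<inter> Z n \<subseteq> closed_square - outer_domain n W" for n
      using os unfolding Z_def outer_domain_def by blast
    show "AE x in lebesgue_on open_square. x \<in> Z (r k) \<longrightarrow> v k x = 0" for k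
      using vC[of k] insq unfolding constraint_set_def mem_Collect_eq by eventually_elim (use ZZ in blast)
    show "AE x in lebesgue_on open_square. x \<in> closed_square - W \<longrightarrow> (\<forall>\<^sub>F k in sequentially. x \<in> Z (r k))"
      using cells insq fr
    proof eventually_elim
      case (elim x)
      show ?case
      proof
        assume "x \<in> closed_square - W"
        then have "x \<in> open_square - closure W"
          using elim \<Omega>(1) by (auto simp: frontier_def interior_open)
        moreover have "open (open_square - closure W)" by (intro open_Diff) auto
        moreover have "open_square - closure W \<subseteq> closed_square - W" using os closure_subset by auto
        ultimately have "x \<in> interior (closed_square - W)" by (auto simp: interior_def)
        from ev_r[OF eventually_cell_in_shrink[OF elim(2) this bounded_subset[OF bcs Diff_subset]]] ev_r[OF eventually_gt_at_top[of 0]]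
        show "\<forall>\<^sub>F k in sequentially. x \<in> Z (r k)"
        proof eventually_elim
          case (elim k)
          then obtain p where "x \<in> cell (r k) p" using \<open>\<forall>n>0. \<exists>p. x \<in> cell n p\<close> by blast
          then show ?case using elim(1) unfolding Z_def by blast
        qed
      qed
    qed
  qed
  show ?thesis using one zero unfolding constraint_set_def mem_Collect_eq by eventually_elim auto
qed

section \<open>Mollification of integrable functions\<close>

text \<open>
Smooth probability densities supported within distance \<open>\<delta>\<close> of the origin. They need not be symmetric
or centred: kernels supported in a cone are used below.
\<close>

definition smoothing_kernel :: "(real \<times> real \<Rightarrow> real) \<Rightarrow> real \<Rightarrow> bool" where
  "smoothing_kernel \<kappa> \<delta> \<longleftrightarrow> smooth \<kappa> \<and> (\<forall>z. 0 \<le> \<kappa> z) \<and> (\<forall>z. \<kappa> z \<noteq> 0 \<longrightarrow> norm z < \<delta>) \<and>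
     integrable lborel \<kappa> \<and> (\<integral>z. \<kappa> z \<partial>lborel) = 1"

text \<open>
The average of \<open>u\<close> over the displacements \<open>v\<close> weighted by \<open>\<kappa> v\<close>, written in terms of the point
\<open>z = x + v\<close>.
\<close>

definition mollify :: "(real \<times> real \<Rightarrow> real) \<Rightarrow> (real \<times> real \<Rightarrow> real) \<Rightarrow> real \<times> real \<Rightarrow> real" where
  "mollify u \<kappa> x = (\<integral>z. u z * \<kappa> (z - x) \<partial>lborel)"

text \<open>
The partial derivative of \<^term>\<open>mollify u \<kappa>\<close>, as the derivative falling on the kernel.
\<close>

definition mollify_deriv :: "(real \<times> real \<Rightarrow> real) \<Rightarrow> (real \<times> real \<Rightarrow> real) \<Rightarrow> real \<times> real \<Rightarrow> real \<times> real \<Rightarrow> real" where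
  "mollify_deriv u \<kappa> b x = - (\<integral>z. u z * partial_deriv b \<kappa> (z - x) \<partial>lborel)"

lemma smoothing_kernel_compact:
  assumes "smoothing_kernel \<kappa> \<delta>" shows "compact (closure {z. \<kappa> z \<noteq> 0})"
proof -
  have "{z. \<kappa> z \<noteq> 0} \<subseteq> ball 0 \<delta>" using assms by (auto simp: smoothing_kernel_def)
  then show ?thesis using bounded_subset[OF bounded_ball] by (metis compact_closure)
qed

lemma smoothing_kernel_measurable [measurable_dest]:
  assumes "smoothing_kernel \<kappa> \<delta>" shows "\<kappa> \<in> borel_measurable borel"
  using assms by (intro borel_measurable_continuous_onI smooth_continuous) (auto simp: smoothing_kernel_def)

lemma nn_integral_lborel_reflect:
  fixes f :: "'a::euclidean_space \<Rightarrow> ennreal"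
  assumes [measurable]: "f \<in> borel_measurable borel"
  shows "(\<integral>\<^sup>+x. f (t - x) \<partial>lborel) = (\<integral>\<^sup>+x. f x \<partial>lborel)"
proof -
  have "lborel = distr lborel borel (\<lambda>x. t + (-1) *\<^sub>R x)"
    by (subst lborel_affine[of "-1" t]) (simp_all add: density_1)
  then have "(\<integral>\<^sup>+x. f x \<partial>lborel) = (\<integral>\<^sup>+x. f x \<partial>distr lborel borel (\<lambda>x. t + (-1) *\<^sub>R x))" by (rule arg_cong)
  also have "\<dots> = (\<integral>\<^sup>+x. f (t - x) \<partial>lborel)" by (subst nn_integral_distr) simp_all
  finally show ?thesis ..
qed

lemma nn_integral_lborel_shift:
  fixes f :: "'a::euclidean_space \<Rightarrow> ennreal"
  assumes [measurable]: "f \<in> borel_measurable borel"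
  shows "(\<integral>\<^sup>+x. f (x - t) \<partial>lborel) = (\<integral>\<^sup>+x. f x \<partial>lborel)"
proof -
  have "lborel = distr lborel borel (\<lambda>x. - t + x)" by (rule lborel_distr_plus[symmetric])
  then have "(\<integral>\<^sup>+x. f x \<partial>lborel) = (\<integral>\<^sup>+x. f x \<partial>distr lborel borel (\<lambda>x. - t + x))" by (rule arg_cong)
  also have "\<dots> = (\<integral>\<^sup>+x. f (x - t) \<partial>lborel)" by (subst nn_integral_distr) simp_all
  finally show ?thesis ..
qed

lemma smoothing_kernel_mass:
  assumes "smoothing_kernel \<kappa> \<delta>"
  shows "(\<integral>\<^sup>+x. ennreal (\<kappa> (z - x)) \<partial>lborel) = 1" "(\<integral>\<^sup>+z. ennreal (\<kappa> (z - x)) \<partial>lborel) = 1"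
    "integrable lborel (\<lambda>z. \<kappa> (z - x))" "(\<integral>z. \<kappa> (z - x) \<partial>lborel) = 1"
proof -
  note [measurable] = smoothing_kernel_measurable[OF assms]
  have 1: "(\<integral>\<^sup>+z. ennreal (\<kappa> z) \<partial>lborel) = 1"
    using assms by (subst nn_integral_eq_integral) (auto simp: smoothing_kernel_def)
  show "(\<integral>\<^sup>+x. ennreal (\<kappa> (z - x)) \<partial>lborel) = 1" by (subst nn_integral_lborel_reflect[of "\<lambda>x. ennreal (\<kappa> x)"]) (simp_all add: 1)
  show 2: "(\<integral>\<^sup>+z. ennreal (\<kappa> (z - x)) \<partial>lborel) = 1" by (subst nn_integral_lborel_shift[of "\<lambda>x. ennreal (\<kappa> x)"]) (simp_all add: 1)
  have nn: "0 \<le> \<kappa> z" for z using assms unfolding smoothing_kernel_def by blast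
  show 3: "integrable lborel (\<lambda>z. \<kappa> (z - x))" by (rule integrableI_nonneg) (auto simp: nn 2)
  show "(\<integral>z. \<kappa> (z - x) \<partial>lborel) = 1"
    using nn_integral_eq_integral[OF 3] nn 2 by simp
qed

lemma integrable_times_bounded:
  fixes u g :: "'a::euclidean_space \<Rightarrow> real"
  assumes u: "integrable lborel u" and g: "g \<in> borel_measurable borel" "\<And>x. \<bar>g x\<bar> \<le> B"
  shows "integrable lborel (\<lambda>z. u z * g z)" "\<bar>\<integral>z. u z * g z \<partial>lborel\<bar> \<le> B * (\<integral>z. \<bar>u z\<bar> \<partial>lborel)"
proof -
  note [measurable] = g(1)
  have um [measurable]: "u \<in> borel_measurable borel" using u by simp
  have le: "\<bar>u z * g z\<bar> \<le> B * \<bar>u z\<bar>" for z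
    unfolding abs_mult using mult_left_mono[OF g(2)[of z] abs_ge_zero[of "u z"]] by (simp add: mult.commute)
  show i: "integrable lborel (\<lambda>z. u z * g z)"
    by (rule Bochner_Integration.integrable_bound[OF integrable_mult_right[OF integrable_abs[OF u], of B]])
      (use le in \<open>auto intro!: AE_I2 intro: order_trans[OF _ abs_ge_self]\<close>)
  have "\<bar>\<integral>z. u z * g z \<partial>lborel\<bar> \<le> (\<integral>z. \<bar>u z * g z\<bar> \<partial>lborel)" by (rule integral_abs_bound)
  also have "\<dots> \<le> (\<integral>z. B * \<bar>u z\<bar> \<partial>lborel)"
    by (rule integral_mono[OF integrable_abs[OF i] integrable_mult_right[OF integrable_abs[OF u]] le])
  finally show "\<bar>\<integral>z. u z * g z \<partial>lborel\<bar> \<le> B * (\<integral>z. \<bar>u z\<bar> \<partial>lborel)" by simp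
qed

lemma mollify_estimates:
  assumes u: "integrable lborel u" and \<kappa>: "smoothing_kernel \<kappa> \<delta>"
  obtains C where "C \<ge> 0" "\<And>x y. \<bar>mollify u \<kappa> x - mollify u \<kappa> y\<bar> \<le> C * norm (x - y)"
    "\<And>b x. b \<in> Basis \<Longrightarrow> \<bar>mollify_deriv u \<kappa> b x\<bar> \<le> C"
    "\<And>b x y. b \<in> Basis \<Longrightarrow> \<bar>mollify_deriv u \<kappa> b x - mollify_deriv u \<kappa> b y\<bar> \<le> C * norm (x - y)"
    "\<And>b x y h. b \<in> Basis \<Longrightarrow> \<bar>mollify u \<kappa> (x + h *\<^sub>R b) - mollify u \<kappa> x - h * mollify_deriv u \<kappa> b y\<bar>
        \<le> C * \<bar>h\<bar> * (norm (x - y) + \<bar>h\<bar>)"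
proof -
  have sm: "smooth \<kappa>" using \<kappa> by (simp add: smoothing_kernel_def)
  have cs: "compact (closure {z. \<kappa> z \<noteq> 0})" by (rule smoothing_kernel_compact[OF \<kappa>])
  have smd: "smooth (partial_deriv b \<kappa>)" if "b \<in> Basis" for b using sm that by (rule smooth_partial_deriv)
  have csd: "compact (closure {z. partial_deriv b \<kappa> z \<noteq> 0})" for b
    using closure_support_partial_deriv[of b \<kappa>] cs by (metis closed_closure compact_Int_closed inf.absorb2)
  obtain C0 where C0: "\<And>x y. \<bar>\<kappa> x - \<kappa> y\<bar> \<le> C0 * norm (x - y)" "C0 > 0"
    using smooth_compact_support_lipschitz[OF sm cs] by metis
  obtain B0 where B0: "\<And>x. \<bar>\<kappa> x\<bar> \<le> B0" "B0 > 0" using compact_support_bounded[OF smooth_continuous[OF sm] cs] by metis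
  have "\<forall>b\<in>Basis. \<exists>B>0. \<forall>x. \<bar>partial_deriv b \<kappa> x\<bar> \<le> B"
    using compact_support_bounded[OF smooth_continuous[OF smd] csd] by metis
  then obtain B1 where B1: "\<And>b. b \<in> Basis \<Longrightarrow> B1 b > 0" "\<And>b x. b \<in> Basis \<Longrightarrow> \<bar>partial_deriv b \<kappa> x\<bar> \<le> B1 b" by metis
  have "\<forall>b\<in>Basis. \<exists>B>0. \<forall>x y. \<bar>partial_deriv b \<kappa> x - partial_deriv b \<kappa> y\<bar> \<le> B * norm (x - y)"
    using smooth_compact_support_lipschitz[OF smd csd] by metis
  then obtain B2 where B2: "\<And>b. b \<in> Basis \<Longrightarrow> B2 b > 0"
    "\<And>b x y. b \<in> Basis \<Longrightarrow> \<bar>partial_deriv b \<kappa> x - partial_deriv b \<kappa> y\<bar> \<le> B2 b * norm (x - y)" by metis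
  define K where "K = C0 + (\<Sum>b\<in>Basis. B1 b + B2 b)"
  have sb: "B1 b + B2 b \<le> (\<Sum>b\<in>Basis. B1 b + B2 b)" if "b \<in> Basis" for b
    using that by (intro member_le_sum) (auto intro!: add_nonneg_nonneg[OF less_imp_le[OF B1(1)] less_imp_le[OF B2(1)]])
  have s0: "0 \<le> (\<Sum>b\<in>Basis. B1 b + B2 b)" using B1(1) B2(1) by (intro sum_nonneg add_nonneg_nonneg) (auto intro: less_imp_le)
  have K: "C0 \<le> K" "K \<ge> 0" using s0 C0(2) by (auto simp: K_def)
  have KB: "B1 b \<le> K" "B2 b \<le> K" if "b \<in> Basis" for b
    using sb[OF that] B1(1)[OF that] B2(1)[OF that] C0(2) by (auto simp: K_def)
  have \<kappa>m [measurable]: "\<kappa> \<in> borel_measurable borel" by (rule smoothing_kernel_measurable[OF \<kappa>])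
  have dm [measurable]: "partial_deriv b \<kappa> \<in> borel_measurable borel" if "b \<in> Basis" for b
    by (intro borel_measurable_continuous_onI smooth_continuous smd that)
  define I where "I = (\<integral>z. \<bar>u z\<bar> \<partial>lborel)"
  have I0: "I \<ge> 0" by (simp add: I_def)
  have i1: "integrable lborel (\<lambda>z. u z * \<kappa> (z - x))" for x
    by (rule integrable_times_bounded(1)[OF u _ B0(1)]) simp
  have i2: "integrable lborel (\<lambda>z. u z * partial_deriv b \<kappa> (z - x))" if b: "b \<in> Basis" for x b
    by (rule integrable_times_bounded(1)[OF u _ B1(2)[OF b]]) (use dm[OF b] in simp)
  show ?thesis
  proof (rule that[of "K * I"])
    show "0 \<le> K * I" using K I0 by simp
    fix x y :: "real \<times> real"
    have "mollify u \<kappa> x - mollify u \<kappa> y = (\<integral>z. u z * (\<kappa> (z - x) - \<kappa> (z - y)) \<partial>lborel)"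
      unfolding mollify_def right_diff_distrib by (rule Bochner_Integration.integral_diff[symmetric, OF i1 i1])
    also have "\<bar>\<dots>\<bar> \<le> (K * norm (x - y)) * I"
      unfolding I_def
    proof (rule integrable_times_bounded(2)[OF u])
      fix z show "\<bar>\<kappa> (z - x) - \<kappa> (z - y)\<bar> \<le> K * norm (x - y)"
        using C0(1)[of "z - x" "z - y"] mult_right_mono[OF K(1) norm_ge_zero[of "x - y"]] by (simp add: norm_minus_commute)
    qed simp
    finally show "\<bar>mollify u \<kappa> x - mollify u \<kappa> y\<bar> \<le> K * I * norm (x - y)" by (simp add: mult_ac)
    fix b :: "real \<times> real" assume b: "b \<in> Basis"
    note [measurable] = dm[OF b]
    have "\<bar>\<integral>z. u z * partial_deriv b \<kappa> (z - x) \<partial>lborel\<bar> \<le> K * I"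
      unfolding I_def by (rule integrable_times_bounded(2)[OF u]) (use order_trans[OF B1(2)[OF b] KB(1)[OF b]] in auto)
    then show "\<bar>mollify_deriv u \<kappa> b x\<bar> \<le> K * I" by (simp add: mollify_deriv_def)
    have "mollify_deriv u \<kappa> b x - mollify_deriv u \<kappa> b y = (\<integral>z. u z * (partial_deriv b \<kappa> (z - y) - partial_deriv b \<kappa> (z - x)) \<partial>lborel)"
      unfolding mollify_deriv_def right_diff_distrib by (subst Bochner_Integration.integral_diff[OF i2[OF b] i2[OF b]]) simp
    also have "\<bar>\<dots>\<bar> \<le> (K * norm (x - y)) * I"
      unfolding I_def
    proof (rule integrable_times_bounded(2)[OF u])
      fix z show "\<bar>partial_deriv b \<kappa> (z - y) - partial_deriv b \<kappa> (z - x)\<bar> \<le> K * norm (x - y)"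
        using B2(2)[OF b, of "z - y" "z - x"] mult_right_mono[OF KB(2)[OF b] norm_ge_zero[of "x - y"]] by simp
    qed simp
    finally show "\<bar>mollify_deriv u \<kappa> b x - mollify_deriv u \<kappa> b y\<bar> \<le> K * I * norm (x - y)" by (simp add: mult_ac)
    fix h :: real
    have "mollify u \<kappa> (x + h *\<^sub>R b) - mollify u \<kappa> x - h * mollify_deriv u \<kappa> b y
      = (\<integral>z. u z * (\<kappa> (z - (x + h *\<^sub>R b)) - \<kappa> (z - x) + h * partial_deriv b \<kappa> (z - y)) \<partial>lborel)"
    proof -
      have "(\<integral>z. u z * (\<kappa> (z - (x + h *\<^sub>R b)) - \<kappa> (z - x) + h * partial_deriv b \<kappa> (z - y)) \<partial>lborel)
        = (\<integral>z. (u z * \<kappa> (z - (x + h *\<^sub>R b)) - u z * \<kappa> (z - x)) + h * (u z * partial_deriv b \<kappa> (z - y)) \<partial>lborel)"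
        by (simp add: algebra_simps)
      also have "\<dots> = (\<integral>z. (u z * \<kappa> (z - (x + h *\<^sub>R b)) - u z * \<kappa> (z - x)) \<partial>lborel) + (\<integral>z. h * (u z * partial_deriv b \<kappa> (z - y)) \<partial>lborel)"
        by (rule Bochner_Integration.integral_add[OF Bochner_Integration.integrable_diff[OF i1 i1] integrable_mult_right[OF i2[OF b]]])
      also have "\<dots> = (mollify u \<kappa> (x + h *\<^sub>R b) - mollify u \<kappa> x) + h * (\<integral>z. u z * partial_deriv b \<kappa> (z - y) \<partial>lborel)"
        unfolding mollify_def Bochner_Integration.integral_diff[OF i1 i1] by (simp only: integral_mult_right_zero)
      finally show ?thesis by (simp add: mollify_deriv_def)
    qed
    also have "\<bar>\<dots>\<bar> \<le> (K * \<bar>h\<bar> * (norm (x - y) + \<bar>h\<bar>)) * I"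
      unfolding I_def
    proof (rule integrable_times_bounded(2)[OF u])
      fix z
      have "\<bar>\<kappa> (z - x + (- h) *\<^sub>R b) - \<kappa> (z - x) - (- h) * partial_deriv b \<kappa> (z - y)\<bar> \<le> B2 b * \<bar>- h\<bar> * (norm (z - x - (z - y)) + \<bar>- h\<bar>)"
        by (rule difference_quotient_partial_deriv[OF sm b B2(2)[OF b]])
      also have "\<dots> \<le> K * \<bar>- h\<bar> * (norm (z - x - (z - y)) + \<bar>- h\<bar>)"
        using KB(2)[OF b] by (intro mult_right_mono) auto
      finally show "\<bar>\<kappa> (z - (x + h *\<^sub>R b)) - \<kappa> (z - x) + h * partial_deriv b \<kappa> (z - y)\<bar> \<le> K * \<bar>h\<bar> * (norm (x - y) + \<bar>h\<bar>)"
        by (simp add: norm_minus_commute diff_diff_eq)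
    qed simp
    finally show "\<bar>mollify u \<kappa> (x + h *\<^sub>R b) - mollify u \<kappa> x - h * mollify_deriv u \<kappa> b y\<bar>
        \<le> K * I * \<bar>h\<bar> * (norm (x - y) + \<bar>h\<bar>)" by (simp add: mult_ac)
  qed
qed

text \<open>
An indicator is approximated by that of a compact subset, and the latter by the Lipschitz functions
\<open>max 0 (1 - k infdist x K)\<close>.
\<close>

lemma lipschitz_dense_in_L1:
  fixes f :: "'a::{second_countable_topology, complete_space} \<Rightarrow> real"
  assumes N: "finite_measure N" and sN: "sets N = sets borel" and f: "integrable N f"
  shows "\<forall>\<eta>>0. \<exists>g L. L-lipschitz_on UNIV g \<and> integrable N g \<and> (\<integral>x. \<bar>f x - g x\<bar> \<partial>N) < \<eta>"
  using f
proof (induction rule: integrable_induct)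
  interpret finite_measure N by (rule N)
  have [measurable_cong]: "sets N = sets borel" by (rule sN)
  case (base A c)
  show ?case
  proof (intro allI impI)
    fix \<eta> :: real assume \<eta>: "\<eta> > 0"
    define e where "e = \<eta> / (2 * (\<bar>c\<bar> + 1))"
    have e: "e > 0" "\<bar>c\<bar> * e < \<eta> / 2" using \<eta> by (auto simp: e_def field_simps intro!: add_pos_nonneg)
    have A [measurable]: "A \<in> sets borel" using base sN by simp
    have sup: "emeasure N A = (SUP K \<in> {K. K \<subseteq> A \<and> compact K}. emeasure N K)"
      by (rule inner_regular[OF sN]) (use emeasure_finite[of "space N"] A in auto)
    have "\<exists>K. K \<subseteq> A \<and> compact K \<and> measure N A - e < measure N K"
    proof -
      have "\<exists>K\<in>{K. K \<subseteq> A \<and> compact K}. emeasure N A < emeasure N K + ennreal e"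
        by (rule SUP_approx_ennreal[OF _ _ sup]) (use e emeasure_finite[of A] in auto)
      then obtain K where K: "K \<subseteq> A" "compact K" "emeasure N A < emeasure N K + ennreal e" by blast
      then have "ennreal (measure N A) < ennreal (measure N K + e)"
        using e(1) by (simp add: emeasure_eq_measure ennreal_plus)
      then have "measure N A < measure N K + e" using e(1) by (subst (asm) ennreal_less_iff) auto
      then show ?thesis using K by (intro exI[of _ K]) auto
    qed
    then obtain K where K: "K \<subseteq> A" "compact K" "measure N A - e < measure N K" by blast
    have Kb [measurable]: "K \<in> sets borel" using K(2) by (simp add: borel_compact)
    define g where "g k x = c * (if K = {} then 0 else max 0 (1 - real k * infdist x K))" for k :: nat and x
    have gl: "(\<bar>c\<bar> * real k)-lipschitz_on UNIV (g k)" for k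
    proof (rule lipschitz_onI)
      fix x y
      have "\<bar>max 0 (1 - s) - max 0 (1 - t)\<bar> \<le> \<bar>s - t\<bar>" for s t :: real by auto
      then have "\<bar>max 0 (1 - real k * infdist x K) - max 0 (1 - real k * infdist y K)\<bar> \<le> \<bar>real k * infdist x K - real k * infdist y K\<bar>" .
      also have "\<dots> = real k * \<bar>infdist x K - infdist y K\<bar>" by (simp add: abs_mult flip: right_diff_distrib)
      also have "\<dots> \<le> real k * dist x y" by (intro mult_left_mono) (auto intro: infdist_triangle_abs)
      finally show "dist (g k x) (g k y) \<le> \<bar>c\<bar> * real k * dist x y"
        by (auto simp: g_def dist_real_def abs_mult mult.assoc right_diff_distrib[symmetric] intro!: mult_left_mono)
    qed simp
    have gm [measurable]: "g k \<in> borel_measurable borel" for k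
      using lipschitz_on_continuous_on[OF gl] by (rule borel_measurable_continuous_onI)
    have gb: "\<bar>g k x\<bar> \<le> \<bar>c\<bar>" for k x
      using infdist_nonneg[of x K] by (auto simp: g_def abs_mult intro!: mult_left_le)
    have gi: "integrable N (g k)" for k by (rule integrable_const_bound[of _ "\<bar>c\<bar>"]) (use gb in auto)
    have "(\<lambda>k. \<integral>x. \<bar>indicator K x * c - g k x\<bar> \<partial>N) \<longlonglongrightarrow> (\<integral>x. 0 \<partial>N)"
    proof (rule integral_dominated_convergence[where w = "\<lambda>_. 2 * \<bar>c\<bar>"])
      show "AE x in N. (\<lambda>k. \<bar>indicator K x * c - g k x\<bar>) \<longlonglongrightarrow> 0"
      proof (rule AE_I2)
        fix x
        show "(\<lambda>k. \<bar>indicator K x * c - g k x\<bar>) \<longlonglongrightarrow> 0"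
        proof (cases "x \<in> K")
          case True
          then have "K \<noteq> {}" by blast
          then show ?thesis using True by (simp add: g_def)
        next
          case False
          show ?thesis
          proof (cases "K = {}")
            case False
            then have d: "infdist x K > 0"
              using \<open>x \<notin> K\<close> K(2) infdist_pos_not_in_closed[of K x] compact_imp_closed by auto
            obtain k0 where k0: "real k0 * infdist x K > 1" using reals_Archimedean3[OF d] by blast
            have "\<forall>\<^sub>F k in sequentially. g k x = 0"
              using eventually_ge_at_top[of k0]
            proof eventually_elim
              case (elim k)
              then have "real k0 * infdist x K \<le> real k * infdist x K" using d by (intro mult_right_mono) auto
              then show ?case using k0 by (auto simp: g_def)
            qed
            then have "\<forall>\<^sub>F k in sequentially. \<bar>indicator K x * c - g k x\<bar> = 0"
              by eventually_elim (use \<open>x \<notin> K\<close> in auto)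
            then show ?thesis by (rule tendsto_eventually)
          qed (auto simp: g_def)
        qed
      qed
      show "AE x in N. norm \<bar>indicator K x * c - g k x\<bar> \<le> 2 * \<bar>c\<bar>" for k
      proof (rule AE_I2)
        fix x
        have "\<bar>indicator K x * c\<bar> \<le> \<bar>c\<bar>" by (auto simp: indicator_def)
        then show "norm \<bar>indicator K x * c - g k x\<bar> \<le> 2 * \<bar>c\<bar>"
          using gb[of k x] abs_triangle_ineq4[of "indicator K x * c" "g k x"] unfolding real_norm_def abs_abs by linarith
      qed
    qed auto
    then have "\<forall>\<^sub>F k in sequentially. (\<integral>x. \<bar>indicator K x * c - g k x\<bar> \<partial>N) < \<eta> / 2"
      using \<eta> by (intro order_tendstoD) auto
    then obtain k where k: "(\<integral>x. \<bar>indicator K x * c - g k x\<bar> \<partial>N) < \<eta> / 2"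
      by (auto simp: eventually_sequentially)
    have iA: "integrable N (\<lambda>x. indicator B x * d)" if "B \<in> sets borel" for B and d :: real
      using that sN emeasure_finite[of B] by (intro integrable_mult_left) (auto simp: less_top[symmetric])
    have "(\<integral>x. \<bar>indicator A x *\<^sub>R c - g k x\<bar> \<partial>N) \<le> (\<integral>x. (indicator A x * \<bar>c\<bar> - indicator K x * \<bar>c\<bar>) + \<bar>indicator K x * c - g k x\<bar> \<partial>N)"
    proof (rule integral_mono)
      show "\<bar>indicator A x *\<^sub>R c - g k x\<bar> \<le> (indicator A x * \<bar>c\<bar> - indicator K x * \<bar>c\<bar>) + \<bar>indicator K x * c - g k x\<bar>" for x
        using K(1) by (auto simp: indicator_def)
      show "integrable N (\<lambda>x. \<bar>indicator A x *\<^sub>R c - g k x\<bar>)"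
        using iA[OF A, of c] gi[of k] by simp
      show "integrable N (\<lambda>x. (indicator A x * \<bar>c\<bar> - indicator K x * \<bar>c\<bar>) + \<bar>indicator K x * c - g k x\<bar>)"
        by (intro Bochner_Integration.integrable_add Bochner_Integration.integrable_diff integrable_abs iA A Kb gi)
    qed
    also have "\<dots> = ((\<integral>x. indicator A x * \<bar>c\<bar> \<partial>N) - (\<integral>x. indicator K x * \<bar>c\<bar> \<partial>N)) + (\<integral>x. \<bar>indicator K x * c - g k x\<bar> \<partial>N)"
      by (subst Bochner_Integration.integral_add, (intro Bochner_Integration.integrable_diff integrable_abs iA A Kb gi)+,
          subst Bochner_Integration.integral_diff, (intro iA A Kb refl)+)
    also have "\<dots> = (measure N A - measure N K) * \<bar>c\<bar> + (\<integral>x. \<bar>indicator K x * c - g k x\<bar> \<partial>N)"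
    proof -
      have sp: "space N = UNIV" using sets_eq_imp_space_eq[OF sN] by simp
      show ?thesis by (simp add: sp left_diff_distrib)
    qed
    also have "\<dots> < \<eta>"
    proof -
      have "(measure N A - measure N K) * \<bar>c\<bar> \<le> e * \<bar>c\<bar>" using K(3) by (intro mult_right_mono) auto
      then show ?thesis using e(2) k by (simp add: mult.commute)
    qed
    finally show "\<exists>g L. L-lipschitz_on UNIV g \<and> integrable N g \<and> (\<integral>x. \<bar>indicator A x *\<^sub>R c - g x\<bar> \<partial>N) < \<eta>"
      using gl gi by blast
  qed
next
  case (add f1 f2)
  show ?case
  proof (intro allI impI)
    fix \<eta> :: real assume "\<eta> > 0"
    then obtain g1 L1 g2 L2 where g: "L1-lipschitz_on UNIV g1" "integrable N g1" "(\<integral>x. \<bar>f1 x - g1 x\<bar> \<partial>N) < \<eta> / 2"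
      "L2-lipschitz_on UNIV g2" "integrable N g2" "(\<integral>x. \<bar>f2 x - g2 x\<bar> \<partial>N) < \<eta> / 2"
      using add.IH by (meson half_gt_zero)
    have "(\<integral>x. \<bar>f1 x + f2 x - (g1 x + g2 x)\<bar> \<partial>N) \<le> (\<integral>x. \<bar>f1 x - g1 x\<bar> + \<bar>f2 x - g2 x\<bar> \<partial>N)"
      using g add.hyps by (intro integral_mono) auto
    also have "\<dots> = (\<integral>x. \<bar>f1 x - g1 x\<bar> \<partial>N) + (\<integral>x. \<bar>f2 x - g2 x\<bar> \<partial>N)"
      using g add.hyps by (intro Bochner_Integration.integral_add) auto
    also have "\<dots> < \<eta>" using g by simp
    finally show "\<exists>g L. L-lipschitz_on UNIV g \<and> integrable N g \<and> (\<integral>x. \<bar>f1 x + f2 x - g x\<bar> \<partial>N) < \<eta>"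
      using lipschitz_on_add[OF g(1,4)] g(2,5) by (intro exI[of _ "\<lambda>x. g1 x + g2 x"] exI[of _ "L1 + L2"]) auto
  qed
next
  case (lim f s)
  show ?case
  proof (intro allI impI)
    fix \<eta> :: real assume \<eta>: "\<eta> > 0"
    have "(\<lambda>i. \<integral>x. \<bar>f x - s i x\<bar> \<partial>N) \<longlonglongrightarrow> (\<integral>x. 0 \<partial>N)"
    proof (rule integral_dominated_convergence[where w = "\<lambda>x. 3 * \<bar>f x\<bar>"])
      show "AE x in N. (\<lambda>i. \<bar>f x - s i x\<bar>) \<longlonglongrightarrow> 0"
      proof (rule AE_I2)
        fix x assume "x \<in> space N"
        then have "(\<lambda>i. f x - s i x) \<longlonglongrightarrow> f x - f x" using lim by (intro tendsto_diff tendsto_const) auto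
        then show "(\<lambda>i. \<bar>f x - s i x\<bar>) \<longlonglongrightarrow> 0" by (intro tendsto_rabs_zero) simp
      qed
      show "AE x in N. norm \<bar>f x - s i x\<bar> \<le> 3 * \<bar>f x\<bar>" for i
      proof (rule AE_I2)
        fix x assume "x \<in> space N"
        then have "\<bar>s i x\<bar> \<le> 2 * \<bar>f x\<bar>" using lim by simp
        then show "norm \<bar>f x - s i x\<bar> \<le> 3 * \<bar>f x\<bar>" using abs_triangle_ineq4[of "f x" "s i x"] by simp
      qed
    qed (use lim.hyps in auto)
    then have "\<forall>\<^sub>F i in sequentially. (\<integral>x. \<bar>f x - s i x\<bar> \<partial>N) < \<eta> / 2"
      using \<eta> by (intro order_tendstoD) auto
    then obtain i where i: "(\<integral>x. \<bar>f x - s i x\<bar> \<partial>N) < \<eta> / 2" by (auto simp: eventually_sequentially)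
    obtain g L where g: "L-lipschitz_on UNIV g" "integrable N g" "(\<integral>x. \<bar>s i x - g x\<bar> \<partial>N) < \<eta> / 2"
      using lim.IH[of i] \<eta> by (meson half_gt_zero)
    have "(\<integral>x. \<bar>f x - g x\<bar> \<partial>N) \<le> (\<integral>x. \<bar>f x - s i x\<bar> + \<bar>s i x - g x\<bar> \<partial>N)"
      using g lim.hyps by (intro integral_mono) auto
    also have "\<dots> = (\<integral>x. \<bar>f x - s i x\<bar> \<partial>N) + (\<integral>x. \<bar>s i x - g x\<bar> \<partial>N)"
      using g lim.hyps by (intro Bochner_Integration.integral_add) auto
    also have "\<dots> < \<eta>" using g i by simp
    finally show "\<exists>g L. L-lipschitz_on UNIV g \<and> integrable N g \<and> (\<integral>x. \<bar>f x - g x\<bar> \<partial>N) < \<eta>"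
      using g by blast
  qed
qed

text \<open>
Tonelli's theorem for a weight \<open>\<zeta>\<close> in front of an average: the weight may be moved to the point of
integration \<open>z\<close>, at distance less than \<open>\<delta>\<close>.
\<close>

lemma nn_integral_mollify_le:
  fixes f \<zeta> :: "real \<times> real \<Rightarrow> ennreal" and \<nu> :: "(real \<times> real) measure"
  assumes \<nu>: "sigma_finite_measure \<nu>" "sets \<nu> = sets borel" and \<zeta>: "\<zeta> \<in> borel_measurable borel" and f: "f \<in> borel_measurable borel"
    and \<kappa>: "smoothing_kernel \<kappa> \<delta>" and le: "\<And>x z. norm (z - x) < \<delta> \<Longrightarrow> \<zeta> x * f z \<le> h z"
  shows "(\<integral>\<^sup>+x. \<zeta> x * (\<integral>\<^sup>+z. f z * ennreal (\<kappa> (z - x)) \<partial>\<nu>) \<partial>lborel) \<le> (\<integral>\<^sup>+z. h z \<partial>\<nu>)"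
proof -
  note [measurable] = smoothing_kernel_measurable[OF \<kappa>] \<zeta> f
  note [measurable_cong] = \<nu>(2)
  interpret pair_sigma_finite lborel \<nu>
    using \<nu> by (simp add: pair_sigma_finite_def lborel.sigma_finite_measure_axioms)
  have "(\<integral>\<^sup>+x. \<zeta> x * (\<integral>\<^sup>+z. f z * ennreal (\<kappa> (z - x)) \<partial>\<nu>) \<partial>lborel)
      = (\<integral>\<^sup>+x. (\<integral>\<^sup>+z. \<zeta> x * (f z * ennreal (\<kappa> (z - x))) \<partial>\<nu>) \<partial>lborel)"
    by (intro nn_integral_cong nn_integral_cmult[symmetric]) simp
  also have "\<dots> = (\<integral>\<^sup>+z. (\<integral>\<^sup>+x. \<zeta> x * (f z * ennreal (\<kappa> (z - x))) \<partial>lborel) \<partial>\<nu>)"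
    by (rule Fubini'[symmetric]) measurable
  also have "\<dots> \<le> (\<integral>\<^sup>+z. h z * 1 \<partial>\<nu>)"
  proof (rule nn_integral_mono)
    fix z
    have "(\<integral>\<^sup>+x. \<zeta> x * (f z * ennreal (\<kappa> (z - x))) \<partial>lborel) \<le> (\<integral>\<^sup>+x. h z * ennreal (\<kappa> (z - x)) \<partial>lborel)"
    proof (rule nn_integral_mono)
      fix x
      show "\<zeta> x * (f z * ennreal (\<kappa> (z - x))) \<le> h z * ennreal (\<kappa> (z - x))"
      proof (cases "\<kappa> (z - x) = 0")
        case False
        then have "norm (z - x) < \<delta>" using \<kappa> unfolding smoothing_kernel_def by blast
        from mult_right_mono[OF le[OF this], of "ennreal (\<kappa> (z - x))"] show ?thesis by (simp add: mult.assoc)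
      qed simp
    qed
    also have "\<dots> = h z * (\<integral>\<^sup>+x. ennreal (\<kappa> (z - x)) \<partial>lborel)" by (rule nn_integral_cmult) measurable
    also have "\<dots> = h z * 1" by (simp only: smoothing_kernel_mass(1)[OF \<kappa>])
    finally show "(\<integral>\<^sup>+x. \<zeta> x * (f z * ennreal (\<kappa> (z - x))) \<partial>lborel) \<le> h z * 1" .
  qed
  finally show ?thesis by simp
qed

lemma borel_measurable_mollify:
  assumes u: "integrable lborel u" and \<kappa>: "smoothing_kernel \<kappa> \<delta>"
  shows "mollify u \<kappa> \<in> borel_measurable borel"
proof -
  obtain C where C: "C \<ge> 0" "\<And>x y. \<bar>mollify u \<kappa> x - mollify u \<kappa> y\<bar> \<le> C * norm (x - y)"
    using mollify_estimates[OF u \<kappa>] by metis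
  have "C-lipschitz_on UNIV (mollify u \<kappa>)"
    by (rule lipschitz_onI) (use C in \<open>auto simp: dist_norm\<close>)
  then show ?thesis by (intro borel_measurable_continuous_onI lipschitz_on_continuous_on)
qed

lemma borel_measurable_mollify_deriv:
  assumes u: "integrable lborel u" and \<kappa>: "smoothing_kernel \<kappa> \<delta>" and b: "b \<in> Basis"
  shows "mollify_deriv u \<kappa> b \<in> borel_measurable borel"
proof -
  obtain C where C: "C \<ge> 0" "\<And>b x y. b \<in> Basis \<Longrightarrow> \<bar>mollify_deriv u \<kappa> b x - mollify_deriv u \<kappa> b y\<bar> \<le> C * norm (x - y)"
    using mollify_estimates[OF u \<kappa>] by metis
  have "C-lipschitz_on UNIV (mollify_deriv u \<kappa> b)"
    by (rule lipschitz_onI) (use C b in \<open>auto simp: dist_norm\<close>)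
  then show ?thesis by (intro borel_measurable_continuous_onI lipschitz_on_continuous_on)
qed

lemma emeasure_open_square: "emeasure lborel open_square = 1"
  unfolding open_square_box by (subst emeasure_lborel_box) (auto simp: Basis_prod_def prod.insert_if)

lemma mollify_pointwise:
  assumes u: "integrable lborel u" and \<kappa>: "smoothing_kernel \<kappa> \<delta>" and \<delta>: "\<delta> > 0"
    and g: "L-lipschitz_on UNIV g"
  shows "ennreal \<bar>mollify u \<kappa> x - u x\<bar> \<le> (\<integral>\<^sup>+z. ennreal \<bar>u z - g z\<bar> * ennreal (\<kappa> (z - x)) \<partial>lborel) + ennreal (L * \<delta>) + ennreal \<bar>u x - g x\<bar>"
proof -
  note [measurable] = smoothing_kernel_measurable[OF \<kappa>]
  have um [measurable]: "u \<in> borel_measurable borel" using u by simp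
  have gm [measurable]: "g \<in> borel_measurable borel"
    using lipschitz_on_continuous_on[OF g] by (rule borel_measurable_continuous_onI)
  have nn: "0 \<le> \<kappa> z" for z using \<kappa> unfolding smoothing_kernel_def by blast
  have L0: "L \<ge> 0" using g by (rule lipschitz_on_nonneg)
  obtain B where B: "\<And>z. \<bar>\<kappa> z\<bar> \<le> B"
    using compact_support_bounded[OF smooth_continuous smoothing_kernel_compact[OF \<kappa>]] \<kappa> unfolding smoothing_kernel_def by metis
  have iu: "integrable lborel (\<lambda>z. u z * \<kappa> (z - x))"
    by (rule integrable_times_bounded(1)[OF u _ B]) simp
  have i\<kappa>: "integrable lborel (\<lambda>z. \<kappa> (z - x))" "(\<integral>z. \<kappa> (z - x) \<partial>lborel) = 1"
    using smoothing_kernel_mass[OF \<kappa>] by auto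
  have gd: "\<bar>(g z - g x) * \<kappa> (z - x)\<bar> \<le> L * \<delta> * \<kappa> (z - x)" for z
  proof (cases "\<kappa> (z - x) = 0")
    case False
    then have "norm (z - x) < \<delta>" using \<kappa> unfolding smoothing_kernel_def by blast
    then have "\<bar>g z - g x\<bar> \<le> L * \<delta>"
      using lipschitz_onD[OF g, of z x] mult_left_mono[OF less_imp_le L0, of "norm (z - x)" \<delta>] by (simp add: dist_norm)
    then show ?thesis using nn by (simp add: abs_mult mult_right_mono)
  qed simp
  have ig: "integrable lborel (\<lambda>z. (g z - g x) * \<kappa> (z - x))"
    by (rule Bochner_Integration.integrable_bound[OF integrable_mult_right[OF i\<kappa>(1), of "L * \<delta>"]])
      (use gd in \<open>auto intro!: AE_I2 intro: order_trans[OF _ abs_ge_self]\<close>)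
  have i3: "integrable lborel (\<lambda>z. (u z - g z) * \<kappa> (z - x))"
  proof -
    have "integrable lborel (\<lambda>z. u z * \<kappa> (z - x) - ((g z - g x) * \<kappa> (z - x) + g x * \<kappa> (z - x)))"
      by (intro Bochner_Integration.integrable_diff Bochner_Integration.integrable_add iu ig integrable_mult_right i\<kappa>)
    then show ?thesis by (simp add: algebra_simps)
  qed
  have "mollify u \<kappa> x - g x = (\<integral>z. (u z - g z) * \<kappa> (z - x) \<partial>lborel) + (\<integral>z. (g z - g x) * \<kappa> (z - x) \<partial>lborel)"
  proof -
    have "(\<integral>z. (u z - g z) * \<kappa> (z - x) \<partial>lborel) + (\<integral>z. (g z - g x) * \<kappa> (z - x) \<partial>lborel)
      = (\<integral>z. (u z - g z) * \<kappa> (z - x) + (g z - g x) * \<kappa> (z - x) \<partial>lborel)"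
      by (rule Bochner_Integration.integral_add[symmetric, OF i3 ig])
    also have "\<dots> = (\<integral>z. u z * \<kappa> (z - x) - g x * \<kappa> (z - x) \<partial>lborel)" by (simp add: algebra_simps)
    also have "\<dots> = mollify u \<kappa> x - g x"
      unfolding mollify_def by (subst Bochner_Integration.integral_diff[OF iu integrable_mult_right[OF i\<kappa>(1)]]) (simp add: i\<kappa>(2))
    finally show ?thesis ..
  qed
  moreover have "\<bar>\<integral>z. (g z - g x) * \<kappa> (z - x) \<partial>lborel\<bar> \<le> L * \<delta>"
  proof -
    have "\<bar>\<integral>z. (g z - g x) * \<kappa> (z - x) \<partial>lborel\<bar> \<le> (\<integral>z. \<bar>(g z - g x) * \<kappa> (z - x)\<bar> \<partial>lborel)" by (rule integral_abs_bound)
    also have "\<dots> \<le> (\<integral>z. L * \<delta> * \<kappa> (z - x) \<partial>lborel)"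
      by (rule integral_mono[OF integrable_abs[OF ig] integrable_mult_right[OF i\<kappa>(1)] gd])
    finally show ?thesis by (simp add: i\<kappa>(2))
  qed
  ultimately have "\<bar>mollify u \<kappa> x - u x\<bar> \<le> (\<integral>z. \<bar>(u z - g z) * \<kappa> (z - x)\<bar> \<partial>lborel) + L * \<delta> + \<bar>u x - g x\<bar>"
    using integral_abs_bound[of lborel "\<lambda>z. (u z - g z) * \<kappa> (z - x)"] by linarith
  then have "ennreal \<bar>mollify u \<kappa> x - u x\<bar> \<le> ennreal ((\<integral>z. \<bar>(u z - g z) * \<kappa> (z - x)\<bar> \<partial>lborel) + L * \<delta> + \<bar>u x - g x\<bar>)"
    by (rule ennreal_leI)
  also have "\<dots> = ennreal (\<integral>z. \<bar>(u z - g z) * \<kappa> (z - x)\<bar> \<partial>lborel) + ennreal (L * \<delta>) + ennreal \<bar>u x - g x\<bar>"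
    using L0 \<delta> by (simp add: ennreal_plus)
  also have "ennreal (\<integral>z. \<bar>(u z - g z) * \<kappa> (z - x)\<bar> \<partial>lborel) = (\<integral>\<^sup>+z. ennreal \<bar>(u z - g z) * \<kappa> (z - x)\<bar> \<partial>lborel)"
    by (rule nn_integral_eq_integral[symmetric, OF integrable_abs[OF i3]]) auto
  also have "\<dots> = (\<integral>\<^sup>+z. ennreal \<bar>u z - g z\<bar> * ennreal (\<kappa> (z - x)) \<partial>lborel)"
    using nn by (simp add: abs_mult ennreal_mult)
  finally show ?thesis .
qed

text \<open>
Mollification converges in \<open>L\<^sup>1\<close> of the square, uniformly over all kernels of small support.
\<close>

lemma mollify_L1_convergence:
  assumes u: "integrable lborel u" and \<eta>: "\<eta> > (0::real)"
  shows "\<exists>\<delta>0>0. \<forall>\<kappa> \<delta>. smoothing_kernel \<kappa> \<delta> \<longrightarrow> 0 < \<delta> \<longrightarrow> \<delta> \<le> \<delta>0 \<longrightarrow>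
    (\<integral>\<^sup>+x. indicator open_square x * ennreal \<bar>mollify u \<kappa> x - u x\<bar> \<partial>lborel) \<le> ennreal \<eta>"
proof -
  have um [measurable]: "u \<in> borel_measurable borel" using u by simp
  \<comment> \<open>A bounded neighbourhood that contains all points the averages over the square depend
      on.\<close>
  define V where "V = ball (0 :: real \<times> real) 3"
  have Vb [measurable]: "V \<in> sets borel" by (simp add: V_def)
  define N where "N = density lborel (indicator V :: _ \<Rightarrow> ennreal)"
  have sN [measurable_cong]: "sets N = sets borel" by (simp add: N_def)
  have "emeasure N (space N) = emeasure lborel V"
    by (simp add: N_def emeasure_density)
  also have "\<dots> < \<infinity>" unfolding V_def by (intro emeasure_bounded_finite) simp
  finally have "finite_measure N" by (intro finite_measureI) simp
  have nnN: "(\<integral>\<^sup>+x. f x \<partial>N) = (\<integral>\<^sup>+x. indicator V x * f x \<partial>lborel)" if "f \<in> borel_measurable borel" for f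
    unfolding N_def using that by (subst nn_integral_density) auto
  have "integrable N u"
    unfolding integrable_iff_bounded
  proof
    have "(\<integral>\<^sup>+x. ennreal (norm (u x)) \<partial>N) \<le> (\<integral>\<^sup>+x. ennreal (norm (u x)) \<partial>lborel)"
      by (subst nnN) (auto intro!: nn_integral_mono simp: indicator_def)
    also have "\<dots> < \<infinity>" using u by (simp add: integrable_iff_bounded)
    finally show "(\<integral>\<^sup>+x. ennreal (norm (u x)) \<partial>N) < \<infinity>" .
  qed simp
  from lipschitz_dense_in_L1[OF \<open>finite_measure N\<close> sN this] \<eta> obtain g L where
    g: "L-lipschitz_on UNIV g" and gi: "integrable N g" and gl: "(\<integral>x. \<bar>u x - g x\<bar> \<partial>N) < \<eta> / 3"
    by (metis divide_pos_pos zero_less_numeral)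
  have gm [measurable]: "g \<in> borel_measurable borel"
    using lipschitz_on_continuous_on[OF g] by (rule borel_measurable_continuous_onI)
  have L0: "L \<ge> 0" using g by (rule lipschitz_on_nonneg)
  have ug: "(\<integral>\<^sup>+x. indicator V x * ennreal \<bar>u x - g x\<bar> \<partial>lborel) \<le> ennreal (\<eta> / 3)"
  proof -
    have "(\<integral>\<^sup>+x. indicator V x * ennreal \<bar>u x - g x\<bar> \<partial>lborel) = (\<integral>\<^sup>+x. ennreal \<bar>u x - g x\<bar> \<partial>N)"
      by (rule nnN[symmetric]) measurable
    also have "\<dots> = ennreal (\<integral>x. \<bar>u x - g x\<bar> \<partial>N)"
      using \<open>integrable N u\<close> gi by (intro nn_integral_eq_integral) auto
    also have "\<dots> \<le> ennreal (\<eta> / 3)" using gl by (intro ennreal_leI) simp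
    finally show ?thesis .
  qed
  define \<delta>0 where "\<delta>0 = min 1 (\<eta> / (3 * (L + 1)))"
  have d0: "\<delta>0 > 0" "\<delta>0 \<le> 1" "L * \<delta>0 \<le> \<eta> / 3"
  proof -
    show "\<delta>0 > 0" "\<delta>0 \<le> 1" using \<eta> L0 by (auto simp: \<delta>0_def)
    have "L * \<delta>0 \<le> (L + 1) * (\<eta> / (3 * (L + 1)))"
      using L0 \<eta> by (intro mult_mono) (auto simp: \<delta>0_def)
    also have "\<dots> = \<eta> / 3" using L0 by (simp add: field_simps)
    finally show "L * \<delta>0 \<le> \<eta> / 3" .
  qed
  have sqV: "z \<in> V" if "x \<in> open_square" "norm (z - x) < 1" for x z
  proof -
    have "norm x \<le> \<bar>fst x\<bar> + \<bar>snd x\<bar>" using norm_Pair_le[of "fst x" "snd x"] by simp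
    also have "\<dots> \<le> 2" using that(1) by (auto simp: open_square_def)
    finally have "norm z < 3" using that(2) norm_triangle_ineq[of x "z - x"] by simp
    then show ?thesis by (simp add: V_def)
  qed
  show ?thesis
  proof (intro exI[of _ \<delta>0] conjI allI impI d0)
    fix \<kappa> \<delta> assume \<kappa>: "smoothing_kernel \<kappa> \<delta>" and \<delta>: "0 < \<delta>" "\<delta> \<le> \<delta>0"
    note [measurable] = smoothing_kernel_measurable[OF \<kappa>]
    let ?Q = "indicator open_square :: real \<times> real \<Rightarrow> ennreal"
    let ?I = "\<lambda>x. \<integral>\<^sup>+z. ennreal \<bar>u z - g z\<bar> * ennreal (\<kappa> (z - x)) \<partial>lborel"
    have "(\<integral>\<^sup>+x. ?Q x * ennreal \<bar>mollify u \<kappa> x - u x\<bar> \<partial>lborel)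
      \<le> (\<integral>\<^sup>+x. ?Q x * ?I x + ?Q x * ennreal (L * \<delta>) + indicator V x * ennreal \<bar>u x - g x\<bar> \<partial>lborel)"
    proof (rule nn_integral_mono)
      fix x
      show "?Q x * ennreal \<bar>mollify u \<kappa> x - u x\<bar> \<le> ?Q x * ?I x + ?Q x * ennreal (L * \<delta>) + indicator V x * ennreal \<bar>u x - g x\<bar>"
        using mollify_pointwise[OF u \<kappa> \<delta>(1) g, of x] sqV[of x x] by (cases "x \<in> open_square") auto
    qed
    also have "\<dots> = (\<integral>\<^sup>+x. ?Q x * ?I x \<partial>lborel) + (\<integral>\<^sup>+x. ?Q x * ennreal (L * \<delta>) \<partial>lborel) + (\<integral>\<^sup>+x. indicator V x * ennreal \<bar>u x - g x\<bar> \<partial>lborel)"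
      by (subst nn_integral_add, measurable, subst nn_integral_add, measurable)
    also have "\<dots> \<le> ennreal (\<eta> / 3) + ennreal (\<eta> / 3) + ennreal (\<eta> / 3)"
    proof (intro add_mono ug)
      have "(\<integral>\<^sup>+x. ?Q x * ?I x \<partial>lborel) \<le> (\<integral>\<^sup>+z. indicator V z * ennreal \<bar>u z - g z\<bar> \<partial>lborel)"
      proof (rule nn_integral_mollify_le[OF _ _ _ _ \<kappa>])
        show "?Q x * ennreal \<bar>u z - g z\<bar> \<le> indicator V z * ennreal \<bar>u z - g z\<bar>" if "norm (z - x) < \<delta>" for x z
          using sqV[of x z] that \<delta> d0(2) by (cases "x \<in> open_square") auto
      qed (auto simp: lborel.sigma_finite_measure_axioms)
      then show "(\<integral>\<^sup>+x. ?Q x * ?I x \<partial>lborel) \<le> ennreal (\<eta> / 3)" using ug by (rule order_trans)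
      have "(\<integral>\<^sup>+x. ?Q x * ennreal (L * \<delta>) \<partial>lborel) = ennreal (L * \<delta>)"
        by (subst nn_integral_multc) (auto simp: emeasure_open_square)
      also have "\<dots> \<le> ennreal (\<eta> / 3)"
        using mult_left_mono[OF \<delta>(2) L0] d0(3) by (intro ennreal_leI) simp
      finally show "(\<integral>\<^sup>+x. ?Q x * ennreal (L * \<delta>) \<partial>lborel) \<le> ennreal (\<eta> / 3)" .
    qed
    also have "\<dots> = ennreal \<eta>" using \<eta> by (simp flip: ennreal_plus)
    finally show "(\<integral>\<^sup>+x. ?Q x * ennreal \<bar>mollify u \<kappa> x - u x\<bar> \<partial>lborel) \<le> ennreal \<eta>" .
  qed
qed

text \<open>
The gradient of the average is at most the average of \<open>\<mu>\<close>. If the shifted kernel is a test function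
of the square this is the definition of the gradient measure; otherwise the kernel is so close to the
boundary of the square that it does not meet \<open>W\<close>, and the left-hand side vanishes.
\<close>

lemma mollified_gradient_bound:
  assumes grad: "has_gradient_measure u open_square \<sigma> \<mu>"
    and u0: "integrable lborel u0" "AE x in lebesgue_on open_square. u x = u0 x" "\<And>x. x \<notin> W \<Longrightarrow> u0 x = 0"
    and um: "u \<in> borel_measurable (lebesgue_on open_square)"
    and \<kappa>: "smoothing_kernel \<kappa> \<delta>"
    and sep: "\<And>x z. x \<in> W \<Longrightarrow> z \<notin> open_square \<Longrightarrow> 2 * \<delta> < norm (x - z)" and WU: "W \<subseteq> open_square"
  shows "ennreal (norm (mollify_deriv u0 \<kappa> (1, 0) x, mollify_deriv u0 \<kappa> (0, 1) x)) \<le> (\<integral>\<^sup>+z. ennreal (\<kappa> (z - x)) \<partial>\<mu>)"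
proof -
  note \<kappa>m [measurable] = smoothing_kernel_measurable[OF \<kappa>]
  have sm: "smooth \<kappa>" using \<kappa> by (simp add: smoothing_kernel_def)
  have nn: "0 \<le> \<kappa> z" for z using \<kappa> unfolding smoothing_kernel_def by blast
  have supp: "norm z < \<delta>" if "\<kappa> z \<noteq> 0" for z using that \<kappa> unfolding smoothing_kernel_def by blast
  have b2: "b \<in> (Basis :: (real \<times> real) set) \<longleftrightarrow> b = (1, 0) \<or> b = (0, 1)" for b by (auto simp: Basis_prod_def)
  define G where "G b = mollify_deriv u0 \<kappa> b x" for b
  show ?thesis
  proof (cases "cball x \<delta> \<subseteq> open_square")
    case True
    define \<phi> where "\<phi> z = \<kappa> (z - x)" for z
    have sub: "closure {z. \<phi> z \<noteq> 0} \<subseteq> cball x \<delta>"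
      by (rule closure_minimal) (auto simp: \<phi>_def dist_norm norm_minus_commute dest!: supp)
    have t: "\<phi> \<in> test_functions open_square"
      unfolding test_functions_def
    proof (intro CollectI conjI)
      show "smooth \<phi>" unfolding \<phi>_def by (rule smooth_shift[OF sm])
      show "compact (closure {z. \<phi> z \<noteq> 0})"
        using sub compact_cball by (metis closed_closure compact_Int_closed inf.absorb2)
    qed (use sub True in auto)
    have pd: "partial_deriv b \<phi> = (\<lambda>z. partial_deriv b \<kappa> (z - x))" for b
      unfolding \<phi>_def[abs_def] by (rule partial_deriv_shift)
    have fin: "finite_measure \<mu>" and s\<mu>: "sets \<mu> = sets (restrict_space borel open_square)"
      and \<sigma>m [measurable]: "\<sigma> \<in> borel_measurable \<mu>" and \<sigma>1: "AE x in \<mu>. norm (\<sigma> x) = 1"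
      and eq: "\<And>\<phi> b. \<phi> \<in> test_functions open_square \<Longrightarrow> b \<in> Basis \<Longrightarrow>
        (\<integral>x. u x * partial_deriv b \<phi> x \<partial>lebesgue_on open_square) = - (\<integral>x. \<phi> x * (\<sigma> x \<bullet> b) \<partial>\<mu>)"
      using grad unfolding has_gradient_measure_def by auto
    interpret finite_measure \<mu> by (rule fin)
    have \<phi>m [measurable]: "\<phi> \<in> borel_measurable \<mu>"
    proof -
      have "\<phi> \<in> borel_measurable borel" unfolding \<phi>_def by measurable
      then have "\<phi> \<in> borel_measurable (restrict_space borel open_square)" by (rule measurable_restrict_space1)
      then show ?thesis by (simp cong: measurable_cong_sets add: measurable_cong_sets[OF s\<mu> refl])
    qed
    obtain B where B: "\<And>z. \<bar>\<kappa> z\<bar> \<le> B"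
      using compact_support_bounded[OF smooth_continuous[OF sm] smoothing_kernel_compact[OF \<kappa>]] by metis
    have Gb: "G b = (\<integral>z. \<phi> z * (\<sigma> z \<bullet> b) \<partial>\<mu>)" if b: "b \<in> Basis" for b
    proof -
      have pm [measurable]: "partial_deriv b \<phi> \<in> borel_measurable borel"
        using smooth_continuous[OF smooth_partial_deriv[OF smooth_shift[OF sm] b]]
        unfolding \<phi>_def[abs_def] by (rule borel_measurable_continuous_onI)
      have u0m [measurable]: "u0 \<in> borel_measurable borel" using u0(1) by simp
      have "(\<integral>z. u0 z * partial_deriv b \<kappa> (z - x) \<partial>lborel) = (\<integral>z. indicator open_square z * (u0 z * partial_deriv b \<phi> z) \<partial>lborel)"
      proof (rule Bochner_Integration.integral_cong[OF refl])
        fix z show "u0 z * partial_deriv b \<kappa> (z - x) = indicator open_square z * (u0 z * partial_deriv b \<phi> z)"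
          using u0(3)[of z] WU by (cases "z \<in> open_square") (auto simp: pd)
      qed
      also have "\<dots> = (\<integral>z. u0 z * partial_deriv b \<phi> z \<partial>lebesgue_on open_square)"
        by (rule integral_open_square_lborel[symmetric]) (intro borel_measurable_times u0m pm)
      also have "\<dots> = (\<integral>z. u z * partial_deriv b \<phi> z \<partial>lebesgue_on open_square)"
      proof (rule integral_cong_AE)
        show "(\<lambda>z. u0 z * partial_deriv b \<phi> z) \<in> borel_measurable (lebesgue_on open_square)"
          by (rule borel_measurable_lebesgue_on_open_square) (intro borel_measurable_times u0m pm)
        show "(\<lambda>z. u z * partial_deriv b \<phi> z) \<in> borel_measurable (lebesgue_on open_square)"
          by (intro borel_measurable_times um borel_measurable_lebesgue_on_open_square pm)
        show "AE z in lebesgue_on open_square. u0 z * partial_deriv b \<phi> z = u z * partial_deriv b \<phi> z"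
          using u0(2) by eventually_elim simp
      qed
      also have "\<dots> = - (\<integral>z. \<phi> z * (\<sigma> z \<bullet> b) \<partial>\<mu>)" by (rule eq[OF t b])
      finally show ?thesis by (simp add: G_def mollify_deriv_def)
    qed
    have i\<phi>: "integrable \<mu> \<phi>" by (rule integrable_const_bound[of _ B]) (use B in \<open>auto simp: \<phi>_def\<close>)
    have ib: "integrable \<mu> (\<lambda>z. \<phi> z * (\<sigma> z \<bullet> b))" if b: "b \<in> Basis" for b
    proof (rule Bochner_Integration.integrable_bound[OF i\<phi>])
      show "AE z in \<mu>. norm (\<phi> z * (\<sigma> z \<bullet> b)) \<le> norm (\<phi> z)"
        using \<sigma>1
      proof eventually_elim
        case (elim z)
        then show ?case using Basis_le_norm[OF b, of "\<sigma> z"] by (simp add: abs_mult mult_left_le)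
      qed
    qed measurable
    define v where "v = (G (1, 0), G (0, 1))"
    have "norm v * norm v = G (1, 0) * G (1, 0) + G (0, 1) * G (0, 1)"
      by (simp add: v_def norm_Pair power2_eq_square flip: real_sqrt_mult)
    also have "\<dots> = G (1, 0) * (\<integral>z. \<phi> z * (\<sigma> z \<bullet> (1, 0)) \<partial>\<mu>) + G (0, 1) * (\<integral>z. \<phi> z * (\<sigma> z \<bullet> (0, 1)) \<partial>\<mu>)"
      using Gb[of "(1, 0)"] Gb[of "(0, 1)"] by (simp add: b2)
    also have "\<dots> = (\<integral>z. G (1, 0) * (\<phi> z * (\<sigma> z \<bullet> (1, 0))) + G (0, 1) * (\<phi> z * (\<sigma> z \<bullet> (0, 1))) \<partial>\<mu>)"
      using ib[of "(1, 0)"] ib[of "(0, 1)"] by (simp add: b2)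
    also have "\<dots> \<le> (\<integral>z. norm v * \<phi> z \<partial>\<mu>)"
    proof (rule integral_mono_AE)
      show "integrable \<mu> (\<lambda>z. G (1, 0) * (\<phi> z * (\<sigma> z \<bullet> (1, 0))) + G (0, 1) * (\<phi> z * (\<sigma> z \<bullet> (0, 1))))"
        using ib[of "(1, 0)"] ib[of "(0, 1)"] by (simp add: b2)
      show "AE z in \<mu>. G (1, 0) * (\<phi> z * (\<sigma> z \<bullet> (1, 0))) + G (0, 1) * (\<phi> z * (\<sigma> z \<bullet> (0, 1))) \<le> norm v * \<phi> z"
        using \<sigma>1
      proof eventually_elim
        case (elim z)
        have "G (1, 0) * (\<phi> z * (\<sigma> z \<bullet> (1, 0))) + G (0, 1) * (\<phi> z * (\<sigma> z \<bullet> (0, 1))) = \<phi> z * (v \<bullet> \<sigma> z)"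
          by (cases "\<sigma> z") (simp add: v_def inner_prod_def algebra_simps)
        also have "\<dots> \<le> \<phi> z * (norm v * norm (\<sigma> z))"
          using nn by (intro mult_left_mono norm_cauchy_schwarz) (auto simp: \<phi>_def)
        finally show ?case using elim by (simp add: mult.commute)
      qed
    qed (intro integrable_mult_right i\<phi>)
    also have "\<dots> = norm v * (\<integral>z. \<phi> z \<partial>\<mu>)" by simp
    finally have "norm v \<le> (\<integral>z. \<phi> z \<partial>\<mu>)"
      using nn by (cases "norm v = 0") (auto simp: \<phi>_def)
    then have "ennreal (norm v) \<le> ennreal (\<integral>z. \<phi> z \<partial>\<mu>)" by (rule ennreal_leI)
    also have "\<dots> = (\<integral>\<^sup>+z. ennreal (\<phi> z) \<partial>\<mu>)"
      using nn by (intro nn_integral_eq_integral[symmetric] i\<phi>) (auto simp: \<phi>_def)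
    finally show ?thesis by (simp add: v_def G_def \<phi>_def)
  next
    case False
    then obtain y where "y \<notin> open_square" "y \<in> cball x \<delta>" by blast
    then have y: "y \<notin> open_square" "norm (x - y) \<le> \<delta>" by (simp_all add: dist_norm)
    have "u0 z * partial_deriv b \<kappa> (z - x) = 0" for z b
    proof (cases "z \<in> W")
      case True
      have "2 * \<delta> < norm (z - y)" by (rule sep[OF True y(1)])
      also have "\<dots> \<le> norm (z - x) + norm (x - y)" using norm_triangle_ineq[of "z - x" "x - y"] by simp
      finally have "norm (z - x) > \<delta>" using y(2) by simp
      then have "z - x \<notin> cball 0 \<delta>" by simp
      moreover have "closure {z. \<kappa> z \<noteq> 0} \<subseteq> cball 0 \<delta>"
        by (rule closure_minimal) (auto dest!: supp)
      ultimately have "z - x \<notin> closure {z. \<kappa> z \<noteq> 0}" by blast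
      then show ?thesis using partial_deriv_outside_support[of "z - x" \<kappa> b] by simp
    qed (simp add: u0(3))
    then have "mollify_deriv u0 \<kappa> b x = 0" for b unfolding mollify_deriv_def by (simp only: integral_zero minus_zero)
    then show ?thesis by (simp add: norm_Pair)
  qed
qed

section \<open>Admissible directions and Lipschitz partitions of unity\<close>

text \<open>
Normalized distance functions to the complements of finitely many balls covering \<open>K\<close>.
\<close>

lemma lipschitz_partition_of_unity:
  fixes K :: "'a::euclidean_space set" and \<rho> :: "'a \<Rightarrow> real"
  assumes K: "compact K" and \<rho>: "\<And>x. x \<in> K \<Longrightarrow> \<rho> x > 0"
  obtains I \<zeta> L where "finite I" "I \<subseteq> K" "L \<ge> 0"
    "\<And>i x. 0 \<le> \<zeta> i x" "\<And>x. x \<in> K \<Longrightarrow> (\<Sum>i\<in>I. \<zeta> i x) = 1"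
    "\<And>i x. i \<in> I \<Longrightarrow> \<zeta> i x \<noteq> 0 \<Longrightarrow> x \<in> ball i (\<rho> i)"
    "\<And>i x y. i \<in> I \<Longrightarrow> x \<in> K \<Longrightarrow> y \<in> K \<Longrightarrow> \<bar>\<zeta> i x - \<zeta> i y\<bar> \<le> L * norm (x - y)"
    "\<And>i. i \<in> I \<Longrightarrow> \<zeta> i \<in> borel_measurable borel"
proof -
  have cov: "K \<subseteq> (\<Union>i\<in>K. ball i (\<rho> i))"
  proof
    fix x assume "x \<in> K"
    moreover have "x \<in> ball x (\<rho> x)" using \<rho>[OF \<open>x \<in> K\<close>] by simp
    ultimately show "x \<in> (\<Union>i\<in>K. ball i (\<rho> i))" by blast
  qed
  have op: "open (ball i (\<rho> i))" for i by simp
  obtain I where I: "I \<subseteq> K" "finite I" "K \<subseteq> (\<Union>i\<in>I. ball i (\<rho> i))"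
    by (rule compactE_image[OF K op cov])
  define \<psi> where "\<psi> i x = max 0 (\<rho> i - dist i x)" for i x
  define S where "S x = (\<Sum>i\<in>I. \<psi> i x)" for x
  have \<psi>0: "0 \<le> \<psi> i x" for i x by (simp add: \<psi>_def)
  have S0: "0 \<le> S x" for x by (simp add: S_def sum_nonneg \<psi>0)
  have \<psi>c: "continuous_on A (\<psi> i)" for A i unfolding \<psi>_def by (intro continuous_intros)
  have Sc: "continuous_on A S" for A unfolding S_def by (intro continuous_on_sum \<psi>c)
  have Spos: "S x > 0" if x: "x \<in> K" for x
  proof -
    obtain i where i: "i \<in> I" "x \<in> ball i (\<rho> i)" using I(3) x by blast
    then have "0 < \<psi> i x" by (simp add: \<psi>_def)
    also have "\<dots> \<le> S x" unfolding S_def using i I(2) by (intro member_le_sum) (auto simp: \<psi>0)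
    finally show ?thesis .
  qed
  have "\<exists>s>0. \<forall>x\<in>K. s \<le> S x"
  proof (cases "K = {}")
    case False
    from continuous_attains_inf[OF K False Sc] obtain x0 where "x0 \<in> K" "\<And>y. y \<in> K \<Longrightarrow> S x0 \<le> S y" by blast
    then show ?thesis using Spos by blast
  qed (auto intro: exI[of _ 1])
  then obtain s where s: "s > 0" "\<And>x. x \<in> K \<Longrightarrow> s \<le> S x" by blast
  define \<zeta> where "\<zeta> i x = \<psi> i x / S x" for i x
  have \<psi>l: "\<bar>\<psi> i x - \<psi> i y\<bar> \<le> norm (x - y)" for i x y
  proof -
    have "\<bar>dist i x - dist i y\<bar> \<le> dist x y" using dist_triangle[of i x y] dist_triangle[of i y x] by (simp add: dist_commute abs_le_iff)
    moreover have "\<bar>\<psi> i x - \<psi> i y\<bar> \<le> \<bar>dist i x - dist i y\<bar>" by (auto simp: \<psi>_def)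
    ultimately show ?thesis by (simp add: dist_norm)
  qed
  have Sl: "\<bar>S x - S y\<bar> \<le> real (card I) * norm (x - y)" for x y
  proof -
    have "\<bar>S x - S y\<bar> \<le> (\<Sum>i\<in>I. \<bar>\<psi> i x - \<psi> i y\<bar>)" unfolding S_def sum_subtractf[symmetric] by (rule sum_abs)
    also have "\<dots> \<le> real (card I) * norm (x - y)" by (rule sum_bounded_above) (rule \<psi>l)
    finally show ?thesis .
  qed
  have le1: "\<psi> i x \<le> S x" if "i \<in> I" for i x
    unfolding S_def using that I(2) by (intro member_le_sum) (auto simp: \<psi>0)
  define L where "L = (1 + real (card I)) / s"
  have lip: "\<bar>\<zeta> i x - \<zeta> i y\<bar> \<le> L * norm (x - y)" if i: "i \<in> I" and x: "x \<in> K" and y: "y \<in> K" for i x y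
  proof -
    have eq: "\<zeta> i x - \<zeta> i y = ((\<psi> i x - \<psi> i y) + \<zeta> i y * (S y - S x)) / S x"
      using Spos[OF x] Spos[OF y] by (simp add: \<zeta>_def field_simps)
    have z1: "0 \<le> \<zeta> i y" "\<zeta> i y \<le> 1" using le1[OF i, of y] Spos[OF y] \<psi>0[of i y] by (auto simp: \<zeta>_def divide_le_eq_1)
    have "\<bar>(\<psi> i x - \<psi> i y) + \<zeta> i y * (S y - S x)\<bar> \<le> \<bar>\<psi> i x - \<psi> i y\<bar> + \<bar>\<zeta> i y\<bar> * \<bar>S y - S x\<bar>"
      using abs_triangle_ineq[of "\<psi> i x - \<psi> i y" "\<zeta> i y * (S y - S x)"] by (simp only: abs_mult)
    also have "\<dots> \<le> norm (x - y) + 1 * (real (card I) * norm (x - y))"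
      using \<psi>l[of i x y] Sl[of y x] z1 by (intro add_mono mult_mono) (auto simp: norm_minus_commute)
    finally have "\<bar>(\<psi> i x - \<psi> i y) + \<zeta> i y * (S y - S x)\<bar> \<le> (1 + real (card I)) * norm (x - y)" by (simp add: algebra_simps)
    then have "\<bar>\<zeta> i x - \<zeta> i y\<bar> \<le> (1 + real (card I)) * norm (x - y) / S x"
      unfolding eq abs_divide using Spos[OF x] by (simp add: divide_right_mono)
    also have "\<dots> \<le> (1 + real (card I)) * norm (x - y) / s"
      using s(1) s(2)[OF x] by (intro divide_left_mono) (auto intro!: mult_nonneg_nonneg mult_pos_pos Spos x)
    finally show ?thesis by (simp add: L_def)
  qed
  show ?thesis
  proof (rule that[OF I(2,1), of L \<zeta>, OF _ _ _ _ lip])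
    show "L \<ge> 0" using s(1) by (simp add: L_def)
    show "0 \<le> \<zeta> i x" for i x by (simp add: \<zeta>_def \<psi>0 S0)
    show "(\<Sum>i\<in>I. \<zeta> i x) = 1" if "x \<in> K" for x
      using Spos[OF that] by (simp add: \<zeta>_def sum_divide_distrib[symmetric] S_def)
    show "x \<in> ball i (\<rho> i)" if "i \<in> I" "\<zeta> i x \<noteq> 0" for i x
      using that by (auto simp: \<zeta>_def \<psi>_def max_def split: if_splits)
    show "\<zeta> i \<in> borel_measurable borel" for i
      unfolding \<zeta>_def[abs_def] by (intro borel_measurable_divide borel_measurable_continuous_onI \<psi>c Sc)
  qed
qed

text \<open>
A vector close to \<open>\<epsilon> e2\<close> is steeper than every graph of Lipschitz constant \<open>L\<close>.
\<close>

lemma cone_step: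
  fixes e1 e2 v :: "real \<times> real"
  assumes e: "norm e1 = 1" "norm e2 = 1" "e1 \<bullet> e2 = 0" and L: "L \<ge> 0" and \<epsilon>: "\<epsilon> > 0"
    and v: "norm (v - \<epsilon> *\<^sub>R e2) < \<epsilon> / (1 + L)"
  shows "L * \<bar>v \<bullet> e1\<bar> < v \<bullet> e2" "norm v < 2 * \<epsilon>"
proof -
  have "e2 \<bullet> e1 = 0" using e(3) by (simp only: inner_commute)
  then have 1: "\<bar>v \<bullet> e1\<bar> \<le> norm (v - \<epsilon> *\<^sub>R e2)"
    using Cauchy_Schwarz_ineq2[of "v - \<epsilon> *\<^sub>R e2" e1] e by (simp add: inner_diff_left)
  have 2: "\<bar>v \<bullet> e2 - \<epsilon>\<bar> \<le> norm (v - \<epsilon> *\<^sub>R e2)"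
    using Cauchy_Schwarz_ineq2[of "v - \<epsilon> *\<^sub>R e2" e2] e by (simp add: inner_diff_left dot_square_norm)
  have "L * \<bar>v \<bullet> e1\<bar> \<le> L * norm (v - \<epsilon> *\<^sub>R e2)" using L 1 by (intro mult_left_mono)
  moreover have "(1 + L) * norm (v - \<epsilon> *\<^sub>R e2) < \<epsilon>" using v L by (simp add: field_simps)
  ultimately show "L * \<bar>v \<bullet> e1\<bar> < v \<bullet> e2" using 2 by (simp add: algebra_simps abs_le_iff)
  have "norm v \<le> norm (v - \<epsilon> *\<^sub>R e2) + norm (\<epsilon> *\<^sub>R e2)" using norm_triangle_ineq[of "v - \<epsilon> *\<^sub>R e2" "\<epsilon> *\<^sub>R e2"] by simp
  moreover have "\<epsilon> / (1 + L) \<le> \<epsilon>" using L \<epsilon> by (simp add: field_simps)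
  ultimately show "norm v < 2 * \<epsilon>" using v \<epsilon> e by simp
qed

text \<open>
From points near \<open>x\<close>, every step \<open>v\<close> close to a short multiple \<open>\<epsilon> \<tau>\<close> of the direction stays inside
\<open>S\<close> and stays outside \<open>W\<close>. The bound on \<open>norm v\<close> is included for convenience.
\<close>

definition admissible_direction :: "(real \<times> real) set \<Rightarrow> (real \<times> real) set \<Rightarrow> real \<times> real \<Rightarrow> real \<Rightarrow> real \<times> real \<Rightarrow> real \<Rightarrow> real \<Rightarrow> bool" where
  "admissible_direction S W x \<rho> \<tau> c \<epsilon>0 \<longleftrightarrow> \<rho> > 0 \<and> c > 0 \<and> \<epsilon>0 > 0 \<and>
     (\<forall>y\<in>ball x \<rho>. \<forall>\<epsilon>\<in>{0<..<\<epsilon>0}. \<forall>v. norm (v - \<epsilon> *\<^sub>R \<tau>) < \<epsilon> * c \<longrightarrow>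
        norm v < 2 * \<epsilon> \<and> (y \<in> S \<longrightarrow> y + v \<in> S) \<and> (y \<notin> W \<longrightarrow> y + v \<notin> W))"

lemma admissible_direction_interior:
  assumes r: "r > 0" and S: "ball x r \<subseteq> S \<or> ball x r \<inter> S = {}" and W: "ball x r \<subseteq> W \<or> ball x r \<inter> W = {}"
  shows "admissible_direction S W x (r/2) 0 1 (r/4)"
  unfolding admissible_direction_def
proof (intro conjI ballI allI impI)
  fix y v :: "real \<times> real" and \<epsilon> assume y: "y \<in> ball x (r/2)" and \<epsilon>: "\<epsilon> \<in> {0<..<r/4}" and v: "norm (v - \<epsilon> *\<^sub>R 0) < \<epsilon> * 1"
  show "norm v < 2 * \<epsilon>" using v \<epsilon> by simp
  have "dist x (y + v) \<le> dist x y + norm v" using dist_triangle[of x "y + v" y] by (simp add: dist_norm)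
  then have yv: "y + v \<in> ball x r" "y \<in> ball x r" using y v \<epsilon> by simp_all
  show "y + v \<in> S" if "y \<in> S" using S yv that by blast
  show "y + v \<notin> W" if "y \<notin> W" using W yv that by blast
qed (use r in auto)

text \<open>
Away from both boundaries every direction is admissible. At a boundary point of \<open>S\<close> one moves into
\<open>S\<close>, at a boundary point of \<open>W\<close> one moves out of \<open>W\<close>; by disjointness of the boundaries the other set
is locally constant there.
\<close>

lemma admissible_direction_exists:
  assumes S: "open S" "strongly_lipschitz S" and W: "open W" "strongly_lipschitz W"
    and SW: "S \<subseteq> W" and disj: "frontier S \<inter> frontier W = {}"
  shows "\<exists>\<rho> \<tau> c \<epsilon>0. admissible_direction S W x \<rho> \<tau> c \<epsilon>0"
proof -
  have side: "\<exists>r>0. ball x r \<subseteq> A \<or> ball x r \<inter> A = {}" if "x \<notin> frontier A" for A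
  proof (cases "x \<in> interior A")
    case True
    then show ?thesis by (auto simp: mem_interior)
  next
    case False
    with that have "x \<in> - closure A" by (auto simp: frontier_def)
    moreover have "open (- closure A)" by (rule open_Compl[OF closed_closure])
    ultimately obtain r where "r > 0" "ball x r \<subseteq> - closure A" by (meson openE)
    then show ?thesis using closure_subset[of A] by (intro exI[of _ r]) auto
  qed
  consider "x \<notin> frontier S" "x \<notin> frontier W" | "x \<in> frontier S" | "x \<in> frontier W" by blast
  then show ?thesis
  proof cases
    case 1
    obtain r1 where r1: "r1 > 0" "ball x r1 \<subseteq> S \<or> ball x r1 \<inter> S = {}" using side[OF 1(1)] by blast
    obtain r2 where r2: "r2 > 0" "ball x r2 \<subseteq> W \<or> ball x r2 \<inter> W = {}" using side[OF 1(2)] by blast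
    define r where "r = min r1 r2"
    have "ball x r \<subseteq> ball x r1" "ball x r \<subseteq> ball x r2" by (auto simp: r_def)
    then have "ball x r \<subseteq> S \<or> ball x r \<inter> S = {}" "ball x r \<subseteq> W \<or> ball x r \<inter> W = {}" using r1 r2 by blast+
    then have "admissible_direction S W x (r/2) 0 1 (r/4)" by (intro admissible_direction_interior) (use r1 r2 in \<open>auto simp: r_def\<close>)
    then show ?thesis by blast
  next
    case 2
    have "x \<in> closure W" using 2 closure_mono[OF SW] by (auto simp: frontier_def)
    then have "x \<in> W" using 2 disj W(1) by (auto simp: frontier_def interior_open)
    with W(1) obtain r1 where r1: "r1 > 0" "ball x r1 \<subseteq> W" by (rule openE)
    obtain e1 e2 g L r where chart: "lipschitz_chart S x e1 e2 g L r"
      using lipschitz_chart_exists[OF S(2) 2] by metis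
    note e = lipschitz_chartD(1-3)[OF chart] and g = lipschitz_chartD(4)[OF chart]
      and r = lipschitz_chartD(5)[OF chart] and ch = lipschitz_chartD(6)[OF chart]
    have L0: "L \<ge> 0" using g by (rule lipschitz_on_nonneg)
    define q where "q = min r r1"
    have q: "q > 0" "ball x q \<subseteq> ball x r" "ball x q \<subseteq> W" using r r1 by (auto simp: q_def)
    have "admissible_direction S W x (q/2) e2 (1 / (1 + L)) (q/4)"
      unfolding admissible_direction_def
    proof (intro conjI ballI allI impI)
      fix y \<epsilon> v assume y: "y \<in> ball x (q/2)" and \<epsilon>: "\<epsilon> \<in> {0<..<q/4}" and v: "norm (v - \<epsilon> *\<^sub>R e2) < \<epsilon> * (1 / (1 + L))"
      have v': "norm (v - \<epsilon> *\<^sub>R e2) < \<epsilon> / (1 + L)" using v by simp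
      have \<epsilon>0: "\<epsilon> > 0" using \<epsilon> by simp
      note cs = cone_step[OF e L0 \<epsilon>0 v']
      show "norm v < 2 * \<epsilon>" by (rule cs(2))
      have "dist x (y + v) \<le> dist x y + norm v" using dist_triangle[of x "y + v" y] by (simp add: dist_norm)
      then have yv: "y + v \<in> ball x q" "y \<in> ball x q" using y cs(2) \<epsilon> by simp_all
      show "y + v \<in> S" if "y \<in> S"
      proof -
        have "g ((y - x) \<bullet> e1) < (y - x) \<bullet> e2" using ch yv(2) q that by blast
        moreover have "\<bar>g ((y + v - x) \<bullet> e1) - g ((y - x) \<bullet> e1)\<bar> \<le> L * \<bar>v \<bullet> e1\<bar>"
          using lipschitz_onD[OF g, of "(y + v - x) \<bullet> e1" "(y - x) \<bullet> e1"] by (simp add: dist_real_def inner_add_left inner_diff_left)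
        ultimately have "g ((y + v - x) \<bullet> e1) < (y + v - x) \<bullet> e2"
          using cs(1) by (simp add: inner_add_left inner_diff_left abs_le_iff)
        then show ?thesis using ch yv(1) q by blast
      qed
      show "y + v \<notin> W" if "y \<notin> W" using yv(2) q(3) that by blast
    qed (use q L0 in \<open>auto intro!: divide_pos_pos\<close>)
    then show ?thesis by blast
  next
    case 3
    have "x \<notin> W" using 3 W(1) by (auto simp: frontier_def interior_open)
    then have "x \<notin> closure S" using 3 disj SW closure_Un_frontier[of S] by blast
    then have "x \<in> - closure S" by simp
    with open_Compl[OF closed_closure] obtain r1 where r1: "r1 > 0" "ball x r1 \<subseteq> - closure S" by (rule openE)
    then have r1S: "ball x r1 \<inter> S = {}" using closure_subset by blast
    obtain e1 e2 g L r where chart: "lipschitz_chart W x e1 e2 g L r"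
      using lipschitz_chart_exists[OF W(2) 3] by metis
    note e = lipschitz_chartD(1-3)[OF chart] and g = lipschitz_chartD(4)[OF chart]
      and r = lipschitz_chartD(5)[OF chart] and ch = lipschitz_chartD(6)[OF chart]
    have L0: "L \<ge> 0" using g by (rule lipschitz_on_nonneg)
    define q where "q = min r r1"
    have q: "q > 0" "ball x q \<subseteq> ball x r" "ball x q \<inter> S = {}" using r r1 r1S by (auto simp: q_def)
    have "admissible_direction S W x (q/2) (- e2) (1 / (1 + L)) (q/4)"
      unfolding admissible_direction_def
    proof (intro conjI ballI allI impI)
      fix y \<epsilon> v assume y: "y \<in> ball x (q/2)" and \<epsilon>: "\<epsilon> \<in> {0<..<q/4}" and v: "norm (v - \<epsilon> *\<^sub>R - e2) < \<epsilon> * (1 / (1 + L))"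
      have v': "norm (- v - \<epsilon> *\<^sub>R e2) < \<epsilon> / (1 + L)"
        using v norm_minus_cancel[of "v + \<epsilon> *\<^sub>R e2"] by simp
      have \<epsilon>0: "\<epsilon> > 0" using \<epsilon> by simp
      note cs = cone_step[OF e L0 \<epsilon>0 v']
      show nv: "norm v < 2 * \<epsilon>" using cs(2) by simp
      have "dist x (y + v) \<le> dist x y + norm v" using dist_triangle[of x "y + v" y] by (simp add: dist_norm)
      then have yv: "y + v \<in> ball x q" "y \<in> ball x q" using y nv \<epsilon> by simp_all
      show "y + v \<in> S" if "y \<in> S" using yv(2) q(3) that by blast
      show "y + v \<notin> W" if "y \<notin> W"
      proof -
        have "\<not> g ((y - x) \<bullet> e1) < (y - x) \<bullet> e2" using ch yv(2) q that by blast
        moreover have "\<bar>g ((y + v - x) \<bullet> e1) - g ((y - x) \<bullet> e1)\<bar> \<le> L * \<bar>v \<bullet> e1\<bar>"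
          using lipschitz_onD[OF g, of "(y + v - x) \<bullet> e1" "(y - x) \<bullet> e1"] by (simp add: dist_real_def inner_add_left inner_diff_left)
        ultimately have "\<not> g ((y + v - x) \<bullet> e1) < (y + v - x) \<bullet> e2"
          using cs(1) by (simp add: inner_add_left inner_diff_left abs_le_iff)
        then show ?thesis using ch yv(1) q by blast
      qed
    qed (use q L0 in \<open>auto intro!: divide_pos_pos\<close>)
    then show ?thesis by blast
  qed
qed

section \<open>Sampled mollifications\<close>

text \<open>
The consistency of the upwind energy with the isotropic gradient \<open>(g1, g2)\<close>.
\<close>

lemma norm_four_positive_parts_le:
  fixes r l t d g1 g2 e :: real
  assumes "0 \<le> r" "r \<le> max g1 0 + e" "0 \<le> l" "l \<le> max (- g1) 0 + e"
    "0 \<le> t" "t \<le> max g2 0 + e" "0 \<le> d" "d \<le> max (- g2) 0 + e" "0 \<le> e"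
  shows "norm (r, l, t, d) \<le> norm (g1, g2) + 2 * e"
proof -
  have sq: "(max g 0)\<^sup>2 + (max (- g) 0)\<^sup>2 = g\<^sup>2" for g :: real by (auto simp: max_def)
  have "norm (r, l, t, d) \<le> norm ((max g1 0, max (- g1) 0, max g2 0, max (- g2) 0) + (e, e, e, e))"
    using assms by (auto simp: norm_Pair intro!: real_sqrt_le_mono add_mono power_mono)
  also have "\<dots> \<le> norm (max g1 0, max (- g1) 0, max g2 0, max (- g2) 0) + norm (e, e, e, e)" by (rule norm_triangle_ineq)
  also have "norm (max g1 0, max (- g1) 0, max g2 0, max (- g2) 0) = norm (g1, g2)"
    using sq[of g1] sq[of g2] by (simp add: norm_Pair)
  also have "norm (e, e, e, e) = 2 * e"
  proof -
    have "norm (e, e, e, e) = sqrt ((2 * e)\<^sup>2)" by (simp add: norm_Pair power_mult_distrib)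
    then show ?thesis unfolding real_sqrt_abs using assms(9) by simp
  qed
  finally show ?thesis .
qed

text \<open>
The increment of a glued function \<open>\<Sum> \<zeta>\<^sub>i m\<^sub>i\<close> is that of the \<open>m\<^sub>i\<close>, averaged, plus a term with the
increments of the \<open>\<zeta>\<^sub>i\<close>. The latter sum to zero, so an arbitrary constant \<open>t\<close>, later the value of the
unmollified function, may be subtracted from the \<open>m\<^sub>i\<close>.
\<close>

lemma partition_increment_bound:
  fixes \<zeta> :: "'i \<Rightarrow> 'a::real_normed_vector \<Rightarrow> real"
  assumes I: "finite I" and z0: "\<And>i x. 0 \<le> \<zeta> i x" and z1: "\<And>x. x \<in> K \<Longrightarrow> (\<Sum>i\<in>I. \<zeta> i x) = 1"
    and zL: "\<And>i x y. i \<in> I \<Longrightarrow> x \<in> K \<Longrightarrow> y \<in> K \<Longrightarrow> \<bar>\<zeta> i x - \<zeta> i y\<bar> \<le> L * norm (x - y)" and L: "L \<ge> 0"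
    and C: "C \<ge> 0" and mL: "\<And>i x y. i \<in> I \<Longrightarrow> \<bar>m i x - m i y\<bar> \<le> C * norm (x - y)"
    and GC: "\<And>i. i \<in> I \<Longrightarrow> \<bar>G i\<bar> \<le> C"
    and mG: "\<And>i. i \<in> I \<Longrightarrow> \<bar>m i x' - m i x - h * G i\<bar> \<le> C * \<bar>h\<bar> * (norm (x - y) + \<bar>h\<bar>)"
    and K: "x \<in> K" "x' \<in> K" "y \<in> K" and s: "\<bar>h\<bar> = s" "norm (x' - x) \<le> s" "norm (x - y) \<le> 2 * s"
  shows "(\<Sum>i\<in>I. \<zeta> i x' * m i x') - (\<Sum>i\<in>I. \<zeta> i x * m i x)
    \<le> h * (\<Sum>i\<in>I. \<zeta> i y * G i) + s * (real (card I) * (C * (3 + 5 * L)) * s + L * (\<Sum>i\<in>I. \<bar>m i y - t\<bar>))"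
proof -
  have s0: "s \<ge> 0" using s(1) by simp
  have le1: "\<zeta> i x \<le> 1" if "i \<in> I" for i
    using member_le_sum[of i I "\<lambda>i. \<zeta> i x"] that I z0 z1[OF K(1)] by simp
  have each: "\<zeta> i x' * m i x' - \<zeta> i x * m i x - t * (\<zeta> i x' - \<zeta> i x)
     \<le> h * (\<zeta> i y * G i) + s * (C * (3 + 5 * L) * s + L * \<bar>m i y - t\<bar>)" if i: "i \<in> I" for i
  proof -
    have "\<zeta> i x' * m i x' - \<zeta> i x * m i x - t * (\<zeta> i x' - \<zeta> i x)
      = \<zeta> i x * (m i x' - m i x - h * G i) + h * G i * (\<zeta> i x - \<zeta> i y) + h * (\<zeta> i y * G i) + (\<zeta> i x' - \<zeta> i x) * (m i x' - t)"
      by (simp add: algebra_simps)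
    also have "\<dots> \<le> C * s * (3 * s) + s * C * (L * (2 * s)) + h * (\<zeta> i y * G i) + L * s * (C * (3 * s) + \<bar>m i y - t\<bar>)"
    proof (intro add_mono order_refl)
      have "\<bar>\<zeta> i x * (m i x' - m i x - h * G i)\<bar> \<le> 1 * (C * s * (3 * s))"
        unfolding abs_mult
      proof (rule mult_mono)
        have "C * \<bar>h\<bar> * (norm (x - y) + \<bar>h\<bar>) \<le> C * s * (3 * s)"
          using C s s0 by (intro mult_mono) auto
        then show "\<bar>m i x' - m i x - h * G i\<bar> \<le> C * s * (3 * s)" using mG[OF i] by linarith
      qed (use le1[OF i] z0[of i x] in auto)
      then show "\<zeta> i x * (m i x' - m i x - h * G i) \<le> C * s * (3 * s)" by linarith
      have "\<bar>h * G i * (\<zeta> i x - \<zeta> i y)\<bar> \<le> s * C * (L * (2 * s))"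
        unfolding abs_mult
      proof (intro mult_mono)
        have "L * norm (x - y) \<le> L * (2 * s)" using L s by (intro mult_left_mono)
        then show "\<bar>\<zeta> i x - \<zeta> i y\<bar> \<le> L * (2 * s)" using zL[OF i K(1,3)] by linarith
      qed (use s s0 C GC[OF i] in auto)
      then show "h * G i * (\<zeta> i x - \<zeta> i y) \<le> s * C * (L * (2 * s))" by linarith
      have "\<bar>(\<zeta> i x' - \<zeta> i x) * (m i x' - t)\<bar> \<le> L * s * (C * (3 * s) + \<bar>m i y - t\<bar>)"
        unfolding abs_mult
      proof (intro mult_mono)
        have "L * norm (x' - x) \<le> L * s" using L s by (intro mult_left_mono)
        then show "\<bar>\<zeta> i x' - \<zeta> i x\<bar> \<le> L * s" using zL[OF i K(2,1)] by linarith
        have "norm (x' - y) \<le> 3 * s" using norm_triangle_ineq[of "x' - x" "x - y"] s by simp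
        then have "C * norm (x' - y) \<le> C * (3 * s)" using C by (intro mult_left_mono)
        then show "\<bar>m i x' - t\<bar> \<le> C * (3 * s) + \<bar>m i y - t\<bar>" using mL[OF i, of x' y] by linarith
      qed (use L s0 in auto)
      then show "(\<zeta> i x' - \<zeta> i x) * (m i x' - t) \<le> L * s * (C * (3 * s) + \<bar>m i y - t\<bar>)" by linarith
    qed
    also have "\<dots> = h * (\<zeta> i y * G i) + s * (C * (3 + 5 * L) * s + L * \<bar>m i y - t\<bar>)" by (simp add: algebra_simps)
    finally show ?thesis .
  qed
  have "(\<Sum>i\<in>I. \<zeta> i x' * m i x') - (\<Sum>i\<in>I. \<zeta> i x * m i x)
     = (\<Sum>i\<in>I. \<zeta> i x' * m i x' - \<zeta> i x * m i x - t * (\<zeta> i x' - \<zeta> i x))"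
    using z1[OF K(1)] z1[OF K(2)] by (simp add: sum_subtractf flip: sum_distrib_left)
  also have "\<dots> \<le> (\<Sum>i\<in>I. h * (\<zeta> i y * G i) + s * (C * (3 + 5 * L) * s + L * \<bar>m i y - t\<bar>))"
    by (intro sum_mono each)
  also have "\<dots> = h * (\<Sum>i\<in>I. \<zeta> i y * G i) + s * (real (card I) * (C * (3 + 5 * L)) * s + L * (\<Sum>i\<in>I. \<bar>m i y - t\<bar>))"
    by (simp add: sum.distrib sum_distrib_left[symmetric] mult.assoc)
  finally show ?thesis .
qed

lemma sum_nn_integral_cells_le:
  assumes n: "n > 0" and F [measurable]: "F \<in> borel_measurable borel"
  shows "(\<Sum>p\<in>grid n. \<integral>\<^sup>+x. indicator (cell n p) x * F x \<partial>lborel) \<le> (\<integral>\<^sup>+x. indicator open_square x * F x \<partial>lborel)"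
proof -
  have "(\<Sum>p\<in>grid n. \<integral>\<^sup>+x. indicator (cell n p) x * F x \<partial>lborel) = (\<integral>\<^sup>+x. (\<Sum>p\<in>grid n. indicator (cell n p) x * F x) \<partial>lborel)"
    by (rule nn_integral_sum[symmetric]) measurable
  also have "\<dots> \<le> (\<integral>\<^sup>+x. indicator open_square x * F x \<partial>lborel)"
  proof (rule nn_integral_mono)
    fix x
    show "(\<Sum>p\<in>grid n. indicator (cell n p) x * F x) \<le> indicator open_square x * F x"
    proof (cases "\<exists>p\<in>grid n. x \<in> cell n p")
      case True
      then obtain p where p: "p \<in> grid n" "x \<in> cell n p" by blast
      have "(\<Sum>q\<in>grid n. indicator (cell n q) x * F x) = indicator (cell n p) x * F x + (\<Sum>q\<in>grid n - {p}. indicator (cell n q) x * F x)"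
        by (rule sum.remove) (use p in auto)
      also have "(\<Sum>q\<in>grid n - {p}. indicator (cell n q) x * F x) = 0"
      proof (rule sum.neutral, rule ballI)
        fix q assume "q \<in> grid n - {p}"
        then have "x \<notin> cell n q" using p(2) disjoint_cells[OF n, of x p q] by blast
        then show "indicator (cell n q) x * F x = 0" by simp
      qed
      finally show ?thesis using cell_subset_open_square[OF p(1)] p(2) by (auto simp only: indicator_simps(1) mult_1_left add_0_right subset_iff)
    next
      case False
      then have "(\<Sum>q\<in>grid n. indicator (cell n q) x * F x) = 0"
        by (intro sum.neutral ballI) (metis indicator_simps(2) mult_zero_left)
      then show ?thesis by (simp only: zero_le)
    qed
  qed
  finally show ?thesis .
qed

text \<open>
A Borel function on the plane that equals \<open>u\<close> almost everywhere on the square and satisfies the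
constraints at every point.
\<close>

lemma borel_representative:
  assumes u: "integrable (lebesgue_on open_square) u" and uC: "u \<in> constraint_set S W"
    and S: "open S" and W: "open W" and SW: "S \<subseteq> W" and WU: "W \<subseteq> open_square"
  obtains u0 where "integrable lborel u0" "AE x in lebesgue_on open_square. u x = u0 x"
    "\<And>x. x \<in> S \<Longrightarrow> u0 x = 1" "\<And>x. x \<notin> W \<Longrightarrow> u0 x = 0"
proof -
  have Sb [measurable]: "S \<in> sets borel" and Wb [measurable]: "W \<in> sets borel" using S W by (auto intro: borel_open)
  have om: "open_square \<inter> space lebesgue \<in> sets lebesgue" by simp
  have um: "u \<in> borel_measurable (lebesgue_on open_square)" using u by simp
  define v where "v x = (if x \<in> open_square then u x else 0)" for x
  have "v \<in> borel_measurable lebesgue"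
    using um unfolding v_def by (subst (asm) borel_measurable_if[symmetric]) simp_all
  then obtain u' where u' [measurable]: "u' \<in> borel_measurable lborel" and ae: "AE x in lborel. v x = u' x"
    using completion_ex_borel_measurable_real[of v lborel] by blast
  define u0 where "u0 x = (if x \<in> S then 1 else if x \<in> W then u' x else 0)" for x
  have u0m: "u0 \<in> borel_measurable borel" unfolding u0_def by measurable
  have ae': "AE x in lebesgue_on open_square. v x = u' x"
    using AE_completion[OF ae] om by (simp only: AE_restrict_space_iff) (auto elim: eventually_mono)
  have insq: "AE x in lebesgue_on open_square. x \<in> open_square"
    by (intro AE_I2) (simp add: space_restrict_space)
  have os: "open_square \<subseteq> closed_square" by (auto simp: open_square_def closed_square_def)
  have eq: "AE x in lebesgue_on open_square. u x = u0 x"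
    using ae' uC[unfolded constraint_set_def mem_Collect_eq] insq
  proof eventually_elim
    case (elim x)
    then show ?case using os by (auto simp: u0_def v_def)
  qed
  have "integrable (lebesgue_on open_square) u0"
    using integrable_cong_AE[OF um borel_measurable_lebesgue_on_open_square[OF u0m] eq] u by blast
  then have "integrable lebesgue (\<lambda>x. indicator open_square x *\<^sub>R u0 x)"
    using om by (subst (asm) integrable_restrict_space) auto
  moreover have "(\<lambda>x. indicator open_square x *\<^sub>R u0 x) = u0"
    using SW WU by (auto simp: u0_def indicator_def fun_eq_iff)
  ultimately have "integrable lborel u0" using u0m by (simp add: integrable_completion)
  then show ?thesis using eq SW by (intro that[of u0]) (auto simp: u0_def)
qed

text \<open>
The average of \<open>\<mu>\<close>, weighted by \<open>\<zeta>\<close>, has at most the mass of \<open>\<mu>\<close> weighted by \<open>\<zeta>\<close>, up to an error of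
the size of the kernel.
\<close>

lemma nn_integral_weighted_kernel_le:
  assumes \<mu>: "finite_measure \<mu>" "sets \<mu> = sets (restrict_space borel open_square)"
    and \<zeta>: "\<zeta> \<in> borel_measurable borel" "\<And>x. 0 \<le> \<zeta> x"
    and L: "\<And>x y. x \<in> open_square \<Longrightarrow> y \<in> open_square \<Longrightarrow> \<zeta> x \<le> \<zeta> y + L * norm (x - y)" "L \<ge> 0"
    and \<kappa>: "smoothing_kernel \<kappa> \<delta>" and \<delta>: "\<delta> > 0"
  shows "(\<integral>\<^sup>+x. indicator open_square x * (ennreal (\<zeta> x) * (\<integral>\<^sup>+z. ennreal (\<kappa> (z - x)) \<partial>\<mu>)) \<partial>lborel)
     \<le> (\<integral>\<^sup>+z. ennreal (\<zeta> z) \<partial>\<mu>) + ennreal (L * \<delta>) * emeasure \<mu> (space \<mu>)"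
proof -
  note [measurable] = smoothing_kernel_measurable[OF \<kappa>] \<zeta>(1)
  have sp: "space \<mu> = open_square" using sets_eq_imp_space_eq[OF \<mu>(2)] by (simp add: space_restrict_space)
  have idm: "(\<lambda>x. x) \<in> \<mu> \<rightarrow>\<^sub>M borel"
    unfolding measurable_cong_sets[OF \<mu>(2) refl] by (rule measurable_restrict_space1) simp
  define \<nu> where "\<nu> = distr \<mu> borel (\<lambda>x. x)"
  have [measurable_cong]: "sets \<nu> = sets borel" by (simp add: \<nu>_def)
  have "finite_measure \<nu>" unfolding \<nu>_def using \<mu>(1) idm by (intro finite_measure.finite_measure_distr)
  then have sf: "sigma_finite_measure \<nu>" by (rule finite_measure.axioms(1))
  have nn\<nu>: "(\<integral>\<^sup>+z. f z \<partial>\<nu>) = (\<integral>\<^sup>+z. f z \<partial>\<mu>)" if "f \<in> borel_measurable borel" for f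
    unfolding \<nu>_def using idm that by (subst nn_integral_distr) auto
  have "(\<integral>\<^sup>+x. indicator open_square x * (ennreal (\<zeta> x) * (\<integral>\<^sup>+z. ennreal (\<kappa> (z - x)) \<partial>\<mu>)) \<partial>lborel)
    = (\<integral>\<^sup>+x. (indicator open_square x * ennreal (\<zeta> x)) * (\<integral>\<^sup>+z. indicator open_square z * ennreal (\<kappa> (z - x)) \<partial>\<nu>) \<partial>lborel)"
  proof (rule nn_integral_cong)
    fix x
    have "(\<integral>\<^sup>+z. indicator open_square z * ennreal (\<kappa> (z - x)) \<partial>\<nu>) = (\<integral>\<^sup>+z. indicator open_square z * ennreal (\<kappa> (z - x)) \<partial>\<mu>)"
      by (rule nn\<nu>) measurable
    also have "\<dots> = (\<integral>\<^sup>+z. ennreal (\<kappa> (z - x)) \<partial>\<mu>)" by (rule nn_integral_cong) (simp add: sp)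
    finally show "indicator open_square x * (ennreal (\<zeta> x) * (\<integral>\<^sup>+z. ennreal (\<kappa> (z - x)) \<partial>\<mu>))
      = (indicator open_square x * ennreal (\<zeta> x)) * (\<integral>\<^sup>+z. indicator open_square z * ennreal (\<kappa> (z - x)) \<partial>\<nu>)"
      by (simp only: mult.assoc)
  qed
  also have "\<dots> \<le> (\<integral>\<^sup>+z. indicator open_square z * (ennreal (\<zeta> z) + ennreal (L * \<delta>)) \<partial>\<nu>)"
  proof (rule nn_integral_mollify_le[OF sf _ _ _ \<kappa>])
    fix x z :: "real \<times> real" assume zx: "norm (z - x) < \<delta>"
    show "indicator open_square x * ennreal (\<zeta> x) * indicator open_square z \<le> indicator open_square z * (ennreal (\<zeta> z) + ennreal (L * \<delta>))"
    proof (cases "x \<in> open_square \<and> z \<in> open_square")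
      case True
      have "L * norm (x - z) \<le> L * \<delta>" using L(2) zx by (intro mult_left_mono) (auto simp: norm_minus_commute)
      then have "\<zeta> x \<le> \<zeta> z + L * \<delta>" using L(1)[of x z] True by linarith
      then have "ennreal (\<zeta> x) \<le> ennreal (\<zeta> z + L * \<delta>)" by (rule ennreal_leI)
      also have "\<dots> = ennreal (\<zeta> z) + ennreal (L * \<delta>)" using \<zeta>(2)[of z] L(2) \<delta> by (intro ennreal_plus) auto
      finally have "ennreal (\<zeta> x) \<le> ennreal (\<zeta> z) + ennreal (L * \<delta>)" .
      then show ?thesis using True by simp
    next
      case False
      then show ?thesis by auto
    qed
  qed (simp_all add: \<nu>_def)
  also have "\<dots> = (\<integral>\<^sup>+z. indicator open_square z * (ennreal (\<zeta> z) + ennreal (L * \<delta>)) \<partial>\<mu>)" by (rule nn\<nu>) measurable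
  also have "\<dots> = (\<integral>\<^sup>+z. ennreal (\<zeta> z) + ennreal (L * \<delta>) \<partial>\<mu>)" by (rule nn_integral_cong) (simp add: sp)
  also have "\<dots> = (\<integral>\<^sup>+z. ennreal (\<zeta> z) \<partial>\<mu>) + ennreal (L * \<delta>) * emeasure \<mu> (space \<mu>)"
    using measurable_compose[OF idm, of "\<lambda>z. ennreal (\<zeta> z)" borel] by (subst nn_integral_add) auto
  finally show ?thesis .
qed

lemma borel_measurable_kernel_mass:
  assumes \<mu>: "finite_measure \<mu>" "sets \<mu> = sets (restrict_space borel open_square)" and \<kappa>: "smoothing_kernel \<kappa> \<delta>"
  shows "(\<lambda>x. \<integral>\<^sup>+z. ennreal (\<kappa> (z - x)) \<partial>\<mu>) \<in> borel_measurable borel"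
proof -
  note \<kappa>m = smoothing_kernel_measurable[OF \<kappa>]
  interpret sigma_finite_measure \<mu> using \<mu>(1) by (rule finite_measure.axioms(1))
  have idm: "(\<lambda>x. x) \<in> \<mu> \<rightarrow>\<^sub>M borel"
    unfolding measurable_cong_sets[OF \<mu>(2) refl] by (rule measurable_restrict_space1) simp
  have "(\<lambda>p. snd p - fst p) \<in> borel \<Otimes>\<^sub>M \<mu> \<rightarrow>\<^sub>M borel"
    by (intro borel_measurable_diff measurable_fst measurable_compose[OF measurable_snd idm])
  from measurable_compose[OF measurable_compose[OF this \<kappa>m] measurable_ennreal]
  have "(\<lambda>(x, z). ennreal (\<kappa> (z - x))) \<in> borel_measurable (borel \<Otimes>\<^sub>M \<mu>)" by (simp add: split_beta')
  then show ?thesis by (rule borel_measurable_nn_integral)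
qed

text \<open>
A Lipschitz partition of unity on the closed square and, at arbitrarily small scales, one kernel for
each of its members whose displacements respect both constraints on the support of that member.
\<close>

lemma admissible_kernels_exist:
  assumes S: "open S" "strongly_lipschitz S" and W: "open W" "strongly_lipschitz W"
    and SW: "S \<subseteq> W" and disj: "frontier S \<inter> frontier W = {}"
  obtains I :: "(real \<times> real) set" and \<zeta> L where "finite I" "L \<ge> 0"
    "\<And>i x. 0 \<le> \<zeta> i x" "\<And>x. x \<in> closed_square \<Longrightarrow> (\<Sum>i\<in>I. \<zeta> i x) = 1"
    "\<And>i x y. i \<in> I \<Longrightarrow> x \<in> closed_square \<Longrightarrow> y \<in> closed_square \<Longrightarrow> \<bar>\<zeta> i x - \<zeta> i y\<bar> \<le> L * norm (x - y)"
    "\<And>i. i \<in> I \<Longrightarrow> \<zeta> i \<in> borel_measurable borel"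
    "\<And>\<delta>0. \<delta>0 > (0::real) \<Longrightarrow> \<exists>\<delta> \<kappa>. 0 < \<delta> \<and> \<delta> \<le> \<delta>0 \<and> (\<forall>i\<in>I. smoothing_kernel (\<kappa> i) \<delta> \<and>
       (\<forall>x v. \<zeta> i x \<noteq> 0 \<longrightarrow> \<kappa> i v \<noteq> 0 \<longrightarrow> (x \<in> S \<longrightarrow> x + v \<in> S) \<and> (x \<notin> W \<longrightarrow> x + v \<notin> W)))"
proof -
  have "\<forall>x. \<exists>\<rho> \<tau> c \<epsilon>0. admissible_direction S W x \<rho> \<tau> c \<epsilon>0" using admissible_direction_exists[OF S W SW disj] by blast
  then obtain \<rho> \<tau> c \<epsilon>0 where gd: "\<And>x. admissible_direction S W x (\<rho> x) (\<tau> x) (c x) (\<epsilon>0 x)" by metis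
  have \<rho>0: "\<rho> x > 0" and c0: "c x > 0" and \<epsilon>00: "\<epsilon>0 x > 0" for x using gd[of x] by (auto simp: admissible_direction_def)
  have step: "norm v < 2 * \<epsilon>" "y \<in> S \<Longrightarrow> y + v \<in> S" "y \<notin> W \<Longrightarrow> y + v \<notin> W"
    if "y \<in> ball x (\<rho> x)" "0 < \<epsilon>" "\<epsilon> < \<epsilon>0 x" "norm (v - \<epsilon> *\<^sub>R \<tau> x) < \<epsilon> * c x" for x y \<epsilon> v
    using gd[of x] that unfolding admissible_direction_def by (meson greaterThanLessThan_iff)+
  have cK: "compact closed_square" unfolding closed_square_def by (intro compact_Times compact_Icc)
  obtain I \<zeta> L where I: "finite I" "I \<subseteq> closed_square" and L: "L \<ge> 0"
    and z: "\<And>i x. 0 \<le> \<zeta> i x" "\<And>x. x \<in> closed_square \<Longrightarrow> (\<Sum>i\<in>I. \<zeta> i x) = 1"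
    and zb: "\<And>i x. i \<in> I \<Longrightarrow> \<zeta> i x \<noteq> 0 \<Longrightarrow> x \<in> ball i (\<rho> i)"
    and zl: "\<And>i x y. i \<in> I \<Longrightarrow> x \<in> closed_square \<Longrightarrow> y \<in> closed_square \<Longrightarrow> \<bar>\<zeta> i x - \<zeta> i y\<bar> \<le> L * norm (x - y)"
    and zm: "\<And>i. i \<in> I \<Longrightarrow> \<zeta> i \<in> borel_measurable borel"
    by (rule lipschitz_partition_of_unity[OF cK, of \<rho>]) (use \<rho>0 in blast)+
  show ?thesis
  proof (rule that[OF I(1) L z zl zm])
    fix \<delta>0 :: real assume \<delta>0: "\<delta>0 > 0"
    define \<epsilon> where "\<epsilon> = Min (insert (\<delta>0 / 2) ((\<lambda>i. \<epsilon>0 i / 2) ` I))"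
    have \<epsilon>: "0 < \<epsilon>" "2 * \<epsilon> \<le> \<delta>0" "\<And>i. i \<in> I \<Longrightarrow> \<epsilon> < \<epsilon>0 i"
    proof -
      show "0 < \<epsilon>" unfolding \<epsilon>_def using I(1) \<delta>0 \<epsilon>00 by (subst Min_gr_iff) auto
      have "\<epsilon> \<le> \<delta>0 / 2" unfolding \<epsilon>_def using I(1) by (intro Min_le) auto
      then show "2 * \<epsilon> \<le> \<delta>0" by simp
      show "\<epsilon> < \<epsilon>0 i" if "i \<in> I" for i
      proof -
        have "\<epsilon> \<le> \<epsilon>0 i / 2" unfolding \<epsilon>_def using I(1) that by (intro Min_le) auto
        also have "\<dots> < \<epsilon>0 i" using \<epsilon>00[of i] by simp
        finally show ?thesis .
      qed
    qed
    have "\<exists>\<kappa>. smoothing_kernel \<kappa> (2 * \<epsilon>) \<and> (\<forall>v. \<kappa> v \<noteq> 0 \<longrightarrow> norm (v - \<epsilon> *\<^sub>R \<tau> i) < \<epsilon> * c i)" if i: "i \<in> I" for i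
    proof -
      have w: "\<epsilon> * c i > 0" using \<epsilon>(1) c0 by simp
      obtain \<kappa> where \<kappa>: "smooth \<kappa>" "\<And>z. 0 \<le> \<kappa> z"
        "\<And>z. \<kappa> z \<noteq> 0 \<Longrightarrow> norm (z - \<epsilon> *\<^sub>R \<tau> i) < \<epsilon> * c i"
        "integrable lborel \<kappa>" "(\<integral>z. \<kappa> z \<partial>lborel) = 1"
        using smooth_kernel_exists[OF w, of "\<epsilon> *\<^sub>R \<tau> i"] by metis
      have "norm z < 2 * \<epsilon>" if "\<kappa> z \<noteq> 0" for z
        by (rule step(1)[of i i, OF _ \<epsilon>(1) \<epsilon>(3)[OF i] \<kappa>(3)[OF that]]) (simp add: \<rho>0)
      then show ?thesis using \<kappa> unfolding smoothing_kernel_def by blast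
    qed
    then obtain \<kappa> where \<kappa>: "\<And>i. i \<in> I \<Longrightarrow> smoothing_kernel (\<kappa> i) (2 * \<epsilon>)"
      "\<And>i v. i \<in> I \<Longrightarrow> \<kappa> i v \<noteq> 0 \<Longrightarrow> norm (v - \<epsilon> *\<^sub>R \<tau> i) < \<epsilon> * c i" by metis
    show "\<exists>\<delta> \<kappa>. 0 < \<delta> \<and> \<delta> \<le> \<delta>0 \<and> (\<forall>i\<in>I. smoothing_kernel (\<kappa> i) \<delta> \<and>
       (\<forall>x v. \<zeta> i x \<noteq> 0 \<longrightarrow> \<kappa> i v \<noteq> 0 \<longrightarrow> (x \<in> S \<longrightarrow> x + v \<in> S) \<and> (x \<notin> W \<longrightarrow> x + v \<notin> W)))"
    proof (intro exI[of _ "2 * \<epsilon>"] exI[of _ \<kappa>] conjI ballI allI impI)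
      show "0 < 2 * \<epsilon>" "2 * \<epsilon> \<le> \<delta>0" using \<epsilon> by simp_all
      fix i assume i: "i \<in> I"
      show "smoothing_kernel (\<kappa> i) (2 * \<epsilon>)" by (rule \<kappa>(1)[OF i])
      fix x v assume "\<zeta> i x \<noteq> 0" "\<kappa> i v \<noteq> 0"
      note st = step(2,3)[OF zb[OF i \<open>\<zeta> i x \<noteq> 0\<close>] \<epsilon>(1) \<epsilon>(3)[OF i] \<kappa>(2)[OF i \<open>\<kappa> i v \<noteq> 0\<close>]]
      show "x + v \<in> S" if "x \<in> S" using st(1) that .
      show "x + v \<notin> W" if "x \<notin> W" using st(2) that .
    qed
  qed
qed

lemma mollify_const:
  assumes \<kappa>: "smoothing_kernel \<kappa> \<delta>" and c: "\<And>v. \<kappa> v \<noteq> 0 \<Longrightarrow> u (x + v) = c"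
  shows "mollify u \<kappa> x = c"
proof -
  have "u z * \<kappa> (z - x) = c * \<kappa> (z - x)" for z
    using c[of "z - x"] by (cases "\<kappa> (z - x) = 0") auto
  then have "mollify u \<kappa> x = (\<integral>z. c * \<kappa> (z - x) \<partial>lborel)" by (simp only: mollify_def)
  also have "\<dots> = c" using smoothing_kernel_mass(4)[OF \<kappa>] by simp
  finally show ?thesis .
qed

lemma cell_center_closed_square:
  assumes "n > 0" "0 \<le> fst p" "fst p \<le> int n" "0 \<le> snd p" "snd p \<le> int n"
  shows "cell_center n p \<in> closed_square"
  using assms by (auto simp: cell_center_def closed_square_def divide_le_eq_1)

text \<open>
Grid values vanish off the grid. The formula for the sampled function agrees with this default, since
the corresponding points are outside the open square.
\<close>

lemma cell_center_outside:
  assumes "n > 0" "p \<notin> grid n" shows "cell_center n p \<notin> open_square"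
proof
  assume "cell_center n p \<in> open_square"
  then have "0 < real_of_int (fst p)" "real_of_int (fst p) < real n" "0 < real_of_int (snd p)" "real_of_int (snd p) < real n"
    using assms(1) by (auto simp: cell_center_def open_square_def zero_less_divide_iff)
  then have "0 < fst p" "fst p < int n" "0 < snd p" "snd p < int n" by linarith+
  then show False using assms(2) by (cases p) (auto simp: grid_def)
qed

lemma nn_integral_lebesgue_on_open_square:
  assumes [measurable]: "f \<in> borel_measurable borel"
  shows "(\<integral>\<^sup>+x. f x \<partial>lebesgue_on open_square) = (\<integral>\<^sup>+x. indicator open_square x * f x \<partial>lborel)"
proof -
  have "open_square \<inter> space lebesgue \<in> sets lebesgue" by simp
  then have "(\<integral>\<^sup>+x. f x \<partial>lebesgue_on open_square) = (\<integral>\<^sup>+x. f x * indicator open_square x \<partial>lebesgue)"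
    by (rule nn_integral_restrict_space)
  also have "\<dots> = (\<integral>\<^sup>+x. f x * indicator open_square x \<partial>lborel)"
    by (rule nn_integral_completion) 
  finally show ?thesis by (simp only: mult.commute)
qed

text \<open>
The recovery construction at a fixed tolerance: the samples at the cell centres of the glued
mollification \<open>A\<close>, whose scale \<open>\<delta>\<close> depends on \<open>\<eta>\<close> only.
\<close>

lemma mollified_recovery:
  assumes S: "open S" "strongly_lipschitz S" and W: "open W" "strongly_lipschitz W"
    and SW: "S \<subseteq> W" and disj: "frontier S \<inter> frontier W = {}"
    and cW: "compact (closure W)" "closure W \<subseteq> open_square"
    and u: "integrable (lebesgue_on open_square) u" "u \<in> constraint_set S W"
    and grad: "has_gradient_measure u open_square \<sigma> \<mu>" and \<eta>: "\<eta> > (0 :: real)"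
  shows "\<forall>\<^sub>F n in sequentially. \<exists>w. integrable (lebesgue_on open_square) w \<and>
    (\<integral>x. \<bar>w x - u x\<bar> \<partial>lebesgue_on open_square) \<le> \<eta> \<and>
    discrete_TV n w \<le> emeasure \<mu> (space \<mu>) + ennreal \<eta> \<and>
    w \<in> constraint_set (inner_domain n S) (outer_domain n W)"
proof -
  have os: "open_square \<subseteq> closed_square" by (auto simp: open_square_def closed_square_def)
  have WU: "W \<subseteq> open_square" using closure_subset cW(2) by blast
  have fin: "finite_measure \<mu>" and s\<mu>: "sets \<mu> = sets (restrict_space borel open_square)"
    using grad by (auto simp: has_gradient_measure_def)
  interpret \<mu>: finite_measure \<mu> by (rule fin)
  have sp: "space \<mu> = open_square" using sets_eq_imp_space_eq[OF s\<mu>] by (simp add: space_restrict_space)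
  obtain u0 where u0: "integrable lborel u0" "AE x in lebesgue_on open_square. u x = u0 x"
    and u0S: "\<And>x. x \<in> S \<Longrightarrow> u0 x = 1" and u0W: "\<And>x. x \<notin> W \<Longrightarrow> u0 x = 0"
    by (rule borel_representative[OF u S(1) W(1) SW WU]) blast
  have u0m [measurable]: "u0 \<in> borel_measurable borel" using u0(1) by simp
  have um: "u \<in> borel_measurable (lebesgue_on open_square)" using u(1) by simp
  obtain I :: "(real \<times> real) set" and \<zeta> L where I: "finite I" and L: "L \<ge> 0"
    and z0: "\<And>i x. 0 \<le> \<zeta> i x" and z1: "\<And>x. x \<in> closed_square \<Longrightarrow> (\<Sum>i\<in>I. \<zeta> i x) = 1"
    and zL: "\<And>i x y. i \<in> I \<Longrightarrow> x \<in> closed_square \<Longrightarrow> y \<in> closed_square \<Longrightarrow> \<bar>\<zeta> i x - \<zeta> i y\<bar> \<le> L * norm (x - y)"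
    and zm: "\<And>i. i \<in> I \<Longrightarrow> \<zeta> i \<in> borel_measurable borel"
    and ker: "\<And>\<delta>0. \<delta>0 > (0::real) \<Longrightarrow> \<exists>\<delta> \<kappa>. 0 < \<delta> \<and> \<delta> \<le> \<delta>0 \<and> (\<forall>i\<in>I. smoothing_kernel (\<kappa> i) \<delta> \<and>
       (\<forall>x v. \<zeta> i x \<noteq> 0 \<longrightarrow> \<kappa> i v \<noteq> 0 \<longrightarrow> (x \<in> S \<longrightarrow> x + v \<in> S) \<and> (x \<notin> W \<longrightarrow> x + v \<notin> W)))"
    by (rule admissible_kernels_exist[OF S W SW disj]) blast
  obtain d where d: "d > 0" "\<And>x z. x \<in> W \<Longrightarrow> z \<notin> open_square \<Longrightarrow> d \<le> norm (x - z)"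
  proof -
    have "closure W \<inter> - open_square = {}" using cW(2) by blast
    then obtain d where "d > 0" "\<forall>x\<in>closure W. \<forall>y\<in>- open_square. d \<le> dist x y"
      using separate_compact_closed[OF cW(1) closed_Compl[OF open_open_square]] by blast
    then show ?thesis using closure_subset[of W] by (intro that[of d]) (auto simp: dist_norm)
  qed
  define N where "N = real (card I)"
  have N0: "N \<ge> 0" by (simp add: N_def)
  define M where "M = measure \<mu> (space \<mu>)"
  have M0: "M \<ge> 0" by (simp add: M_def)
  have emM: "emeasure \<mu> (space \<mu>) = ennreal M" by (simp add: M_def \<mu>.emeasure_eq_measure)
  have nz: "N + 1 \<noteq> 0" "L + 1 \<noteq> 0" "M + 1 \<noteq> 0" using N0 L M0 by auto
  define \<eta>1 where "\<eta>1 = \<eta> / (8 * (N + 1) * (L + 1))"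
  have e1: "\<eta>1 > 0" using \<eta> N0 L by (simp add: \<eta>1_def)
  \<comment> \<open>The total error of all mollifications has to be small, both by itself and multiplied by
      the Lipschitz constant of the partition.\<close>
  have e1': "N * \<eta>1 \<le> \<eta> / 2" "2 * (L * (N * \<eta>1)) \<le> \<eta> / 4"
  proof -
    have "N * \<eta>1 * (L + 1) \<le> (N + 1) * \<eta>1 * (L + 1)" using N0 e1 L by (intro mult_right_mono) auto
    also have "\<dots> = \<eta> / 8"
    proof -
      have "X * (\<eta> / (8 * X * Y)) * Y = \<eta> / 8" if "X \<noteq> 0" "Y \<noteq> 0" for X Y :: real using that by simp
      from this[OF nz(1,2)] show ?thesis by (simp only: \<eta>1_def)
    qed
    finally have *: "N * \<eta>1 * (L + 1) \<le> \<eta> / 8" .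
    have "0 \<le> N * \<eta>1 * L" using N0 e1 L by simp
    then show "N * \<eta>1 \<le> \<eta> / 2" using * \<eta> by (simp add: distrib_left)
    have "0 \<le> N * \<eta>1" using N0 e1 by simp
    then show "2 * (L * (N * \<eta>1)) \<le> \<eta> / 4" using * by (simp add: algebra_simps)
  qed
  obtain \<delta>1 where "\<delta>1 > 0 \<and> (\<forall>\<kappa> \<delta>. smoothing_kernel \<kappa> \<delta> \<longrightarrow> 0 < \<delta> \<longrightarrow> \<delta> \<le> \<delta>1 \<longrightarrow>
    (\<integral>\<^sup>+x. indicator open_square x * ennreal \<bar>mollify u0 \<kappa> x - u0 x\<bar> \<partial>lborel) \<le> ennreal \<eta>1)"
    using mollify_L1_convergence[OF u0(1) e1] by (elim exE)
  then have d1: "\<delta>1 > 0" "\<And>\<kappa> \<delta>. smoothing_kernel \<kappa> \<delta> \<Longrightarrow> 0 < \<delta> \<Longrightarrow> \<delta> \<le> \<delta>1 \<Longrightarrow>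
    (\<integral>\<^sup>+x. indicator open_square x * ennreal \<bar>mollify u0 \<kappa> x - u0 x\<bar> \<partial>lborel) \<le> ennreal \<eta>1"
    by simp_all
  \<comment> \<open>The scale must be small for \<open>L\<^sup>1\<close> convergence, for the distance of
      \<open>W\<close> to the boundary of the square, and for the variation of the
      \<open>\<zeta>\<^sub>i\<close> across a kernel.\<close>
  define \<delta>0 where "\<delta>0 = min (min \<delta>1 (d / 3)) (\<eta> / (4 * (N + 1) * (L + 1) * (M + 1)))"
  have d0: "\<delta>0 > 0" using d1(1) d(1) \<eta> N0 L M0 by (simp add: \<delta>0_def)
  obtain \<delta> \<kappa> where dk: "0 < \<delta> \<and> \<delta> \<le> \<delta>0 \<and> (\<forall>i\<in>I. smoothing_kernel (\<kappa> i) \<delta> \<and>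
       (\<forall>x v. \<zeta> i x \<noteq> 0 \<longrightarrow> \<kappa> i v \<noteq> 0 \<longrightarrow> (x \<in> S \<longrightarrow> x + v \<in> S) \<and> (x \<notin> W \<longrightarrow> x + v \<notin> W)))"
    using ker[OF d0] by (elim exE)
  then have \<delta>: "0 < \<delta>" "\<delta> \<le> \<delta>0" and \<kappa>: "\<And>i. i \<in> I \<Longrightarrow> smoothing_kernel (\<kappa> i) \<delta>"
    and \<kappa>S: "\<And>i x v. i \<in> I \<Longrightarrow> \<zeta> i x \<noteq> 0 \<Longrightarrow> \<kappa> i v \<noteq> 0 \<Longrightarrow> x \<in> S \<Longrightarrow> x + v \<in> S"
    and \<kappa>W: "\<And>i x v. i \<in> I \<Longrightarrow> \<zeta> i x \<noteq> 0 \<Longrightarrow> \<kappa> i v \<noteq> 0 \<Longrightarrow> x \<notin> W \<Longrightarrow> x + v \<notin> W"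
    by blast+
  have dd: "\<delta> \<le> \<delta>1" "2 * \<delta> < d" "N * (L * \<delta>) * M \<le> \<eta> / 4"
  proof -
    show "\<delta> \<le> \<delta>1" using \<delta>(2) by (simp add: \<delta>0_def)
    have "\<delta> \<le> d / 3" using \<delta>(2) by (simp add: \<delta>0_def)
    then show "2 * \<delta> < d" using d(1) by simp
    have "N * (L * \<delta>) * M \<le> (N + 1) * ((L + 1) * (\<eta> / (4 * (N + 1) * (L + 1) * (M + 1)))) * (M + 1)"
      using \<delta> N0 L M0 by (intro mult_mono mult_nonneg_nonneg) (auto simp: \<delta>0_def)
    also have "\<dots> = \<eta> / 4"
    proof -
      have "X * (Y * (\<eta> / (4 * X * Y * Z))) * Z = \<eta> / 4" if "X \<noteq> 0" "Y \<noteq> 0" "Z \<noteq> 0" for X Y Z :: real using that by simp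
      from this[OF nz] show ?thesis .
    qed
    finally show "N * (L * \<delta>) * M \<le> \<eta> / 4" .
  qed
  define m where "m i = mollify u0 (\<kappa> i)" for i
  define G where "G i b x = mollify_deriv u0 (\<kappa> i) b x" for i b x
  have mm [measurable]: "m i \<in> borel_measurable borel" if "i \<in> I" for i
    unfolding m_def by (rule borel_measurable_mollify[OF u0(1) \<kappa>[OF that]])
  have Gm [measurable]: "G i b \<in> borel_measurable borel" if "i \<in> I" "b \<in> Basis" for i b
    unfolding G_def[abs_def] by (rule borel_measurable_mollify_deriv[OF u0(1) \<kappa>[OF that(1)] that(2)])
  have "\<exists>C\<ge>0. (\<forall>x y. \<bar>m i x - m i y\<bar> \<le> C * norm (x - y)) \<and> (\<forall>b\<in>Basis. \<forall>x. \<bar>G i b x\<bar> \<le> C) \<and>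
      (\<forall>b\<in>Basis. \<forall>x y h. \<bar>m i (x + h *\<^sub>R b) - m i x - h * G i b y\<bar> \<le> C * \<bar>h\<bar> * (norm (x - y) + \<bar>h\<bar>))" if i: "i \<in> I" for i
    unfolding m_def G_def by (rule mollify_estimates[OF u0(1) \<kappa>[OF i]]) blast
  then have "\<exists>C. \<forall>i\<in>I. C i \<ge> 0 \<and> (\<forall>x y. \<bar>m i x - m i y\<bar> \<le> C i * norm (x - y)) \<and> (\<forall>b\<in>Basis. \<forall>x. \<bar>G i b x\<bar> \<le> C i) \<and>
      (\<forall>b\<in>Basis. \<forall>x y h. \<bar>m i (x + h *\<^sub>R b) - m i x - h * G i b y\<bar> \<le> C i * \<bar>h\<bar> * (norm (x - y) + \<bar>h\<bar>))"
    by (intro bchoice) blast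
  then obtain C0 where C0: "\<And>i. i \<in> I \<Longrightarrow> C0 i \<ge> 0" "\<And>i x y. i \<in> I \<Longrightarrow> \<bar>m i x - m i y\<bar> \<le> C0 i * norm (x - y)"
    "\<And>i b x. i \<in> I \<Longrightarrow> b \<in> Basis \<Longrightarrow> \<bar>G i b x\<bar> \<le> C0 i"
    "\<And>i b x y h. i \<in> I \<Longrightarrow> b \<in> Basis \<Longrightarrow> \<bar>m i (x + h *\<^sub>R b) - m i x - h * G i b y\<bar> \<le> C0 i * \<bar>h\<bar> * (norm (x - y) + \<bar>h\<bar>)"
    by blast
  define C where "C = (\<Sum>i\<in>I. C0 i)"
  have C: "C \<ge> 0" unfolding C_def by (rule sum_nonneg) (rule C0(1))
  have CC: "C0 i \<le> C" if "i \<in> I" for i unfolding C_def using that I C0(1) by (intro member_le_sum) auto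
  have mL: "\<bar>m i x - m i y\<bar> \<le> C * norm (x - y)" if "i \<in> I" for i x y
    using C0(2)[OF that, of x y] mult_right_mono[OF CC[OF that] norm_ge_zero[of "x - y"]] by linarith
  have GC: "\<bar>G i b x\<bar> \<le> C" if "i \<in> I" "b \<in> Basis" for i b x
    using C0(3)[OF that, of x] CC[OF that(1)] by linarith
  have mG: "\<bar>m i (x + h *\<^sub>R b) - m i x - h * G i b y\<bar> \<le> C * \<bar>h\<bar> * (norm (x - y) + \<bar>h\<bar>)" if "i \<in> I" "b \<in> Basis" for i b x y h
  proof -
    have "C0 i * \<bar>h\<bar> * (norm (x - y) + \<bar>h\<bar>) \<le> C * \<bar>h\<bar> * (norm (x - y) + \<bar>h\<bar>)"
      using CC[OF that(1)] by (intro mult_right_mono) auto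
    then show ?thesis using C0(4)[OF that, of x h y] by linarith
  qed
  define A where "A x = (\<Sum>i\<in>I. \<zeta> i x * m i x)" for x
  have AS: "A x = 1" if "x \<in> S" for x
  proof -
    have "\<zeta> i x * m i x = \<zeta> i x" if "i \<in> I" for i
      using mollify_const[OF \<kappa>[OF that], of u0 x 1] u0S \<kappa>S[OF that] \<open>x \<in> S\<close> by (cases "\<zeta> i x = 0") (auto simp: m_def)
    then have "A x = (\<Sum>i\<in>I. \<zeta> i x)" unfolding A_def by (intro sum.cong refl)
    also have "\<dots> = 1" by (rule z1) (use that SW WU os in blast)
    finally show ?thesis .
  qed
  have AW: "A x = 0" if "x \<notin> W" for x
  proof -
    have "\<zeta> i x * m i x = 0" if "i \<in> I" for i
      using mollify_const[OF \<kappa>[OF that], of u0 x 0] u0W \<kappa>W[OF that] \<open>x \<notin> W\<close> by (cases "\<zeta> i x = 0") (auto simp: m_def)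
    then show ?thesis unfolding A_def by (intro sum.neutral ballI)
  qed
  define D where "D y = (\<Sum>i\<in>I. \<bar>m i y - u0 y\<bar>)" for y
  have D0: "D y \<ge> 0" for y by (simp add: D_def sum_nonneg)
  have Dm [measurable]: "D \<in> borel_measurable borel" unfolding D_def[abs_def] using mm by measurable
  have Dint: "(\<integral>\<^sup>+x. indicator open_square x * ennreal (D x) \<partial>lborel) \<le> ennreal (N * \<eta>1)"
  proof -
    have "(\<integral>\<^sup>+x. indicator open_square x * ennreal (D x) \<partial>lborel)
      = (\<integral>\<^sup>+x. (\<Sum>i\<in>I. indicator open_square x * ennreal \<bar>m i x - u0 x\<bar>) \<partial>lborel)"
      by (intro nn_integral_cong) (simp only: D_def sum_distrib_left[symmetric] sum_ennreal[OF abs_ge_zero])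
    also have "\<dots> = (\<Sum>i\<in>I. \<integral>\<^sup>+x. indicator open_square x * ennreal \<bar>m i x - u0 x\<bar> \<partial>lborel)"
      by (rule nn_integral_sum) (use mm in measurable)
    also have "\<dots> \<le> (\<Sum>i\<in>I. ennreal \<eta>1)"
      unfolding m_def by (intro sum_mono d1(2)[OF \<kappa> \<delta>(1) dd(1)])
    also have "\<dots> = ennreal (N * \<eta>1)" using e1 by (simp add: N_def ennreal_mult ennreal_of_nat_eq_real_of_nat)
    finally show ?thesis .
  qed
  \<comment> \<open>The main part of the gradient of \<open>A\<close>; the part with derivatives of the
      \<open>\<zeta>\<^sub>i\<close> is controlled by \<open>D\<close>.\<close>
  define g where "g b y = (\<Sum>i\<in>I. \<zeta> i y * G i b y)" for b y
  have gm [measurable]: "g b \<in> borel_measurable borel" if "b \<in> Basis" for b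
    unfolding g_def[abs_def] using zm Gm[OF _ that] by measurable
  define \<gamma> where "\<gamma> y = norm (g (1, 0) y, g (0, 1) y)" for y
  have b10: "(1, 0) \<in> (Basis :: (real \<times> real) set)" and b01: "(0, 1) \<in> (Basis :: (real \<times> real) set)" by (auto simp: Basis_prod_def)
  have \<gamma>m [measurable]: "\<gamma> \<in> borel_measurable borel"
    unfolding \<gamma>_def[abs_def] using gm[OF b10] gm[OF b01] by measurable
  have \<gamma>int: "(\<integral>\<^sup>+x. indicator open_square x * ennreal (\<gamma> x) \<partial>lborel) \<le> ennreal (M + \<eta> / 4)"
  proof -
    have pt: "ennreal (\<gamma> x) \<le> (\<Sum>i\<in>I. ennreal (\<zeta> i x) * (\<integral>\<^sup>+z. ennreal (\<kappa> i (z - x)) \<partial>\<mu>))" for x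
    proof -
      have "(g (1, 0) x, g (0, 1) x) = (\<Sum>i\<in>I. \<zeta> i x *\<^sub>R (G i (1, 0) x, G i (0, 1) x))"
        by (simp add: g_def sum_prod scaleR_prod_def)
      then have "\<gamma> x \<le> (\<Sum>i\<in>I. \<zeta> i x * norm (G i (1, 0) x, G i (0, 1) x))"
        unfolding \<gamma>_def using sum_norm_le[of I "\<lambda>i. \<zeta> i x *\<^sub>R (G i (1, 0) x, G i (0, 1) x)" "\<lambda>i. \<zeta> i x * norm (G i (1, 0) x, G i (0, 1) x)"] z0
        by (simp only: norm_scaleR abs_of_nonneg[OF z0] order_refl)
      then have "ennreal (\<gamma> x) \<le> (\<Sum>i\<in>I. ennreal (\<zeta> i x * norm (G i (1, 0) x, G i (0, 1) x)))"
        using z0 by (subst sum_ennreal) (auto intro: ennreal_leI)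
      also have "\<dots> \<le> (\<Sum>i\<in>I. ennreal (\<zeta> i x) * (\<integral>\<^sup>+z. ennreal (\<kappa> i (z - x)) \<partial>\<mu>))"
      proof (rule sum_mono)
        fix i assume i: "i \<in> I"
        have "ennreal (norm (G i (1, 0) x, G i (0, 1) x)) \<le> (\<integral>\<^sup>+z. ennreal (\<kappa> i (z - x)) \<partial>\<mu>)"
          unfolding G_def
          by (rule mollified_gradient_bound[OF grad u0 u0W um \<kappa>[OF i] _ WU]) (assumption | rule less_le_trans[OF dd(2) d(2)])+
        then show "ennreal (\<zeta> i x * norm (G i (1, 0) x, G i (0, 1) x)) \<le> ennreal (\<zeta> i x) * (\<integral>\<^sup>+z. ennreal (\<kappa> i (z - x)) \<partial>\<mu>)"
          using z0 by (subst ennreal_mult) (auto intro: mult_left_mono)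
      qed
      finally show ?thesis .
    qed
    note [measurable] = smoothing_kernel_measurable[OF \<kappa>] zm
    have "(\<integral>\<^sup>+x. indicator open_square x * ennreal (\<gamma> x) \<partial>lborel)
      \<le> (\<integral>\<^sup>+x. (\<Sum>i\<in>I. indicator open_square x * (ennreal (\<zeta> i x) * (\<integral>\<^sup>+z. ennreal (\<kappa> i (z - x)) \<partial>\<mu>))) \<partial>lborel)"
      by (intro nn_integral_mono) (simp only: sum_distrib_left[symmetric] mult_left_mono[OF pt zero_le])
    also have "\<dots> = (\<Sum>i\<in>I. \<integral>\<^sup>+x. indicator open_square x * (ennreal (\<zeta> i x) * (\<integral>\<^sup>+z. ennreal (\<kappa> i (z - x)) \<partial>\<mu>)) \<partial>lborel)"
      by (rule nn_integral_sum)
        (intro borel_measurable_times_ennreal borel_measurable_indicator measurable_compose[OF zm measurable_ennreal]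
          borel_measurable_kernel_mass[OF fin s\<mu> \<kappa>] | simp)+
    also have "\<dots> \<le> (\<Sum>i\<in>I. (\<integral>\<^sup>+z. ennreal (\<zeta> i z) \<partial>\<mu>) + ennreal (L * \<delta>) * emeasure \<mu> (space \<mu>))"
    proof (rule sum_mono)
      fix i assume i: "i \<in> I"
      show "(\<integral>\<^sup>+x. indicator open_square x * (ennreal (\<zeta> i x) * (\<integral>\<^sup>+z. ennreal (\<kappa> i (z - x)) \<partial>\<mu>)) \<partial>lborel)
         \<le> (\<integral>\<^sup>+z. ennreal (\<zeta> i z) \<partial>\<mu>) + ennreal (L * \<delta>) * emeasure \<mu> (space \<mu>)"
      proof (rule nn_integral_weighted_kernel_le[OF fin s\<mu> zm[OF i] z0 _ L \<kappa>[OF i] \<delta>(1)])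
        fix x y assume "x \<in> open_square" "y \<in> open_square"
        then have "x \<in> closed_square" "y \<in> closed_square" using os by blast+
        from zL[OF i this] show "\<zeta> i x \<le> \<zeta> i y + L * norm (x - y)" by linarith
      qed
    qed
    also have "\<dots> = (\<Sum>i\<in>I. \<integral>\<^sup>+z. ennreal (\<zeta> i z) \<partial>\<mu>) + (\<Sum>i\<in>I. ennreal (L * \<delta>) * emeasure \<mu> (space \<mu>))" by (rule sum.distrib)
    also have "(\<Sum>i\<in>I. \<integral>\<^sup>+z. ennreal (\<zeta> i z) \<partial>\<mu>) = (\<integral>\<^sup>+z. (\<Sum>i\<in>I. ennreal (\<zeta> i z)) \<partial>\<mu>)"
    proof (rule nn_integral_sum[symmetric])
      fix i assume i: "i \<in> I"
      have "\<zeta> i \<in> borel_measurable \<mu>"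
        unfolding measurable_cong_sets[OF s\<mu> refl] by (rule measurable_restrict_space1) (rule zm[OF i])
      then show "(\<lambda>z. ennreal (\<zeta> i z)) \<in> borel_measurable \<mu>" by simp
    qed
    also have "\<dots> = (\<integral>\<^sup>+z. 1 \<partial>\<mu>)"
    proof (rule nn_integral_cong)
      fix z assume "z \<in> space \<mu>"
      then have "z \<in> closed_square" using sp os by blast
      then show "(\<Sum>i\<in>I. ennreal (\<zeta> i z)) = 1" by (subst sum_ennreal) (simp_all add: z0 z1)
    qed
    also have "\<dots> = ennreal M" by (simp add: emM)
    also have "(\<Sum>i\<in>I. ennreal (L * \<delta>) * emeasure \<mu> (space \<mu>)) = ennreal (N * (L * \<delta>) * M)"
      using L \<delta>(1) M0 by (simp add: emM N_def ennreal_mult[symmetric] ennreal_of_nat_eq_real_of_nat mult.assoc)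
    also have "ennreal M + ennreal (N * (L * \<delta>) * M) = ennreal (M + N * (L * \<delta>) * M)"
      using M0 N0 L \<delta>(1) by (intro ennreal_plus[symmetric]) auto
    also have "\<dots> \<le> ennreal (M + \<eta> / 4)" using dd(3) by (intro ennreal_leI) simp
    finally show ?thesis .
  qed
  define K where "K = N * (C * (3 + 5 * L))"
  have K0: "K \<ge> 0" using N0 C L by (simp add: K_def)
  have big: "\<forall>\<^sub>F n in sequentially. real n > R" for R
    using filterlim_at_top_dense[of real sequentially] filterlim_real_sequentially by blast
  show ?thesis
    using big[of 0] big[of "8 * K / \<eta>"] big[of "4 * N * C / \<eta>"] big[of "2 / d"]
  proof eventually_elim
    case (elim n)
    then have n: "n > 0" by simp
    \<comment> \<open>From here on the kernels are fixed, so the constants \<open>K\<close> and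
        \<open>C\<close> do not depend on \<open>n\<close>.\<close>
    have nK: "2 * (K / real n) \<le> \<eta> / 4" and nC: "N * (C * (2 / real n)) \<le> \<eta> / 2" and nd: "2 / real n < d"
      using elim \<eta> d(1) n by (simp_all add: field_simps)
    define a where "a p = (if p \<in> grid n then A (cell_center n p) else 0)" for p
    have aA: "a p = A (cell_center n p)" for p
    proof (cases "p \<in> grid n")
      case False
      then have "cell_center n p \<notin> W" using cell_center_outside[OF n False] WU by blast
      then show ?thesis using False by (simp add: a_def AW)
    qed (simp add: a_def)
    define w where "w x = (\<Sum>p\<in>grid n. a p * indicat_real (cell n p) x)" for x
    have wm: "w \<in> borel_measurable borel" unfolding w_def[abs_def] by measurable
    have wp: "w x = a p" if "p \<in> grid n" "x \<in> cell n p" for x p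
      unfolding w_def by (rule sum_cells_value[OF n that])
    have wi: "integrable (lebesgue_on open_square) w"
      unfolding w_def[abs_def]
    proof (intro Bochner_Integration.integrable_sum integrable_mult_right)
      fix p
      show "integrable (lebesgue_on open_square) (indicat_real (cell n p))"
        by (rule integrable_on_open_square_bounded[of _ 1], rule borel_measurable_lebesgue_on_open_square) (auto simp: indicator_def)
    qed
    have "grid_values n a w" by (simp add: grid_values_def a_def w_def)
    then have TVle: "discrete_TV n w \<le> ennreal (1 / real n * (\<Sum>p\<in>grid n. norm (positive_parts (discrete_gradient a p))))"
      unfolding discrete_TV_def by (intro Inf_lower) blast
    define e where "e y = K / real n + L * D y" for y
    have e0: "e y \<ge> 0" for y using K0 L D0[of y] by (simp add: e_def)
    have em [measurable]: "e \<in> borel_measurable borel" unfolding e_def[abs_def] by measurable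
    \<comment> \<open>The sampled energy at \<open>p\<close> is bounded pointwise on the whole cell, so that
        it can be integrated over the cell.\<close>
    have cellbound: "real n * norm (positive_parts (discrete_gradient a p)) \<le> \<gamma> y + 2 * e y"
      if p: "p \<in> grid n" and y: "y \<in> cell n p" for p y
    proof -
      obtain i j where pij: "p = (i, j)" by (cases p)
      have ij: "1 \<le> i" "i \<le> int n - 1" "1 \<le> j" "j \<le> int n - 1" using p by (auto simp: pij grid_def)
      have yc: "y \<in> closed_square" using cell_subset_open_square[OF p] y os by blast
      have xc: "cell_center n p \<in> closed_square" using ij by (intro cell_center_closed_square n) (auto simp: pij)
      have ny: "norm (cell_center n p - y) \<le> 2 * (1 / real n)"
        using dist_in_cell[OF n cell_center_in_cell[OF n] y] by simp
      have step: "a q - a p \<le> h * g b y + (1 / real n) * e y"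
        if q: "cell_center n q = cell_center n p + h *\<^sub>R b" "cell_center n q \<in> closed_square" and h: "\<bar>h\<bar> = 1 / real n" and b: "b \<in> Basis" for q h b
      proof -
        have "(\<Sum>i\<in>I. \<zeta> i (cell_center n q) * m i (cell_center n q)) - (\<Sum>i\<in>I. \<zeta> i (cell_center n p) * m i (cell_center n p))
          \<le> h * (\<Sum>i\<in>I. \<zeta> i y * G i b y) + 1 / real n * (real (card I) * (C * (3 + 5 * L)) * (1 / real n) + L * (\<Sum>i\<in>I. \<bar>m i y - u0 y\<bar>))"
        proof (rule partition_increment_bound[OF I z0 z1 zL L C mL GC[OF _ b] _ xc q(2) yc h _ ny])
          show "\<bar>m i (cell_center n q) - m i (cell_center n p) - h * G i b y\<bar> \<le> C * \<bar>h\<bar> * (norm (cell_center n p - y) + \<bar>h\<bar>)" if "i \<in> I" for i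
            unfolding q(1) by (rule mG[OF that b])
          show "norm (cell_center n q - cell_center n p) \<le> 1 / real n" unfolding q(1) using h b by simp
        qed
        then show ?thesis unfolding aA A_def g_def e_def D_def K_def N_def by simp
      qed
      have pos: "real n * max (a q - a p) 0 \<le> max s 0 + e y" if "a q - a p \<le> (1 / real n) * s + (1 / real n) * e y" for q s
      proof -
        have "real n * (a q - a p) \<le> s + e y" using that n by (simp add: field_simps)
        then show ?thesis using e0[of y] n by (auto simp: max_def)
      qed
      have nb: "cell_center n q \<in> closed_square" if "q \<in> {(i + 1, j), (i - 1, j), (i, j + 1), (i, j - 1)}" for q
        using that ij by (intro cell_center_closed_square n) auto
      have sh: "cell_center n (i + 1, j) = cell_center n p + (1 / real n) *\<^sub>R (1, 0)"
        "cell_center n (i - 1, j) = cell_center n p + (- 1 / real n) *\<^sub>R (1, 0)"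
        "cell_center n (i, j + 1) = cell_center n p + (1 / real n) *\<^sub>R (0, 1)"
        "cell_center n (i, j - 1) = cell_center n p + (- 1 / real n) *\<^sub>R (0, 1)"
        by (simp_all add: pij cell_center_def add_divide_distrib diff_divide_distrib)
      have st1: "real n * max (a (i + 1, j) - a p) 0 \<le> max (g (1, 0) y) 0 + e y"
      proof (rule pos)
        have "a (i + 1, j) - a p \<le> (1 / real n) * g (1, 0) y + (1 / real n) * e y"
          by (rule step[OF sh(1) nb _ b10]) simp_all
        then show "a (i + 1, j) - a p \<le> (1 / real n) * (g (1, 0) y) + (1 / real n) * e y" by simp
      qed
      have st2: "real n * max (a (i - 1, j) - a p) 0 \<le> max (- g (1, 0) y) 0 + e y"
      proof (rule pos)
        have "a (i - 1, j) - a p \<le> (- 1 / real n) * g (1, 0) y + (1 / real n) * e y"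
          by (rule step[OF sh(2) nb _ b10]) simp_all
        then show "a (i - 1, j) - a p \<le> (1 / real n) * (- g (1, 0) y) + (1 / real n) * e y" by simp
      qed
      have st3: "real n * max (a (i, j + 1) - a p) 0 \<le> max (g (0, 1) y) 0 + e y"
      proof (rule pos)
        have "a (i, j + 1) - a p \<le> (1 / real n) * g (0, 1) y + (1 / real n) * e y"
          by (rule step[OF sh(3) nb _ b01]) simp_all
        then show "a (i, j + 1) - a p \<le> (1 / real n) * (g (0, 1) y) + (1 / real n) * e y" by simp
      qed
      have st4: "real n * max (a (i, j - 1) - a p) 0 \<le> max (- g (0, 1) y) 0 + e y"
      proof (rule pos)
        have "a (i, j - 1) - a p \<le> (- 1 / real n) * g (0, 1) y + (1 / real n) * e y"
          by (rule step[OF sh(4) nb _ b01]) simp_all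
        then show "a (i, j - 1) - a p \<le> (1 / real n) * (- g (0, 1) y) + (1 / real n) * e y" by simp
      qed
      have "real n * norm (positive_parts (discrete_gradient a p)) = norm (real n *\<^sub>R positive_parts (discrete_gradient a p))" by simp
      also have "real n *\<^sub>R positive_parts (discrete_gradient a p) = (real n * max (a (i + 1, j) - a p) 0, real n * max (a (i - 1, j) - a p) 0,
          real n * max (a (i, j + 1) - a p) 0, real n * max (a (i, j - 1) - a p) 0)"
        by (simp add: pij discrete_gradient_def positive_parts_def)
      also have "norm \<dots> \<le> norm (g (1, 0) y, g (0, 1) y) + 2 * e y"
        by (rule norm_four_positive_parts_le) (use st1 st2 st3 st4 e0 in auto)
      finally show ?thesis by (simp add: \<gamma>_def)
    qed
    have "ennreal (1 / real n * (\<Sum>p\<in>grid n. norm (positive_parts (discrete_gradient a p)))) \<le> ennreal (M + \<eta>)"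
    proof -
      have "ennreal (1 / real n * (\<Sum>p\<in>grid n. norm (positive_parts (discrete_gradient a p))))
        = (\<Sum>p\<in>grid n. ennreal (1 / real n * norm (positive_parts (discrete_gradient a p))))"
        by (subst sum_ennreal) (simp_all add: sum_distrib_left)
      also have "\<dots> \<le> (\<Sum>p\<in>grid n. \<integral>\<^sup>+x. indicator (cell n p) x * ennreal (\<gamma> x + 2 * e x) \<partial>lborel)"
      proof (rule sum_mono)
        fix p assume p: "p \<in> grid n"
        define c where "c = real n * norm (positive_parts (discrete_gradient a p))"
        have "ennreal (1 / real n * norm (positive_parts (discrete_gradient a p))) = ennreal c * ennreal (1 / (real n)\<^sup>2)"
          using n by (subst ennreal_mult[symmetric]) (auto simp: c_def power2_eq_square)
        also have "\<dots> = ennreal c * emeasure lborel (cell n p)" by (simp only: emeasure_cell[OF n])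
        also have "\<dots> = (\<integral>\<^sup>+x. ennreal c * indicator (cell n p) x \<partial>lborel)" by (rule nn_integral_cmult_indicator[symmetric]) simp
        also have "\<dots> \<le> (\<integral>\<^sup>+x. indicator (cell n p) x * ennreal (\<gamma> x + 2 * e x) \<partial>lborel)"
          by (intro nn_integral_mono) (use cellbound[OF p] in \<open>auto simp: indicator_def c_def intro!: ennreal_leI\<close>)
        finally show "ennreal (1 / real n * norm (positive_parts (discrete_gradient a p))) \<le> (\<integral>\<^sup>+x. indicator (cell n p) x * ennreal (\<gamma> x + 2 * e x) \<partial>lborel)" .
      qed
      also have "\<dots> \<le> (\<integral>\<^sup>+x. indicator open_square x * ennreal (\<gamma> x + 2 * e x) \<partial>lborel)"
        by (rule sum_nn_integral_cells_le[OF n]) measurable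
      also have "\<dots> = (\<integral>\<^sup>+x. indicator open_square x * ennreal (\<gamma> x) + (indicator open_square x * ennreal (2 * (K / real n)) + ennreal (2 * L) * (indicator open_square x * ennreal (D x))) \<partial>lborel)"
      proof (rule nn_integral_cong)
        fix x
        have "ennreal (\<gamma> x + 2 * e x) = ennreal (\<gamma> x) + (ennreal (2 * (K / real n)) + ennreal (2 * L) * ennreal (D x))"
          using K0 L D0[of x] by (simp add: e_def \<gamma>_def distrib_left ennreal_plus ennreal_mult mult.assoc)
        then show "indicator open_square x * ennreal (\<gamma> x + 2 * e x) = indicator open_square x * ennreal (\<gamma> x) + (indicator open_square x * ennreal (2 * (K / real n)) + ennreal (2 * L) * (indicator open_square x * ennreal (D x)))"
          by (cases "x \<in> open_square") simp_all
      qed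
      also have "\<dots> = (\<integral>\<^sup>+x. indicator open_square x * ennreal (\<gamma> x) \<partial>lborel) + ((\<integral>\<^sup>+x. indicator open_square x * ennreal (2 * (K / real n)) \<partial>lborel) + ennreal (2 * L) * (\<integral>\<^sup>+x. indicator open_square x * ennreal (D x) \<partial>lborel))"
        by (subst nn_integral_add, measurable, subst nn_integral_add, measurable, subst nn_integral_cmult, measurable)
      also have "(\<integral>\<^sup>+x. indicator open_square x * ennreal (2 * (K / real n)) \<partial>lborel) = ennreal (2 * (K / real n))"
        by (subst nn_integral_multc) (auto simp: emeasure_open_square)
      also have "(\<integral>\<^sup>+x. indicator open_square x * ennreal (\<gamma> x) \<partial>lborel) + (ennreal (2 * (K / real n)) + ennreal (2 * L) * (\<integral>\<^sup>+x. indicator open_square x * ennreal (D x) \<partial>lborel))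
        \<le> ennreal (M + \<eta> / 4) + (ennreal (\<eta> / 4) + ennreal (2 * L) * ennreal (N * \<eta>1))"
        by (intro add_mono \<gamma>int mult_left_mono Dint ennreal_leI nK) simp
      also have "\<dots> = ennreal (M + \<eta> / 4) + (ennreal (\<eta> / 4) + ennreal (2 * (L * (N * \<eta>1))))"
        using L N0 e1 by (subst ennreal_mult[symmetric]) (auto simp: mult.assoc)
      also have "\<dots> = ennreal (M + \<eta> / 4 + (\<eta> / 4 + 2 * (L * (N * \<eta>1))))"
      proof -
        have p: "0 \<le> M + \<eta> / 4" "0 \<le> \<eta> / 4" "0 \<le> 2 * (L * (N * \<eta>1))" "0 \<le> \<eta> / 4 + 2 * (L * (N * \<eta>1))"
          using M0 \<eta> L N0 e1 by simp_all
        show ?thesis by (simp only: ennreal_plus[OF p(1,4)] ennreal_plus[OF p(2,3)])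
      qed
      also have "\<dots> \<le> ennreal (M + \<eta>)" using e1'(2) \<eta> by (intro ennreal_leI) linarith
      finally show ?thesis .
    qed
    with TVle have TV: "discrete_TV n w \<le> emeasure \<mu> (space \<mu>) + ennreal \<eta>"
      using M0 \<eta> by (simp add: emM)
    have L1: "(\<integral>x. \<bar>w x - u x\<bar> \<partial>lebesgue_on open_square) \<le> \<eta>"
    proof -
      have cells: "AE x in lborel. \<exists>p. x \<in> cell n p" using AE_in_cells by eventually_elim (use n in blast)
      have "ennreal (\<integral>x. \<bar>w x - u x\<bar> \<partial>lebesgue_on open_square) = (\<integral>\<^sup>+x. ennreal \<bar>w x - u x\<bar> \<partial>lebesgue_on open_square)"
        using wi u(1) by (intro nn_integral_eq_integral[symmetric]) auto
      also have "\<dots> = (\<integral>\<^sup>+x. ennreal \<bar>w x - u0 x\<bar> \<partial>lebesgue_on open_square)"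
        by (rule nn_integral_cong_AE) (use u0(2) in eventually_elim, simp)
      also have "\<dots> = (\<integral>\<^sup>+x. indicator open_square x * ennreal \<bar>w x - u0 x\<bar> \<partial>lborel)"
        by (rule nn_integral_lebesgue_on_open_square) (use wm in measurable)
      also have "\<dots> \<le> (\<integral>\<^sup>+x. indicator open_square x * ennreal (D x) + indicator open_square x * ennreal (N * (C * (2 / real n))) \<partial>lborel)"
      proof (rule nn_integral_mono_AE)
        show "AE x in lborel. indicator open_square x * ennreal \<bar>w x - u0 x\<bar> \<le> indicator open_square x * ennreal (D x) + indicator open_square x * ennreal (N * (C * (2 / real n)))"
          using cells
        proof eventually_elim
          case (elim y)
          then obtain p where y: "y \<in> cell n p" by blast
          have "\<bar>w y - u0 y\<bar> \<le> D y + N * (C * (2 / real n))" if yU: "y \<in> open_square"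
          proof (cases "p \<in> grid n")
            case True
            have xc: "cell_center n p \<in> closed_square"
              using cell_subset_open_square[OF True] cell_center_in_cell[OF n] os by blast
            have le1: "\<zeta> i (cell_center n p) \<le> 1" if "i \<in> I" for i
              using member_le_sum[of i I "\<lambda>i. \<zeta> i (cell_center n p)"] that I z0 z1[OF xc] by simp
            have "w y - u0 y = (\<Sum>i\<in>I. \<zeta> i (cell_center n p) * (m i (cell_center n p) - u0 y))"
              using z1[OF xc] by (simp add: wp[OF True y] aA A_def right_diff_distrib sum_subtractf flip: sum_distrib_right)
            also have "\<bar>\<dots>\<bar> \<le> (\<Sum>i\<in>I. \<bar>m i y - u0 y\<bar> + C * (2 / real n))"
            proof (rule order_trans[OF sum_abs], rule sum_mono)
              fix i assume i: "i \<in> I"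
              have "C * norm (cell_center n p - y) \<le> C * (2 / real n)"
                using dist_in_cell[OF n cell_center_in_cell[OF n] y] C by (intro mult_left_mono)
              then have "\<bar>m i (cell_center n p) - u0 y\<bar> \<le> \<bar>m i y - u0 y\<bar> + C * (2 / real n)"
                using mL[OF i, of "cell_center n p" y] by linarith
              then have "\<bar>\<zeta> i (cell_center n p)\<bar> * \<bar>m i (cell_center n p) - u0 y\<bar> \<le> 1 * (\<bar>m i y - u0 y\<bar> + C * (2 / real n))"
                using le1[OF i] z0[of i "cell_center n p"] by (intro mult_mono) auto
              then show "\<bar>\<zeta> i (cell_center n p) * (m i (cell_center n p) - u0 y)\<bar> \<le> \<bar>m i y - u0 y\<bar> + C * (2 / real n)"
                by (simp only: abs_mult mult_1_left)
            qed
            also have "\<dots> = D y + N * (C * (2 / real n))" by (simp add: sum.distrib D_def N_def)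
            finally show ?thesis .
          next
            case False
            have "y \<notin> W"
            proof
              assume "y \<in> W"
              then have "d \<le> norm (y - cell_center n p)" using d(2) cell_center_outside[OF n False] by blast
              then show False using dist_in_cell[OF n y cell_center_in_cell[OF n]] nd by linarith
            qed
            moreover have "w y = 0"
            proof -
              have "y \<notin> cell n q" if "q \<in> grid n" for q using disjoint_cells[OF n y, of q] False that by blast
              then show ?thesis unfolding w_def by (intro sum.neutral ballI) (metis indicator_simps(2) mult_zero_right)
            qed
            ultimately show ?thesis using D0[of y] N0 C by (simp add: u0W)
          qed
          then have "ennreal \<bar>w y - u0 y\<bar> \<le> ennreal (D y + N * (C * (2 / real n)))" if "y \<in> open_square"
            using that by (intro ennreal_leI)
          moreover have "ennreal (D y + N * (C * (2 / real n))) = ennreal (D y) + ennreal (N * (C * (2 / real n)))"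
            using D0[of y] N0 C by (intro ennreal_plus) auto
          ultimately have "ennreal \<bar>w y - u0 y\<bar> \<le> ennreal (D y) + ennreal (N * (C * (2 / real n)))" if "y \<in> open_square"
            using that by (simp only:)
          then show ?case by (cases "y \<in> open_square") simp_all
        qed
      qed
      also have "\<dots> = (\<integral>\<^sup>+x. indicator open_square x * ennreal (D x) \<partial>lborel) + (\<integral>\<^sup>+x. indicator open_square x * ennreal (N * (C * (2 / real n))) \<partial>lborel)"
        by (rule nn_integral_add) measurable
      also have "(\<integral>\<^sup>+x. indicator open_square x * ennreal (N * (C * (2 / real n))) \<partial>lborel) = ennreal (N * (C * (2 / real n)))"
        by (subst nn_integral_multc) (auto simp: emeasure_open_square)
      also have "(\<integral>\<^sup>+x. indicator open_square x * ennreal (D x) \<partial>lborel) + ennreal (N * (C * (2 / real n))) \<le> ennreal (\<eta> / 2) + ennreal (\<eta> / 2)"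
        using Dint e1'(1) nC by (intro add_mono ennreal_leI order_trans[OF Dint]) auto
      also have "\<dots> = ennreal \<eta>" using \<eta> by (simp flip: ennreal_plus)
      finally show ?thesis using \<eta> by (simp add: ennreal_le_iff)
    qed
    have "w \<in> constraint_set (inner_domain n S) (outer_domain n W)"
      unfolding constraint_set_def mem_Collect_eq
    proof (rule AE_I2, intro conjI impI)
      fix x assume "x \<in> inner_domain n S"
      then obtain p where p: "p \<in> grid n" "cell n p \<subseteq> shrink S (1 / real n)" "x \<in> cell n p" unfolding inner_domain_def by blast
      then have "cell_center n p \<in> S" using cell_center_in_cell[OF n, of p] by (auto simp: shrink_def)
      then show "w x = 1" by (simp add: wp[OF p(1,3)] aA AS)
    next
      fix x assume "x \<in> closed_square - outer_domain n W"
      then obtain p where p: "p \<in> grid n" "cell n p \<subseteq> shrink (closed_square - W) (1 / real n)" "x \<in> cell n p" unfolding outer_domain_def by blast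
      then have "cell_center n p \<notin> W" using cell_center_in_cell[OF n, of p] by (auto simp: shrink_def)
      then show "w x = 0" by (simp add: wp[OF p(1,3)] aA AW)
    qed
    with wi L1 TV show ?case by blast
  qed
qed

section \<open>Gamma-convergence\<close>

text \<open>
If each property of a sequence holds eventually, then so does one with slowly increasing index.
\<close>

lemma diagonal_index:
  assumes ev: "\<And>k. \<forall>\<^sub>F n in sequentially. P k n"
  obtains \<kappa> :: "nat \<Rightarrow> nat" where "filterlim \<kappa> at_top sequentially" "\<forall>\<^sub>F n in sequentially. P (\<kappa> n) n"
proof -
  have "\<forall>k. \<exists>N. \<forall>n\<ge>N. P k n" using ev by (simp add: eventually_sequentially)
  then obtain N where N: "\<And>k n. n \<ge> N k \<Longrightarrow> P k n" by metis
  define A where "A n = {k. k \<le> n \<and> (\<forall>j\<le>k. N j \<le> n)}" for n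
  have fA: "finite (A n)" for n by (rule finite_subset[of _ "{..n}"]) (auto simp: A_def)
  define \<kappa> where "\<kappa> n = Max (insert 0 (A n))" for n
  have "filterlim \<kappa> at_top sequentially"
    unfolding filterlim_at_top
  proof
    fix K
    show "\<forall>\<^sub>F n in sequentially. K \<le> \<kappa> n"
      using eventually_ge_at_top[of "max K (Max (N ` {..K}))"]
    proof eventually_elim
      case (elim n)
      have "N j \<le> n" if "j \<le> K" for j
        using elim that Max_ge[of "N ` {..K}" "N j"] by auto
      then have "K \<in> A n" using elim by (auto simp: A_def)
      then show ?case unfolding \<kappa>_def using fA by (intro Max_ge) auto
    qed
  qed
  moreover have "\<forall>\<^sub>F n in sequentially. P (\<kappa> n) n"
    using eventually_ge_at_top[of "N 0"]
  proof eventually_elim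
    case (elim n)
    have "\<kappa> n \<in> insert 0 (A n)" unfolding \<kappa>_def using fA by (intro Max_in) auto
    then have "N (\<kappa> n) \<le> n" using elim by (auto simp: A_def)
    then show ?case by (rule N)
  qed
  ultimately show ?thesis using that by blast
qed

text \<open>
If the inequality failed, then along a subsequence the functionals would stay below a finite number
smaller than the limit functional.
\<close>

lemma liminf_inequality:
  assumes S: "open S" "bounded S" and W: "open W" "strongly_lipschitz W"
    and SW: "S \<subseteq> W" and cW: "closure W \<subseteq> open_square"
    and conv: "converges_L1 (lebesgue_on open_square) w u"
  shows "total_variation open_square u + convex_indicator (constraint_set S W) u
    \<le> liminf (\<lambda>n. discrete_TV n (w n) + convex_indicator (constraint_set (inner_domain n S) (outer_domain n W)) (w n))"
    (is "?G \<le> liminf ?F")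
proof (rule ccontr)
  assume "\<not> ?G \<le> liminf ?F"
  then have "liminf ?F < ?G" by simp
  then obtain t where t: "liminf ?F < t" "t < ?G" using dense by blast
  then have "t \<noteq> top" "t \<noteq> 0" by auto
  then obtain L where L: "t = ennreal L" "L > 0" by (cases t) (auto simp: ennreal_eq_0_iff less_le)
  have wi: "\<And>n. integrable (lebesgue_on open_square) (w n)" and ui: "integrable (lebesgue_on open_square) u"
    and lim: "(\<lambda>n. \<integral>x. \<bar>w n x - u x\<bar> \<partial>lebesgue_on open_square) \<longlonglongrightarrow> 0"
    using conv by (auto simp: converges_L1_def)
  have "\<exists>\<^sub>F n in sequentially. ?F n < t"
  proof (rule ccontr)
    assume "\<not> (\<exists>\<^sub>F n in sequentially. ?F n < t)"
    then have "\<forall>\<^sub>F n in sequentially. t \<le> ?F n" by (simp add: not_frequently not_less)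
    then have "t \<le> liminf ?F" by (rule Liminf_bounded)
    with t(1) show False by simp
  qed
  then have "infinite {n. ?F n < t}" by (simp add: frequently_cofinite cofinite_eq_sequentially[symmetric])
  then obtain r where r: "strict_mono (r :: nat \<Rightarrow> nat)" "\<And>k. r k \<in> {n. ?F n < t}"
    using infinite_enumerate by blast
  have Fr: "?F (r k) < t" for k using r(2)[of k] by simp
  have wC: "w (r k) \<in> constraint_set (inner_domain (r k) S) (outer_domain (r k) W)" for k
  proof (rule ccontr)
    assume "w (r k) \<notin> constraint_set (inner_domain (r k) S) (outer_domain (r k) W)"
    then have "?F (r k) = top" by (simp add: convex_indicator_def)
    with Fr[of k] show False by simp
  qed
  have "discrete_TV (r k) (w (r k)) < t" for k
    using Fr[of k] wC[of k] by (simp add: convex_indicator_def)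
  then have "\<exists>a. grid_values (r k) a (w (r k)) \<and>
      ennreal (1 / real (r k) * (\<Sum>p\<in>grid (r k). norm (positive_parts (discrete_gradient a p)))) < t" for k
    unfolding discrete_TV_def Inf_less_iff by blast
  then obtain a where a: "\<And>k. grid_values (r k) (a k) (w (r k))"
    "\<And>k. ennreal (1 / real (r k) * (\<Sum>p\<in>grid (r k). norm (positive_parts (discrete_gradient (a k) p)))) < t" by metis
  have aL: "1 / real (r k) * (\<Sum>p\<in>grid (r k). norm (positive_parts (discrete_gradient (a k) p))) \<le> L" for k
  proof -
    have "0 \<le> 1 / real (r k) * (\<Sum>p\<in>grid (r k). norm (positive_parts (discrete_gradient (a k) p)))"
      by (intro mult_nonneg_nonneg sum_nonneg) auto
    then show ?thesis using a(2)[of k] L by (simp add: ennreal_less_iff)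
  qed
  have lim': "(\<lambda>k. \<integral>x. \<bar>w (r k) x - u x\<bar> \<partial>lebesgue_on open_square) \<longlonglongrightarrow> 0"
    using LIMSEQ_subseq_LIMSEQ[OF lim r(1)] by (simp add: comp_def)
  have "u \<in> constraint_set S W"
    by (rule constraint_passes_to_limit[OF S W SW cW r(1) wC wi ui lim'])
  moreover have "total_variation open_square u \<le> ennreal L"
    by (rule liminf_total_variation[OF r(1) a(1) wi ui lim' aL L(2)])
  ultimately have "?G \<le> t" by (simp add: convex_indicator_def L(1))
  with t(2) show False by simp
qed

lemma recovery_sequence:
  assumes S: "open S" "strongly_lipschitz S" and W: "open W" "strongly_lipschitz W"
    and SW: "S \<subseteq> W" and disj: "frontier S \<inter> frontier W = {}"
    and cW: "compact (closure W)" "closure W \<subseteq> open_square"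
    and u: "integrable (lebesgue_on open_square) u"
  shows "\<exists>w. converges_L1 (lebesgue_on open_square) w u \<and>
    limsup (\<lambda>n. discrete_TV n (w n) + convex_indicator (constraint_set (inner_domain n S) (outer_domain n W)) (w n))
      \<le> total_variation open_square u + convex_indicator (constraint_set S W) u"
proof (cases "total_variation open_square u + convex_indicator (constraint_set S W) u = top")
  case True
  show ?thesis unfolding True using u by (intro exI[of _ "\<lambda>_. u"]) (simp add: converges_L1_def)
next
  case False
  then have uC: "u \<in> constraint_set S W" and TVfin: "total_variation open_square u \<noteq> top"
    by (auto simp: convex_indicator_def split: if_splits)
  define P where "P k n w \<longleftrightarrow> integrable (lebesgue_on open_square) w \<and>
      (\<integral>x. \<bar>w x - u x\<bar> \<partial>lebesgue_on open_square) \<le> 1 / real (Suc k) \<and>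
      discrete_TV n w \<le> total_variation open_square u + ennreal (2 / real (Suc k)) \<and>
      w \<in> constraint_set (inner_domain n S) (outer_domain n W)" for k n w
  have ev: "\<forall>\<^sub>F n in sequentially. \<exists>w. P k n w" for k
  proof -
    define \<eta> where "\<eta> = 1 / real (Suc k)"
    have \<eta>: "\<eta> > 0" by (simp add: \<eta>_def)
    have "total_variation open_square u < total_variation open_square u + ennreal \<eta>"
    proof -
      obtain T where T: "total_variation open_square u = ennreal T" "0 \<le> T"
        using TVfin by (cases "total_variation open_square u") auto
      have "ennreal T < ennreal (T + \<eta>)" using T(2) \<eta> by (subst ennreal_less_iff) auto
      then show ?thesis using T(2) \<eta> by (simp add: T(1) ennreal_plus)
    qed
    then have "Inf {emeasure \<mu> (space \<mu>) | \<mu> \<sigma>. has_gradient_measure u open_square \<sigma> \<mu>} < total_variation open_square u + ennreal \<eta>"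
      by (subst (asm) (1) total_variation_def)
    then obtain \<mu> \<sigma> where grad: "has_gradient_measure u open_square \<sigma> \<mu>"
      and mass: "emeasure \<mu> (space \<mu>) < total_variation open_square u + ennreal \<eta>"
      unfolding Inf_less_iff by blast
    have 2: "total_variation open_square u + ennreal \<eta> + ennreal \<eta> = total_variation open_square u + ennreal (2 / real (Suc k))"
      using \<eta> by (simp add: \<eta>_def add.assoc flip: ennreal_plus)
    show ?thesis
      using mollified_recovery[OF S W SW disj cW u uC grad \<eta>]
    proof eventually_elim
      case (elim n)
      then obtain w where w: "integrable (lebesgue_on open_square) w"
        "(\<integral>x. \<bar>w x - u x\<bar> \<partial>lebesgue_on open_square) \<le> \<eta>"
        "discrete_TV n w \<le> emeasure \<mu> (space \<mu>) + ennreal \<eta>"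
        "w \<in> constraint_set (inner_domain n S) (outer_domain n W)" by blast
      have "discrete_TV n w \<le> total_variation open_square u + ennreal (2 / real (Suc k))"
        using order_trans[OF w(3) add_right_mono[OF less_imp_le[OF mass]]] by (simp only: 2)
      then have "P k n w" using w unfolding P_def \<eta>_def by blast
      then show ?case by blast
    qed
  qed
  obtain \<kappa> where \<kappa>: "filterlim \<kappa> at_top sequentially" "\<forall>\<^sub>F n in sequentially. \<exists>w. P (\<kappa> n) n w"
    using diagonal_index[of "\<lambda>k n. \<exists>w. P k n w", OF ev] by blast
  \<comment> \<open>The finitely many indices without a good candidate get the default value
      \<open>u\<close>, which is integrable.\<close>
  define w where "w n = (if \<exists>v. P (\<kappa> n) n v then SOME v. P (\<kappa> n) n v else u)" for n
  have wP: "\<forall>\<^sub>F n in sequentially. P (\<kappa> n) n (w n)"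
    using \<kappa>(2)
  proof eventually_elim
    case (elim n)
    then show ?case unfolding w_def using someI_ex[OF elim] by simp
  qed
  have wi: "integrable (lebesgue_on open_square) (w n)" for n
  proof (cases "\<exists>v. P (\<kappa> n) n v")
    case True
    then have "P (\<kappa> n) n (w n)" unfolding w_def using someI_ex[OF True] by simp
    then show ?thesis by (simp add: P_def)
  qed (simp add: w_def u)
  have inv: "(\<lambda>n. c / real (Suc (\<kappa> n))) \<longlonglongrightarrow> 0" for c :: real
  proof -
    have "filterlim (\<lambda>n. real (Suc (\<kappa> n))) at_top sequentially"
      using filterlim_compose[OF filterlim_real_sequentially filterlim_compose[OF filterlim_Suc \<kappa>(1)]] .
    then show ?thesis by (rule real_tendsto_divide_at_top[OF tendsto_const])
  qed
  have "(\<lambda>n. \<integral>x. \<bar>w n x - u x\<bar> \<partial>lebesgue_on open_square) \<longlonglongrightarrow> 0"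
    by (rule Lim_null_comparison[OF _ inv[of 1]]) (use wP in \<open>auto elim!: eventually_mono simp: P_def\<close>)
  then have "converges_L1 (lebesgue_on open_square) w u" using wi u by (simp add: converges_L1_def)
  moreover have "limsup (\<lambda>n. discrete_TV n (w n) + convex_indicator (constraint_set (inner_domain n S) (outer_domain n W)) (w n))
      \<le> limsup (\<lambda>n. total_variation open_square u + ennreal (2 / real (Suc (\<kappa> n))))"
    by (rule Limsup_mono) (use wP in \<open>auto elim!: eventually_mono simp: P_def convex_indicator_def\<close>)
  moreover have "limsup (\<lambda>n. total_variation open_square u + ennreal (2 / real (Suc (\<kappa> n)))) = total_variation open_square u"
  proof (rule lim_imp_Limsup)
    have "(\<lambda>n. total_variation open_square u + ennreal (2 / real (Suc (\<kappa> n)))) \<longlonglongrightarrow> total_variation open_square u + ennreal 0"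
      by (intro tendsto_add tendsto_const tendsto_ennrealI inv)
    then show "(\<lambda>n. total_variation open_square u + ennreal (2 / real (Suc (\<kappa> n)))) \<longlonglongrightarrow> total_variation open_square u" by simp
  qed simp
  ultimately show ?thesis using uC by (intro exI[of _ w]) (simp add: convex_indicator_def)
qed

theorem theorem7:
  fixes \<Omega>\<^sub>s \<Omega> :: "(real \<times> real) set"
  assumes "open \<Omega>\<^sub>s" and "bounded \<Omega>\<^sub>s" and "strongly_lipschitz \<Omega>\<^sub>s"
    and "open \<Omega>" and "bounded \<Omega>" and "strongly_lipschitz \<Omega>"
    and "\<Omega>\<^sub>s \<subseteq> \<Omega>"
    and "compact (closure \<Omega>)" and "closure \<Omega> \<subseteq> open_square"
    and "frontier \<Omega>\<^sub>s \<inter> frontier \<Omega> = {}"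
    and "finite (components \<Omega>\<^sub>s)"
  shows "gamma_converges_L1 (lebesgue_on open_square)
    (\<lambda>n v. discrete_TV n v +
       convex_indicator (constraint_set (inner_domain n \<Omega>\<^sub>s) (outer_domain n \<Omega>)) v)
    (\<lambda>v. total_variation open_square v + convex_indicator (constraint_set \<Omega>\<^sub>s \<Omega>) v)"
  unfolding gamma_converges_L1_def
  using liminf_inequality[OF assms(1,2,4,6,7,9)] recovery_sequence[OF assms(1,3,4,6,7,10,8,9)] by blast

end
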